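(* Let $n\ge2$ be an integer, $s\in(0,1)$, and for $\varepsilon>0$ define $$\Omega_\varepsilon:=\Big\{(x_1,x')\in\mathbb R\times\mathbb R^{n-1} : \frac{x_1^2}{(1+\varepsilon)^2}+|x'|^2<1\Big\}.$$ Then, for $0<\varepsilon<1/4$, there exists a one-parameter family of open sets $G_\varepsilon\subset\Omega_\varepsilon$ with smooth boundary such that $G_\varepsilon+B_{1/2}=\Omega_\varepsilon$ and such that, moreover, if $u_\varepsilon\in C^2(\Omega_\varepsilon)\cap C^s(\mathbb R^n)$ is the unique solution to $$(-\Delta)^su_\varepsilon=1\ \text{ in }\Omega_\varepsilon,\qquad u_\varepsilon=0\ \text{ in }\mathbb R^n\setminus\Omega_\varepsilon,$$ then $$\lim_{\varepsilon\to0^+}\frac{[u_\varepsilon]_{\partial G_\varepsilon}}{\rho(\Omega_\varepsilon)}=s\,\gamma_{n,s}\Big(\frac34\Big)^{s-1},\qquad\text{where}\quad\gamma_{n,s}:=\frac{2^{-2s}\,\Gamma\big(\frac n2\big)}{\Gamma\big(\frac{n+2s}2\big)\Gamma(1+s)}.$$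
   Context: $B_{1/2}$ is the open ball of radius $1/2$ centred at $0$; $A+B=\{a+b:a\in A,b\in B\}$. $\rho(\Omega)=\inf\{R_2-R_1 : B_{R_1}(x)\subset\Omega\subset B_{R_2}(x)\text{ for some }x\in\Omega\}$. $[u]_{\partial G}=\sup_{x\neq y\in\partial G}\frac{|u(x)-u(y)|}{|x-y|}$. The fractional Laplacian is $(-\Delta)^su(x)=c_{n,s}\,\mathrm{P.V.}\int_{\mathbb R^n}\frac{u(x)-u(y)}{|x-y|^{n+2s}}dy$ with $c_{n,s}>0$ the standard normalization constant (the one for which $\gamma_{n,s}(1-|x|^2)_+^s$ has fractional Laplacian equal to $1$ in $B_1$). *)

theory Defs
  imports "HOL-Analysis.Analysis" "HOL-Library.Set_Algebras"
begin

text \<open>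
  The predicate is meant for open \<open>S\<close>: \<open>f\<close> and all its iterated directional derivatives of
  order at most \<open>k\<close> exist and are continuous on \<open>S\<close>.
\<close>

fun C_k_on :: "nat \<Rightarrow> 'a::euclidean_space set \<Rightarrow> ('a \<Rightarrow> real) \<Rightarrow> bool" where
  "C_k_on 0 S f \<longleftrightarrow> continuous_on S f"
| "C_k_on (Suc k) S f \<longleftrightarrow>
     (\<forall>x\<in>S. f differentiable (at x)) \<and>
     (\<forall>v. C_k_on k S (\<lambda>x. frechet_derivative f (at x) v))"

definition smooth_on :: "'a::euclidean_space set \<Rightarrow> ('a \<Rightarrow> real) \<Rightarrow> bool" where
  "smooth_on S f \<longleftrightarrow> (\<forall>k. C_k_on k S f)"

text \<open>
  Near each boundary point, \<open>G\<close> is the region below the graph of a \<open>C\<^sup>\<infinity>\<close> function in a suitably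
  rotated coordinate system. The unit vector \<open>\<nu>\<close> is the vertical axis, \<open>x \<bullet> \<nu>\<close> the height of \<open>x\<close>,
  and \<open>x - (x \<bullet> \<nu>) *\<^sub>R \<nu>\<close> its horizontal part, a point of the hyperplane orthogonal to \<open>\<nu>\<close>.
  Only the values of \<open>g\<close> on that hyperplane matter; \<open>g\<close> is defined on a ball of the ambient space,
  which is no restriction since it may be extended constantly along \<open>\<nu>\<close>.
\<close>

definition smooth_boundary :: "'a::euclidean_space set \<Rightarrow> bool" where
  "smooth_boundary G \<longleftrightarrow>
     (\<forall>p\<in>frontier G. \<exists>r>0. \<exists>\<nu> g. norm \<nu> = 1 \<and>
        smooth_on (ball (p - (p \<bullet> \<nu>) *\<^sub>R \<nu>) r) g \<and>
        G \<inter> ball p r = {x \<in> ball p r. x \<bullet> \<nu> < g (x - (x \<bullet> \<nu>) *\<^sub>R \<nu>)})"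

definition holder_space :: "real \<Rightarrow> ('a::metric_space \<Rightarrow> real) set" where
  "holder_space \<alpha> =
     {u. bounded (range u) \<and> (\<exists>C. \<forall>x y. \<bar>u x - u y\<bar> \<le> C * dist x y powr \<alpha>)}"

text \<open>
  The explicit value of the standard constant \<open>c\<^bsub>n,s\<^esub>\<close>. It is the one for which the operator has
  Fourier multiplier \<open>\<bar>\<xi>\<bar>\<^bsup>2s\<^esup>\<close>, equivalently for which \<open>torsion_const n s * (1 - \<bar>x\<bar>\<^sup>2)\<^sub>+\<^bsup>s\<^esup>\<close>
  has fractional Laplacian \<open>1\<close> in the unit ball.
\<close>

definition frac_laplacian_const :: "nat \<Rightarrow> real \<Rightarrow> real" where
  "frac_laplacian_const n s =
     2 powr (2 * s) * s * Gamma ((real n + 2 * s) / 2) / (pi powr (real n / 2) * Gamma (1 - s))"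

definition torsion_const :: "nat \<Rightarrow> real \<Rightarrow> real" where
  "torsion_const n s =
     2 powr (- 2 * s) * Gamma (real n / 2) / (Gamma ((real n + 2 * s) / 2) * Gamma (1 + s))"

text \<open>
  \<open>has_frac_laplacian s u x L\<close>: the principal value defining \<open>(-\<Delta>)\<^sup>s u(x)\<close> exists and equals \<open>L\<close>.
  Integrability of the truncated integrand is demanded explicitly because the library integral of
  a non-integrable function is \<open>0\<close>.
\<close>

definition has_frac_laplacian ::
    "real \<Rightarrow> ('a::euclidean_space \<Rightarrow> real) \<Rightarrow> 'a \<Rightarrow> real \<Rightarrow> bool" where
  "has_frac_laplacian s u x L \<longleftrightarrow>
     (let n = DIM('a); f = (\<lambda>y. (u x - u y) / dist x y powr (real n + 2 * s)) in
       (\<forall>\<delta>>0. set_integrable lborel (- ball x \<delta>) f) \<and>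
       ((\<lambda>\<delta>. frac_laplacian_const n s * (LINT y : - ball x \<delta> | lborel. f y)) \<longlongrightarrow> L)
         (at_right 0))"

definition torsion_solution ::
    "real \<Rightarrow> 'a::euclidean_space set \<Rightarrow> ('a \<Rightarrow> real) \<Rightarrow> bool" where
  "torsion_solution s \<Omega> u \<longleftrightarrow>
     C_k_on 2 \<Omega> u \<and> u \<in> holder_space s \<and>
     (\<forall>x\<in>\<Omega>. has_frac_laplacian s u x 1) \<and> (\<forall>x. x \<notin> \<Omega> \<longrightarrow> u x = 0)"

definition rho :: "'a::metric_space set \<Rightarrow> real" where
  "rho \<Omega> = Inf {R2 - R1 | R1 R2. 0 < R1 \<and> (\<exists>x\<in>\<Omega>. ball x R1 \<subseteq> \<Omega> \<and> \<Omega> \<subseteq> ball x R2)}"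

text \<open>Extended real valued, so that it is \<open>\<infinity>\<close> when the difference quotients are unbounded.\<close>

definition lip_seminorm :: "'a::metric_space set \<Rightarrow> ('a \<Rightarrow> real) \<Rightarrow> ereal" where
  "lip_seminorm S u =
     (SUP (x, y) \<in> {(x, y). x \<in> S \<and> y \<in> S \<and> x \<noteq> y}. ereal (\<bar>u x - u y\<bar> / dist x y))"

text \<open>\<open>\<real>\<^sup>n\<close> is rendered as \<open>\<real> \<times> \<real>\<^bsup>n-1\<^esup>\<close>; the norm on the product type is the Euclidean one.\<close>

definition ellipsoid :: "real \<Rightarrow> (real \<times> (real ^ 'm)) set" where
  "ellipsoid \<epsilon> = {(x1, x'). x1\<^sup>2 / (1 + \<epsilon>)\<^sup>2 + (norm x')\<^sup>2 < 1}"

end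

theory Submission
  imports Defs
begin

text \<open>
  The torsion function of an ellipsoid is explicit: with \<open>A\<close> the linear map that takes the ellipsoid to
  the unit ball, it is \<open>K (1 - \<bar>A x\<bar>\<^sup>2)\<^sub>+\<^sup>s\<close> for a constant \<open>K\<close>. Indeed, on every line through \<open>x\<close> this
  function is a rescaled copy of \<open>(1 - y\<^sup>2)\<^sub>+\<^sup>s\<close> on \<open>(- 1, 1)\<close>, whose one-dimensional fractional Laplacian
  is constant, and by homogeneity of the kernel the scaling factors combine to a power of \<open>\<bar>A w\<bar>\<close> that
  depends on the direction \<open>w\<close> only; so integrating over the directions gives the same value at every \<open>x\<close>.
  As \<open>\<epsilon> \<rightarrow> 0\<close> the constant \<open>K\<close> tends to \<open>\<gamma>\<^bsub>n,s\<^esub>\<close>.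

  The set \<open>G\<close> consists of the centres of the closed balls of radius \<open>1/2\<close> inside the ellipsoid. At the point
  of its boundary with outer unit normal \<open>\<nu>\<close>, the value of \<open>1 - \<bar>A x\<bar>\<^sup>2\<close> depends only on \<open>\<nu>\<^sub>1\<^sup>2\<close> and equals
  \<open>3/4 - \<epsilon> \<nu>\<^sub>1\<^sup>2 / 2\<close> up to \<open>O(\<epsilon>\<^sup>2)\<close>, whereas distances in the boundary are half those of the normals up
  to a factor \<open>1 + O(\<epsilon>)\<close>. The limit then follows from \<open>\<bar>\<nu>\<^sub>1\<^sup>2 - \<phi>\<^sub>1\<^sup>2\<bar> \<le> \<bar>\<nu> - \<phi>\<bar>\<close> on the unit sphere, which is sharp
  near the latitude \<open>45\<close> degrees, and from \<open>\<rho> = \<epsilon>\<close>.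
\<close>

section \<open>Iterated differentiability\<close>

text \<open>Depth 1/2 is less than 1/a, the least radius of curvature of the ellipsoid, so inner
  tangent balls of that radius fit and the parallel surface stays smooth. By rotational symmetry it
  depends on one real parameter, and smoothness reduces to inverting functions of one variable. The
  analytic obstacle is the one-dimensional principal value. The truncation that can be integrated in
  closed form is asymmetric; making it symmetric costs O(h^(2 - 2 s)), which vanishes because s < 1.
  The limit concerns arbitrary solutions, so a maximum principle has to identify them with the
  explicit one. The constant K is never evaluated: the integral over directions is pinched between
  a^(-2 s) and 1 times its value for the ball. Origin of the limit: 3/4 = 1 - (1/2)^2; to first
  order the solution changes by \<gamma> s (3/4)^(s - 1) \<epsilon> / 2 per unit of the squared
  first component of the normal, halved distances contribute a factor 2, and dividing by
  \<open>rho\<close> removes \<epsilon>.\<close>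

lemma C_k_on_cong:
  assumes "open S" "\<And>x. x \<in> S \<Longrightarrow> f x = g x" "C_k_on k S f"
  shows "C_k_on k S g"
  using assms(2,3)
proof (induction k arbitrary: f g)
  case 0
  then show ?case
    by (metis C_k_on.simps(1) continuous_on_cong)
next
  case (Suc k)
  have d: "(g has_derivative frechet_derivative f (at x)) (at x)" if "x \<in> S" for x
    using Suc.prems \<open>open S\<close> that
    by (metis C_k_on.simps(2) frechet_derivative_works has_derivative_transform_within_open)
  moreover have "C_k_on k S (\<lambda>x. frechet_derivative g (at x) v)" for v
  proof (rule Suc.IH)
    show "C_k_on k S (\<lambda>x. frechet_derivative f (at x) v)"
      using Suc.prems by simp
  next
    fix x assume "x \<in> S"
    then show "frechet_derivative f (at x) v = frechet_derivative g (at x) v"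
      using d frechet_derivative_at by metis
  qed
  ultimately show ?case
    by (auto simp: differentiable_def)
qed

text \<open>\<open>frechet_derivative\<close> is a choice operator. Uniqueness of derivatives
  identifies it with any derivative found by calculus, and openness of \<open>S\<close> lets the
  iterated condition pass from one to the other.\<close>

lemma C_k_on_SucI:
  assumes "open S" "\<And>x. x \<in> S \<Longrightarrow> (f has_derivative f' x) (at x)"
    and "\<And>v. C_k_on k S (\<lambda>x. f' x v)"
  shows "C_k_on (Suc k) S f"
proof -
  have "C_k_on k S (\<lambda>x. frechet_derivative f (at x) v)" for v
    by (rule C_k_on_cong[OF assms(1) _ assms(3)[of v]]) (metis assms(2) frechet_derivative_at)
  then show ?thesis
    using assms(2) by (auto simp: differentiable_def)
qed

lemma C_k_on_has_derivative:
  assumes "C_k_on (Suc k) S f" "x \<in> S"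
  shows "(f has_derivative frechet_derivative f (at x)) (at x)"
  using assms by (simp add: frechet_derivative_works)

lemma C_k_on_SucD: "C_k_on (Suc k) S f \<Longrightarrow> C_k_on k S f"
proof (induction k arbitrary: f)
  case 0
  then show ?case
    by (auto intro!: continuous_at_imp_continuous_on differentiable_imp_continuous_within)
next
  case (Suc k)
  then show ?case
    by (metis C_k_on.simps(2))
qed

lemma C_k_on_const: "C_k_on k S (\<lambda>x. c)"
proof (induction k arbitrary: c)
  case (Suc k)
  then show ?case by (simp add: frechet_derivative_const)
qed simp

lemma C_k_on_bounded_linear:
  assumes "open S" "bounded_linear f"
  shows "C_k_on k S f"
proof (cases k)
  case 0
  then show ?thesis
    using assms(2) by (simp add: linear_continuous_on)
next
  case (Suc j)
  have "(f has_derivative f) (at x)" for x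
    using assms(2) by (rule bounded_linear_imp_has_derivative)
  then show ?thesis
    unfolding Suc using assms(1) by (intro C_k_on_SucI[where f'="\<lambda>_. f"] C_k_on_const)
qed

lemma C_k_on_add:
  assumes "open S" "C_k_on k S f" "C_k_on k S g"
  shows "C_k_on k S (\<lambda>x. f x + g x)"
  using assms(2,3)
proof (induction k arbitrary: f g)
  case 0
  then show ?case by (auto intro: continuous_intros)
next
  case (Suc k)
  show ?case
  proof (rule C_k_on_SucI[OF assms(1)])
    fix x assume "x \<in> S"
    then show "((\<lambda>x. f x + g x) has_derivative
        (\<lambda>v. frechet_derivative f (at x) v + frechet_derivative g (at x) v)) (at x)"
      using Suc.prems by (intro has_derivative_add C_k_on_has_derivative) auto
  qed (use Suc in auto)
qed

lemma C_k_on_mult: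
  assumes "open S" "C_k_on k S f" "C_k_on k S g"
  shows "C_k_on k S (\<lambda>x. f x * g x)"
  using assms(2,3)
proof (induction k arbitrary: f g)
  case 0
  then show ?case by (auto intro: continuous_intros)
next
  case (Suc k)
  show ?case
  proof (rule C_k_on_SucI[OF assms(1)])
    fix x assume "x \<in> S"
    then show "((\<lambda>x. f x * g x) has_derivative
        (\<lambda>v. f x * frechet_derivative g (at x) v + frechet_derivative f (at x) v * g x)) (at x)"
      using Suc.prems by (intro has_derivative_mult C_k_on_has_derivative) auto
  next
    fix v
    show "C_k_on k S (\<lambda>x. f x * frechet_derivative g (at x) v + frechet_derivative f (at x) v * g x)"
      using Suc.prems Suc.prems[THEN C_k_on_SucD]
      by (intro C_k_on_add[OF assms(1)] Suc.IH) auto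
  qed
qed

lemma C_k_on_minus:
  assumes "open S" "C_k_on k S f"
  shows "C_k_on k S (\<lambda>x. - f x)"
  using C_k_on_mult[OF assms(1) C_k_on_const[of k S "-1"] assms(2)] by simp

lemma C_k_on_diff:
  assumes "open S" "C_k_on k S f" "C_k_on k S g"
  shows "C_k_on k S (\<lambda>x. f x - g x)"
  using C_k_on_add[OF assms(1,2) C_k_on_minus[OF assms(1,3)]] by simp

lemma C_k_on_power:
  assumes "open S" "C_k_on k S f"
  shows "C_k_on k S (\<lambda>x. f x ^ n)"
  by (induction n) (auto intro: C_k_on_const C_k_on_mult[OF assms])

lemma C_k_on_compose:
  fixes \<phi> :: "real \<Rightarrow> real"
  assumes "open S" "C_k_on k S f" "open T" "C_k_on k T \<phi>" "f ` S \<subseteq> T"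
  shows "C_k_on k S (\<lambda>x. \<phi> (f x))"
  using assms(2,4)
proof (induction k arbitrary: \<phi>)
  case 0
  then show ?case
    using assms(5) by (auto intro: continuous_on_compose2)
next
  case (Suc k)
  \<comment> \<open>A linear map on the reals is multiplication by its value at 1, so the chain rule
    becomes a product. The outer function is replaced by its derivative, hence the generalization
    over \<open>\<phi>\<close>.\<close>
  let ?d = "\<lambda>t. frechet_derivative \<phi> (at t) 1"
  have "((\<lambda>x. \<phi> (f x)) has_derivative (\<lambda>v. frechet_derivative f (at x) v * ?d (f x))) (at x)"
    if "x \<in> S" for x
  proof -
    have \<phi>: "(\<phi> has_derivative frechet_derivative \<phi> (at (f x))) (at (f x))"
      using assms(5) that by (intro C_k_on_has_derivative[OF Suc.prems(2)]) auto
    have lin: "frechet_derivative \<phi> (at (f x)) h = h * ?d (f x)" for h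
      using linear_cmul[OF has_derivative_linear[OF \<phi>], of h 1] by simp
    show ?thesis
      using has_derivative_compose[OF C_k_on_has_derivative[OF Suc.prems(1) that] \<phi>]
      by (subst (asm) lin)
  qed
  then show ?case
  proof (rule C_k_on_SucI[OF assms(1)])
    fix v
    show "C_k_on k S (\<lambda>x. frechet_derivative f (at x) v * ?d (f x))"
    proof (rule C_k_on_mult[OF assms(1)])
      show "C_k_on k S (\<lambda>x. ?d (f x))"
        by (rule Suc.IH[OF C_k_on_SucD[OF Suc.prems(1)]]) (use Suc.prems(2) in simp)
    qed (use Suc.prems(1) in simp)
  qed
qed

lemma C_k_on_real_SucI:
  fixes f :: "real \<Rightarrow> real"
  assumes "open S" "\<And>x. x \<in> S \<Longrightarrow> (f has_field_derivative f' x) (at x)" "C_k_on k S f'"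
  shows "C_k_on (Suc k) S f"
proof (rule C_k_on_SucI[OF assms(1)])
  show "(f has_derivative (\<lambda>v. f' x * v)) (at x)" if "x \<in> S" for x
    using assms(2)[OF that] by (simp add: has_field_derivative_def)
  show "C_k_on k S (\<lambda>x. f' x * v)" for v
    by (rule C_k_on_mult[OF assms(1,3) C_k_on_const])
qed

lemma C_k_on_inverse: "C_k_on k (- {0}) (inverse :: real \<Rightarrow> real)"
proof (induction k)
  case 0
  then show ?case by (auto intro: continuous_intros)
next
  case (Suc k)
  have o: "open (- {0 :: real})" by auto
  show ?case
    by (rule C_k_on_real_SucI[OF o, where f'="\<lambda>x. - (inverse x * inverse x)"])
      (auto intro!: C_k_on_minus C_k_on_mult o Suc derivative_eq_intros simp: power2_eq_square)
qed

lemma C_k_on_powr: "C_k_on k {0<..} (\<lambda>t. t powr p)"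
proof (induction k arbitrary: p)
  case 0
  then show ?case by (auto intro!: continuous_intros)
next
  case (Suc k)
  show ?case
    by (rule C_k_on_real_SucI[where f'="\<lambda>t. p * t powr (p - 1)"])
      (auto intro!: C_k_on_mult C_k_on_const Suc derivative_eq_intros)
qed

lemma C_k_on_subset: "C_k_on k S f \<Longrightarrow> T \<subseteq> S \<Longrightarrow> C_k_on k T f"
  by (induction k arbitrary: f) (auto intro: continuous_on_subset)

text \<open>Bootstrap on (f^-1)' = 1 / f'(f^-1): if the inverse is C^k, so is the right-hand side by
  composition, and the inverse is C^(k+1). Openness of the image is invariance of domain.\<close>

lemma C_k_on_inverse_function:
  fixes f :: "real \<Rightarrow> real"
  assumes "open S" "inj_on f S"
    and "\<And>y. y \<in> S \<Longrightarrow> (f has_field_derivative f' y) (at y)"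
    and "\<And>y. y \<in> S \<Longrightarrow> f' y \<noteq> 0" and "\<And>k. C_k_on k S f'"
  shows "open (f ` S)" and "C_k_on k (f ` S) (the_inv_into S f)"
proof -
  have cf: "continuous_on S f"
    by (rule DERIV_continuous_on[OF has_field_derivative_at_within[OF assms(3)]])
  show o: "open (f ` S)"
    by (rule invariance_of_domain[OF cf assms(1,2)])
  have d: "(the_inv_into S f has_field_derivative inverse (f' (the_inv_into S f t))) (at t)"
    if t: "t \<in> f ` S" for t
  proof -
    obtain y where y: "y \<in> S" "t = f y" using t by auto
    have "(the_inv_into S f has_derivative (*) (inverse (f' y))) (at (f y))"
    proof (rule has_derivative_inverse_strong[OF assms(1) y(1) cf])
      show "(f has_derivative (*) (f' y)) (at y)"
        using assms(3)[OF y(1)] by (simp add: has_field_derivative_def)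
      show "(*) (f' y) \<circ> (*) (inverse (f' y)) = id"
        using assms(4)[OF y(1)] by (auto simp: fun_eq_iff)
    qed (simp add: the_inv_into_f_f assms(2))
    then show ?thesis
      using y assms(2) by (simp add: the_inv_into_f_f has_field_derivative_def)
  qed
  have im: "the_inv_into S f ` f ` S \<subseteq> S"
    using assms(2) by (auto simp: the_inv_into_f_f)
  show "C_k_on k (f ` S) (the_inv_into S f)"
  proof (induction k)
    case 0
    then show ?case
      using DERIV_continuous_on[OF has_field_derivative_at_within[OF d]] by simp
  next
    case (Suc k)
    have n0: "open (- {0 :: real})" by auto
    have "C_k_on k (f ` S) (\<lambda>t. f' (the_inv_into S f t))"
      by (rule C_k_on_compose[OF o Suc assms(1,5) im])
    then have "C_k_on k (f ` S) (\<lambda>t. inverse (f' (the_inv_into S f t)))"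
      by (rule C_k_on_compose[OF o _ n0 C_k_on_inverse]) (use assms(2,4) in \<open>auto simp: the_inv_into_f_f\<close>)
    with d show ?case
      by (rule C_k_on_real_SucI[OF o])
  qed
qed

lemma C_k_on_ident: "open S \<Longrightarrow> C_k_on k S (\<lambda>x. x)"
  by (rule C_k_on_bounded_linear) (auto intro: bounded_linear_ident)

lemma C_k_on_divide_const:
  assumes "open S" "C_k_on k S f"
  shows "C_k_on k S (\<lambda>x. f x / c)"
  using C_k_on_mult[OF assms C_k_on_const[of k S "1 / c"]] by simp

lemma C_k_on_sqrt: "C_k_on k {0<..} sqrt"
  by (rule C_k_on_cong[OF _ _ C_k_on_powr[of k "1/2"]]) (auto simp: powr_half_sqrt)

lemma C_k_on_norm_sq:
  assumes "open S" "bounded_linear L"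
  shows "C_k_on k S (\<lambda>x. (norm (L x :: 'b::real_inner))\<^sup>2)"
proof (cases k)
  case 0
  then show ?thesis
    using linear_continuous_on[OF assms(2)] by (auto intro!: continuous_on_power continuous_on_norm)
next
  case (Suc j)
  have "((\<lambda>x. (norm (L x))\<^sup>2) has_derivative (\<lambda>v. 2 * (L x \<bullet> L v))) (at x)" for x
    unfolding power2_norm_eq_inner
    by (auto intro!: derivative_eq_intros bounded_linear_imp_has_derivative[OF assms(2)]
        simp: inner_commute)
  moreover have "bounded_linear (\<lambda>x. 2 * (L x \<bullet> L v))" for v
    by (intro bounded_linear_const_mult bounded_linear_inner_left_comp assms(2))
  ultimately show ?thesis
    unfolding Suc using assms(1)
    by (intro C_k_on_SucI[where f'="\<lambda>x v. 2 * (L x \<bullet> L v)"] C_k_on_bounded_linear)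
qed

text \<open>The definition asks for one radius, both for the domain of the graph function and for
  the neighbourhood of \<open>p\<close>. The minimum of two radii allows two unrelated open sets
  instead.\<close>

lemma smooth_boundaryI:
  assumes "\<And>p. p \<in> frontier G \<Longrightarrow> \<exists>\<nu> g U V. norm \<nu> = 1 \<and> open U \<and> open V \<and> p \<in> V \<and>
      p - (p \<bullet> \<nu>) *\<^sub>R \<nu> \<in> U \<and> (\<forall>k. C_k_on k U g) \<and>
      (\<forall>x\<in>V. x \<in> G \<longleftrightarrow> x \<bullet> \<nu> < g (x - (x \<bullet> \<nu>) *\<^sub>R \<nu>))"
  shows "smooth_boundary G"
  unfolding smooth_boundary_def
proof
  fix p assume "p \<in> frontier G"
  from assms[OF this] obtain \<nu> g U V where *: "norm \<nu> = 1" "open U" "open V" "p \<in> V"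
    "p - (p \<bullet> \<nu>) *\<^sub>R \<nu> \<in> U" "\<And>k. C_k_on k U g"
    "\<And>x. x \<in> V \<Longrightarrow> x \<in> G \<longleftrightarrow> x \<bullet> \<nu> < g (x - (x \<bullet> \<nu>) *\<^sub>R \<nu>)" by metis
  obtain r1 where r1: "r1 > 0" "ball (p - (p \<bullet> \<nu>) *\<^sub>R \<nu>) r1 \<subseteq> U"
    using *(2,5) openE by blast
  obtain r2 where r2: "r2 > 0" "ball p r2 \<subseteq> V"
    using *(3,4) openE by blast
  define r where "r = min r1 r2"
  have "ball (p - (p \<bullet> \<nu>) *\<^sub>R \<nu>) r \<subseteq> U" "ball p r \<subseteq> V" "r > 0"
    using r1 r2 by (auto simp: r_def)
  then show "\<exists>r>0. \<exists>\<nu> g. norm \<nu> = 1 \<and> smooth_on (ball (p - (p \<bullet> \<nu>) *\<^sub>R \<nu>) r) g \<and>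
      G \<inter> ball p r = {x \<in> ball p r. x \<bullet> \<nu> < g (x - (x \<bullet> \<nu>) *\<^sub>R \<nu>)}"
    using *(1,6,7) C_k_on_subset unfolding smooth_on_def
    by (intro exI[of _ r] exI[of _ \<nu>] exI[of _ g] conjI) blast+
qed

section \<open>The inner parallel set of the ellipsoid\<close>

text \<open>In meridian coordinates p = (a^2 N1, N2) is a boundary point, N is half the gradient of
  the quadratic form there, and \<mu> N is the unit normal. The ball has centre p - \<mu> N / 2, and
  v is the displacement from p. Lying in the ball means |v|^2 + \<mu> v.N <= 0, so v.N <= 0, and the
  form at p + v is at most 1 + 2 v.N + |v|^2 <= 1 + (2 - \<mu>) v.N.\<close>

lemma interior_ball_scalar:
  fixes a \<mu> N1 N2 w1 w2 :: real
  assumes "1 \<le> a" "0 < \<mu>" "\<mu> < 2" "N1\<^sup>2 + N2\<^sup>2 = (inverse \<mu>)\<^sup>2" "a\<^sup>2 * N1\<^sup>2 + N2\<^sup>2 = 1"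
    and "w1\<^sup>2 + w2\<^sup>2 \<le> 1/4"
  shows "((a\<^sup>2 - \<mu>/2) * N1 + w1)\<^sup>2 / a\<^sup>2 + ((1 - \<mu>/2) * N2 + w2)\<^sup>2 \<le> 1"
proof -
  define v1 v2 where v: "v1 = w1 - \<mu> * N1 / 2" "v2 = w2 - \<mu> * N2 / 2"
  have "w1\<^sup>2 + w2\<^sup>2 = (v1\<^sup>2 + v2\<^sup>2) + \<mu> * (v1 * N1 + v2 * N2) + \<mu>\<^sup>2 * (N1\<^sup>2 + N2\<^sup>2) / 4"
    by (simp add: v power2_eq_square field_simps)
  also have "\<mu>\<^sup>2 * (N1\<^sup>2 + N2\<^sup>2) = 1"
    using assms(2,4) by (simp flip: power_mult_distrib)
  finally have le: "(v1\<^sup>2 + v2\<^sup>2) + \<mu> * (v1 * N1 + v2 * N2) \<le> 0"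
    using assms(6) by simp
  then have "\<mu> * (v1 * N1 + v2 * N2) \<le> 0"
    by (smt (verit) sum_power2_ge_zero)
  then have neg: "v1 * N1 + v2 * N2 \<le> 0"
    using assms(2) by (simp add: mult_le_0_iff)
  have "(1 - \<mu>/2) * N2 + w2 = N2 + v2" "(a\<^sup>2 - \<mu>/2) * N1 + w1 = a\<^sup>2 * N1 + v1"
    by (auto simp: v algebra_simps)
  then have "((a\<^sup>2 - \<mu>/2) * N1 + w1)\<^sup>2 / a\<^sup>2 + ((1 - \<mu>/2) * N2 + w2)\<^sup>2
      = (a\<^sup>2 * N1\<^sup>2 + N2\<^sup>2) + 2 * (v1 * N1 + v2 * N2) + (v1\<^sup>2 / a\<^sup>2 + v2\<^sup>2)"
    using assms(1) by (simp add: power2_eq_square field_simps)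
  also have "v1\<^sup>2 / a\<^sup>2 \<le> v1\<^sup>2"
    using assms(1) mult_left_mono[of 1 "a\<^sup>2" "v1\<^sup>2"] by (simp add: divide_le_eq)
  finally have "((a\<^sup>2 - \<mu>/2) * N1 + w1)\<^sup>2 / a\<^sup>2 + ((1 - \<mu>/2) * N2 + w2)\<^sup>2
      \<le> 1 + 2 * (v1 * N1 + v2 * N2) - \<mu> * (v1 * N1 + v2 * N2)"
    using le assms(5) by simp
  also have "\<dots> = 1 + (2 - \<mu>) * (v1 * N1 + v2 * N2)"
    by (simp add: algebra_simps)
  also have "\<dots> \<le> 1"
    using neg assms(3) by (simp add: mult_nonneg_nonpos)
  finally show ?thesis .
qed

lemma norm_prod_sq: "(norm w)\<^sup>2 = (fst w)\<^sup>2 + (norm (snd w))\<^sup>2" for w :: "real \<times> 'b::real_normed_vector"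
  by (simp add: norm_prod_def)

locale thin_ellipsoid =
  fixes \<epsilon> a :: real
  assumes \<epsilon>: "0 < \<epsilon>" "\<epsilon> < 1/4" and a_def: "a = 1 + \<epsilon>"
begin

text \<open>
  The parameter \<open>\<mu>\<close> is the reciprocal of the norm of \<open>(p\<^sub>1 / a\<^sup>2, p')\<close> at a boundary point \<open>p\<close> of the
  ellipsoid. The point at depth \<open>1/2\<close> below \<open>p\<close> on the inner normal then has squared first
  coordinate \<open>X \<mu>\<close>, and the remaining coordinates have squared norm \<open>R \<mu>\<close>.
\<close>

definition X :: "real \<Rightarrow> real" where
  "X \<mu> = (a\<^sup>2 - \<mu>/2)\<^sup>2 * (1 - (inverse \<mu>)\<^sup>2) / (a\<^sup>2 - 1)"

definition R :: "real \<Rightarrow> real" where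
  "R \<mu> = (1 - \<mu>/2)\<^sup>2 * (a\<^sup>2 * (inverse \<mu>)\<^sup>2 - 1) / (a\<^sup>2 - 1)"

definition X' :: "real \<Rightarrow> real" where
  "X' \<mu> = (a\<^sup>2 - \<mu>/2) * (2 * a\<^sup>2 * (inverse \<mu>)^3 - 1) / (a\<^sup>2 - 1)"

definition R' :: "real \<Rightarrow> real" where
  "R' \<mu> = (1 - \<mu>/2) * (1 - 2 * a\<^sup>2 * (inverse \<mu>)^3) / (a\<^sup>2 - 1)"

definition inner_set :: "(real \<times> (real ^ 'm::finite)) set" where
  "inner_set = {x. cball x (1/2) \<subseteq> ellipsoid \<epsilon>}"

lemma a_bounds: "1 < a" "a < 5/4" "1 < a\<^sup>2" "0 < a" "a < a\<^sup>2" "a\<^sup>2 \<noteq> 1" "a\<^sup>2 < 2"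
proof -
  show a: "1 < a" "a < 5/4" "0 < a" using \<epsilon> by (auto simp: a_def)
  then show "a < a\<^sup>2" by (simp add: power2_eq_square)
  then show "1 < a\<^sup>2" "a\<^sup>2 \<noteq> 1" using a by auto
  show "a\<^sup>2 < 2" using power_strict_mono[of a "5/4" 2] a by (simp add: power2_eq_square)
qed

lemma mem_ellipsoid: "x \<in> ellipsoid \<epsilon> \<longleftrightarrow> (fst x)\<^sup>2 / a\<^sup>2 + (norm (snd x))\<^sup>2 < 1"
  by (auto simp: ellipsoid_def a_def split: prod.splits)

text \<open>The two equations are linear in N1^2 and N2^2; 1 <= \<mu> <= a is exactly the range in
  which both solutions are nonnegative.\<close>

lemma normal_components:
  assumes "1 \<le> \<mu>" "\<mu> \<le> a"
  obtains N1 N2 where "0 \<le> N1" "0 \<le> N2" "N1\<^sup>2 + N2\<^sup>2 = (inverse \<mu>)\<^sup>2" "a\<^sup>2 * N1\<^sup>2 + N2\<^sup>2 = 1"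
    "X \<mu> = ((a\<^sup>2 - \<mu>/2) * N1)\<^sup>2" "R \<mu> = ((1 - \<mu>/2) * N2)\<^sup>2"
proof -
  have "inverse \<mu> \<le> 1" "a * inverse \<mu> \<ge> 1"
    using assms by (auto simp: field_simps)
  then have *: "(inverse \<mu>)\<^sup>2 \<le> 1" "a\<^sup>2 * (inverse \<mu>)\<^sup>2 \<ge> 1"
    using assms by (auto simp: power_le_one simp flip: power_mult_distrib)
  define N1 where "N1 = sqrt ((1 - (inverse \<mu>)\<^sup>2) / (a\<^sup>2 - 1))"
  define N2 where "N2 = sqrt ((a\<^sup>2 * (inverse \<mu>)\<^sup>2 - 1) / (a\<^sup>2 - 1))"
  have N: "N1\<^sup>2 = (1 - (inverse \<mu>)\<^sup>2) / (a\<^sup>2 - 1)" "N2\<^sup>2 = (a\<^sup>2 * (inverse \<mu>)\<^sup>2 - 1) / (a\<^sup>2 - 1)"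
    using * a_bounds by (auto simp: N1_def N2_def)
  show thesis
  proof (rule that[of N1 N2])
    show "0 \<le> N1" "0 \<le> N2"
      using * a_bounds by (auto simp: N1_def N2_def)
    have nz: "a\<^sup>2 - 1 \<noteq> 0" using a_bounds(6) by simp
    show "N1\<^sup>2 + N2\<^sup>2 = (inverse \<mu>)\<^sup>2"
      using nz unfolding N add_divide_distrib[symmetric] by (simp add: divide_eq_eq algebra_simps)
    show "a\<^sup>2 * N1\<^sup>2 + N2\<^sup>2 = 1"
      using nz unfolding N times_divide_eq_right add_divide_distrib[symmetric] by (simp add: divide_eq_eq algebra_simps)
    show "X \<mu> = ((a\<^sup>2 - \<mu>/2) * N1)\<^sup>2" "R \<mu> = ((1 - \<mu>/2) * N2)\<^sup>2"
      by (simp_all add: X_def R_def power_mult_distrib N)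
  qed
qed

text \<open>The ball centred at (\<beta>, \<rho>) touches the boundary from inside. Moving the
  centre towards the axes, strictly in at least one coordinate, brings the closed ball into the open
  ellipsoid; points of the two balls are compared coordinate by coordinate through their offsets w1,
  w2.\<close>

lemma mem_inner_set:
  assumes "1 \<le> \<mu>" "\<mu> \<le> a" "(fst x)\<^sup>2 \<le> X \<mu>" "(norm (snd x))\<^sup>2 \<le> R \<mu>"
    and "(fst x)\<^sup>2 < X \<mu> \<or> (norm (snd x))\<^sup>2 < R \<mu>"
  shows "x \<in> inner_set"
  unfolding inner_set_def
proof (clarify)
  obtain N1 N2 where N: "0 \<le> N1" "0 \<le> N2" "N1\<^sup>2 + N2\<^sup>2 = (inverse \<mu>)\<^sup>2" "a\<^sup>2 * N1\<^sup>2 + N2\<^sup>2 = 1"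
    "X \<mu> = ((a\<^sup>2 - \<mu>/2) * N1)\<^sup>2" "R \<mu> = ((1 - \<mu>/2) * N2)\<^sup>2"
    by (rule normal_components[OF assms(1,2)])
  define \<beta> \<rho> where b: "\<beta> = (a\<^sup>2 - \<mu>/2) * N1" "\<rho> = (1 - \<mu>/2) * N2"
  have pos: "0 \<le> \<beta>" "0 \<le> \<rho>"
    using N a_bounds(1,2,5) assms(1,2) by (auto simp: b intro!: mult_nonneg_nonneg)
  have le: "\<bar>fst x\<bar> \<le> \<beta>" "norm (snd x) \<le> \<rho>" "\<bar>fst x\<bar> < \<beta> \<or> norm (snd x) < \<rho>"
    using assms(3-5) pos unfolding N b[symmetric]
    by (auto simp: abs_le_square_iff power2_le_iff_abs_le power_strict_mono
      intro: power2_le_imp_le dest: power2_less_imp_less)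
       (metis abs_of_nonneg abs_ge_zero power2_abs power2_less_imp_less)+
  fix y1 y2 assume "(y1, y2) \<in> cball x (1/2)"
  define w1 w2 where w: "w1 = \<bar>y1 - fst x\<bar>" "w2 = norm (y2 - snd x)"
  have w0: "0 \<le> w1" "0 \<le> w2" by (auto simp: w)
  have "norm ((y1, y2) - x) \<le> 1/2"
    using \<open>(y1, y2) \<in> cball x (1/2)\<close> by (simp add: dist_norm norm_minus_commute)
  then have "(norm ((y1, y2) - x))\<^sup>2 \<le> 1/4"
    using power_mono[of "norm ((y1, y2) - x)" "1/2" 2] by (simp add: power2_eq_square)
  then have "w1\<^sup>2 + w2\<^sup>2 \<le> 1/4"
    by (simp add: norm_prod_sq w)
  then have ball: "(\<beta> + w1)\<^sup>2 / a\<^sup>2 + (\<rho> + w2)\<^sup>2 \<le> 1"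
    unfolding b using a_bounds assms(1,2) N by (intro interior_ball_scalar) auto
  have y1: "\<bar>y1\<bar> \<le> \<bar>fst x\<bar> + w1"
    by (simp add: w)
  have y2: "norm y2 \<le> norm (snd x) + w2"
    unfolding w by (metis add_diff_cancel_left' diff_add_cancel norm_triangle_ineq add.commute)
  have y: "y1\<^sup>2 \<le> (\<bar>fst x\<bar> + w1)\<^sup>2" "(norm y2)\<^sup>2 \<le> (norm (snd x) + w2)\<^sup>2"
    using power_mono[OF y1, of 2] power_mono[OF y2, of 2] by auto
  have x: "(\<bar>fst x\<bar> + w1)\<^sup>2 \<le> (\<beta> + w1)\<^sup>2" "(norm (snd x) + w2)\<^sup>2 \<le> (\<rho> + w2)\<^sup>2"
    using le w0 by (auto intro!: power_mono)
  have "(\<bar>fst x\<bar> + w1)\<^sup>2 < (\<beta> + w1)\<^sup>2 \<or> (norm (snd x) + w2)\<^sup>2 < (\<rho> + w2)\<^sup>2"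
    using le(3) w0 by (auto intro!: power_strict_mono)
  then have "(\<bar>fst x\<bar> + w1)\<^sup>2 / a\<^sup>2 + (norm (snd x) + w2)\<^sup>2 < (\<beta> + w1)\<^sup>2 / a\<^sup>2 + (\<rho> + w2)\<^sup>2"
  proof
    assume "(\<bar>fst x\<bar> + w1)\<^sup>2 < (\<beta> + w1)\<^sup>2"
    then show ?thesis using x(2) a_bounds by (intro add_less_le_mono divide_strict_right_mono) auto
  next
    assume "(norm (snd x) + w2)\<^sup>2 < (\<rho> + w2)\<^sup>2"
    then show ?thesis using x(1) a_bounds by (intro add_le_less_mono divide_right_mono) auto
  qed
  moreover have "y1\<^sup>2 / a\<^sup>2 \<le> (\<bar>fst x\<bar> + w1)\<^sup>2 / a\<^sup>2"
    using y(1) by (intro divide_right_mono) auto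
  ultimately show "(y1, y2) \<in> ellipsoid \<epsilon>"
    using ball y(2) by (simp add: mem_ellipsoid)
qed

lemma not_mem_inner_set:
  assumes "1 \<le> \<mu>" "\<mu> \<le> a" "X \<mu> \<le> (fst x)\<^sup>2" "R \<mu> \<le> (norm (snd x))\<^sup>2"
  shows "x \<notin> (inner_set :: (real \<times> (real ^ 'm::finite)) set)"
proof
  assume x: "x \<in> inner_set"
  obtain N1 N2 where N: "0 \<le> N1" "0 \<le> N2" "N1\<^sup>2 + N2\<^sup>2 = (inverse \<mu>)\<^sup>2" "a\<^sup>2 * N1\<^sup>2 + N2\<^sup>2 = 1"
    "X \<mu> = ((a\<^sup>2 - \<mu>/2) * N1)\<^sup>2" "R \<mu> = ((1 - \<mu>/2) * N2)\<^sup>2"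
    by (rule normal_components[OF assms(1,2)])
  have le: "(a\<^sup>2 - \<mu>/2) * N1 \<le> \<bar>fst x\<bar>" "(1 - \<mu>/2) * N2 \<le> norm (snd x)"
    using assms(3,4) unfolding N by (auto intro: power2_le_imp_le)
  \<comment> \<open>If \<open>snd x\<close> is 0, any unit vector serves as its direction.\<close>
  obtain e :: "real ^ 'm" where e: "norm e = 1" "snd x = norm (snd x) *\<^sub>R e"
  proof (cases "snd x = 0")
    case True
    then show ?thesis using that[of "axis undefined 1"] by (simp add: norm_axis_1)
  next
    case False
    then show ?thesis using that[of "snd x /\<^sub>R norm (snd x)"] by simp
  qed
  obtain c :: real where c: "\<bar>c\<bar> = 1" "fst x = \<bar>fst x\<bar> * c"
    using that[of 1] that[of "-1"] by (cases "fst x \<ge> 0") auto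
  \<comment> \<open>A step of length 1/2 from x along \<mu> (N1, N2), with the signs and direction
    of x, reaches a point of the closed ball at which the quadratic form is at least 1.\<close>
  define y where "y = x + (\<mu> * N1 / 2 * c, (\<mu> * N2 / 2) *\<^sub>R e)"
  have "(dist x y)\<^sup>2 = (\<mu> * N1 / 2)\<^sup>2 * \<bar>c\<bar>\<^sup>2 + (\<mu> * N2 / 2)\<^sup>2"
    using e(1) by (simp add: y_def dist_norm norm_prod_sq power_mult_distrib power_divide)
  also have "\<dots> = \<mu>\<^sup>2 * (N1\<^sup>2 + N2\<^sup>2) / 4"
    unfolding c(1) by (simp add: power2_eq_square field_simps)
  also have "\<dots> = (1/2)\<^sup>2"
    unfolding N(3) power_mult_distrib[symmetric] using assms(1) by (simp add: power2_eq_square)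
  finally have "dist x y = 1/2"
    by (simp add: power2_eq_iff_nonneg)
  then have "y \<in> ellipsoid \<epsilon>"
    using x by (auto simp: inner_set_def)
  then have lt: "(fst y)\<^sup>2 / a\<^sup>2 + (norm (snd y))\<^sup>2 < 1"
    by (simp add: mem_ellipsoid)
  have "fst y = (\<bar>fst x\<bar> + \<mu> * N1 / 2) * c"
    using c(2) by (simp add: y_def algebra_simps)
  then have "\<bar>fst y\<bar> = \<bar>fst x\<bar> + \<mu> * N1 / 2"
    using c(1) N(1) assms(1) by (simp add: abs_mult)
  then have "a\<^sup>2 * N1 \<le> \<bar>fst y\<bar>"
    using le(1) by (simp add: algebra_simps)
  then have f: "(a\<^sup>2 * N1)\<^sup>2 \<le> (fst y)\<^sup>2"
    using N(1) power_mono[of "a\<^sup>2 * N1" "\<bar>fst y\<bar>" 2] by simp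
  have "snd y = (norm (snd x) + \<mu> * N2 / 2) *\<^sub>R e"
    using e(2) by (simp add: y_def scaleR_add_left)
  then have "norm (snd y) = norm (snd x) + \<mu> * N2 / 2"
    using e(1) N(2) assms(1) by simp
  then have "N2 \<le> norm (snd y)"
    using le(2) by (simp add: algebra_simps)
  then have "N2\<^sup>2 \<le> (norm (snd y))\<^sup>2"
    using N(2) by (intro power_mono) auto
  moreover have "a\<^sup>2 * N1\<^sup>2 \<le> (fst y)\<^sup>2 / a\<^sup>2"
    using f a_bounds by (simp add: field_simps power2_eq_square)
  ultimately show False
    using lt N(4) by simp
qed

section \<open>Dependence of the squared coordinates on the parameter, from the equator \<mu> = 1 to
  the poles \<mu> = a\<close>

lemma X_R_special: "X 1 = 0" "R a = 0" "X a = (a - 1/2)\<^sup>2" "R 1 = 1/4"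
proof -
  have a: "a\<^sup>2 - 1 \<noteq> 0" "a > 0" using a_bounds(4,6) by auto
  show "X 1 = 0" "R a = 0"
    using a by (auto simp: X_def R_def simp flip: power_mult_distrib)
  show "R 1 = 1/4"
    using a by (simp add: R_def power2_eq_square)
  have "1 - (inverse a)\<^sup>2 = (a\<^sup>2 - 1) / a\<^sup>2"
    using a by (simp add: field_simps power2_eq_square)
  moreover have "a\<^sup>2 - a / 2 = (a - 1/2) * a"
    by (simp add: power2_eq_square algebra_simps)
  ultimately show "X a = (a - 1/2)\<^sup>2"
    using a by (simp add: X_def power_mult_distrib)
qed

lemma X'_pos: "1/2 < \<mu> \<Longrightarrow> \<mu> < 5/4 \<Longrightarrow> X' \<mu> > 0"
  and R'_neg: "1/2 < \<mu> \<Longrightarrow> \<mu> < 5/4 \<Longrightarrow> R' \<mu> < 0"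
proof -
  assume \<mu>: "1/2 < \<mu>" "\<mu> < 5/4"
  \<comment> \<open>(5/4)^3 = 125/64 is below 2, hence below 2 a^2; so 5/4, which exceeds a, is a
    safe upper end of the parameter interval.\<close>
  have "\<mu> ^ 3 \<le> (5/4) ^ 3"
    using \<mu> by (intro power_mono) auto
  then have "\<mu> ^ 3 < 2 * a\<^sup>2"
    using a_bounds(1,5) by (simp add: power3_eq_cube)
  then have *: "2 * a\<^sup>2 * (inverse \<mu>)^3 - 1 > 0"
    using \<mu> by (simp add: field_simps)
  show "X' \<mu> > 0"
    unfolding X'_def using * \<mu> a_bounds(2,3,5) by (intro divide_pos_pos mult_pos_pos) auto
  have "(1 - \<mu>/2) * (2 * a\<^sup>2 * (inverse \<mu>)^3 - 1) / (a\<^sup>2 - 1) > 0"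
    using * \<mu> a_bounds(2,3,5) by (intro divide_pos_pos mult_pos_pos) auto
  moreover have "R' \<mu> = - ((1 - \<mu>/2) * (2 * a\<^sup>2 * (inverse \<mu>)^3 - 1) / (a\<^sup>2 - 1))"
    by (simp add: R'_def minus_divide_left algebra_simps)
  ultimately show "R' \<mu> < 0" by simp
qed

lemma X_deriv: "(X has_field_derivative X' \<mu>) (at \<mu>)"
  and R_deriv: "(R has_field_derivative R' \<mu>) (at \<mu>)" if "\<mu> > 0" for \<mu>
proof -
  define i where "i = inverse \<mu>"
  have i: "\<mu> * i = 1" "((\<lambda>x. (inverse x)\<^sup>2) has_field_derivative - 2 * i ^ 3) (at \<mu>)"
    using that by (auto intro!: derivative_eq_intros simp: i_def power2_eq_square power3_eq_cube)
  have "(X has_field_derivative ((2 * (a\<^sup>2 - \<mu>/2) * (- 1/2)) * (1 - i\<^sup>2) +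
      (a\<^sup>2 - \<mu>/2)\<^sup>2 * (2 * i ^ 3)) / (a\<^sup>2 - 1)) (at \<mu>)"
    unfolding X_def[abs_def] i_def
    by (rule DERIV_cong[OF DERIV_cdivide[OF DERIV_mult[OF _ DERIV_diff[OF DERIV_const i(2)]]]])
      (auto intro!: derivative_eq_intros simp: i_def)
  also have "(2 * (a\<^sup>2 - \<mu>/2) * (- 1/2)) * (1 - i\<^sup>2) + (a\<^sup>2 - \<mu>/2)\<^sup>2 * (2 * i ^ 3)
      = (a\<^sup>2 - \<mu>/2) * (2 * a\<^sup>2 * i ^ 3 - 1)"
    using i(1) by algebra
  finally show "(X has_field_derivative X' \<mu>) (at \<mu>)"
    by (simp add: X'_def i_def)
  have "(R has_field_derivative ((2 * (1 - \<mu>/2) * (- 1/2)) * (a\<^sup>2 * i\<^sup>2 - 1) +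
      (1 - \<mu>/2)\<^sup>2 * (a\<^sup>2 * (- 2 * i ^ 3))) / (a\<^sup>2 - 1)) (at \<mu>)"
    unfolding R_def[abs_def] i_def
    by (rule DERIV_cong[OF DERIV_cdivide[OF DERIV_mult[OF _ DERIV_diff[OF DERIV_cmult[OF i(2)] DERIV_const]]]])
      (auto intro!: derivative_eq_intros simp: i_def)
  also have "(2 * (1 - \<mu>/2) * (- 1/2)) * (a\<^sup>2 * i\<^sup>2 - 1) + (1 - \<mu>/2)\<^sup>2 * (a\<^sup>2 * (- 2 * i ^ 3))
      = (1 - \<mu>/2) * (1 - 2 * a\<^sup>2 * i ^ 3)"
    using i(1) by algebra
  finally show "(R has_field_derivative R' \<mu>) (at \<mu>)"
    by (simp add: R'_def i_def)
qed

lemma X_mono: "1/2 < \<mu> \<Longrightarrow> \<mu> < \<mu>' \<Longrightarrow> \<mu>' < 5/4 \<Longrightarrow> X \<mu> < X \<mu>'"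
  by (rule DERIV_pos_imp_increasing) (auto intro!: exI X_deriv X'_pos)

lemma R_mono: "1/2 < \<mu> \<Longrightarrow> \<mu> < \<mu>' \<Longrightarrow> \<mu>' < 5/4 \<Longrightarrow> R \<mu>' < R \<mu>"
  by (rule DERIV_neg_imp_decreasing) (auto intro!: exI R_deriv R'_neg)

lemma isCont_X: "\<mu> > 0 \<Longrightarrow> isCont X \<mu>" and isCont_R: "\<mu> > 0 \<Longrightarrow> isCont R \<mu>"
  using X_deriv R_deriv DERIV_isCont by blast+

lemma continuous_on_X: "continuous_on {1..a} X"
  using isCont_X by (auto intro!: continuous_at_imp_continuous_on)

lemma X_range: "0 \<le> t \<Longrightarrow> t \<le> X a \<Longrightarrow> \<exists>\<mu>. 1 \<le> \<mu> \<and> \<mu> \<le> a \<and> X \<mu> = t"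
  using IVT'[of X 1 t a] continuous_on_X X_R_special a_bounds by auto

lemma inner_set_bounds:
  assumes "x \<in> inner_set"
  shows "(fst x)\<^sup>2 < X a" "(norm (snd x))\<^sup>2 < R 1"
  using not_mem_inner_set[of a x] not_mem_inner_set[of 1 x] assms a_bounds X_R_special
  by (auto simp: not_le[symmetric])

lemma mem_inner_set_iff_X:
  assumes "1 \<le> \<mu>" "\<mu> \<le> a" "(fst x)\<^sup>2 = X \<mu>"
  shows "x \<in> inner_set \<longleftrightarrow> (norm (snd x))\<^sup>2 < R \<mu>"
  using mem_inner_set[of \<mu> x] not_mem_inner_set[of \<mu> x] assms by force

lemma mem_inner_set_iff_R:
  assumes "1 \<le> \<mu>" "\<mu> \<le> a" "(norm (snd x))\<^sup>2 = R \<mu>"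
  shows "x \<in> inner_set \<longleftrightarrow> (fst x)\<^sup>2 < X \<mu>"
  using mem_inner_set[of \<mu> x] not_mem_inner_set[of \<mu> x] assms by force

section \<open>Openness and frontier of the parallel set\<close>

lemma continuous_on_quadratic_form:
  "continuous_on UNIV (\<lambda>x :: real \<times> (real ^ 'm::finite). (fst x)\<^sup>2 / a\<^sup>2 + (norm (snd x))\<^sup>2)"
  using a_bounds by (auto intro!: continuous_intros)

lemma open_ellipsoid: "open (ellipsoid \<epsilon> :: (real \<times> (real ^ 'm::finite)) set)"
proof -
  have "ellipsoid \<epsilon> = {x :: real \<times> (real ^ 'm). (fst x)\<^sup>2 / a\<^sup>2 + (norm (snd x))\<^sup>2 < 1}"
    using mem_ellipsoid by blast
  then show ?thesis
    using open_Collect_less[OF continuous_on_quadratic_form continuous_on_const] by simp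
qed

text \<open>The closed ball around x is compact, hence at a positive distance d from the complement
  of the ellipsoid, and translating it by less than d keeps it inside.\<close>

lemma open_inner_set: "open (inner_set :: (real \<times> (real ^ 'm::finite)) set)"
  unfolding open_contains_ball
proof
  fix x :: "real \<times> (real ^ 'm)" assume "x \<in> inner_set"
  then have sub: "cball x (1/2) \<subseteq> ellipsoid \<epsilon>" by (simp add: inner_set_def)
  have "\<exists>d>0. \<forall>y\<in>cball x (1/2). \<forall>z\<in>- ellipsoid \<epsilon>. d \<le> dist y z"
    using sub open_ellipsoid by (intro separate_compact_closed) auto
  then obtain d where d: "d > 0" "\<And>y z. y \<in> cball x (1/2) \<Longrightarrow> z \<notin> ellipsoid \<epsilon> \<Longrightarrow> d \<le> dist y z"
    by auto
  have "ball x d \<subseteq> inner_set"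
  proof
    fix x' assume x': "x' \<in> ball x d"
    have "z \<in> ellipsoid \<epsilon>" if "z \<in> cball x' (1/2)" for z
    proof (rule ccontr)
      assume "z \<notin> ellipsoid \<epsilon>"
      moreover have "x + (z - x') \<in> cball x (1/2)"
        using that by (simp add: dist_norm norm_minus_commute)
      ultimately have "d \<le> dist (x + (z - x')) z"
        using d by blast
      also have "\<dots> = dist x x'" by (simp add: dist_norm)
      finally show False using x' by simp
    qed
    then show "x' \<in> inner_set" by (auto simp: inner_set_def)
  qed
  then show "\<exists>d>0. ball x d \<subseteq> inner_set" using d(1) by blast
qed

lemma frontier_inner_set:
  "frontier inner_set = {x :: real \<times> (real ^ 'm::finite).
     \<exists>\<mu>. 1 \<le> \<mu> \<and> \<mu> \<le> a \<and> (fst x)\<^sup>2 = X \<mu> \<and> (norm (snd x))\<^sup>2 = R \<mu>}"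
proof (intro set_eqI iffI)
  fix x :: "real \<times> (real ^ 'm)"
  assume "x \<in> frontier inner_set"
  then have cl: "x \<in> closure inner_set" and nx: "x \<notin> inner_set"
    by (auto simp: frontier_def interior_open[OF open_inner_set])
  have "closed {x :: real \<times> (real ^ 'm). (fst x)\<^sup>2 \<le> X a \<and> (norm (snd x))\<^sup>2 \<le> R 1}"
    by (intro closed_Collect_conj closed_Collect_le continuous_intros)
  then have "closure inner_set \<subseteq> {x :: real \<times> (real ^ 'm). (fst x)\<^sup>2 \<le> X a \<and> (norm (snd x))\<^sup>2 \<le> R 1}"
    by (intro closure_minimal)
      (blast intro: less_imp_le[OF inner_set_bounds(1)] less_imp_le[OF inner_set_bounds(2)])
  then have le: "(fst x)\<^sup>2 \<le> X a" "(norm (snd x))\<^sup>2 \<le> R 1"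
    using cl by auto
  obtain \<mu> where \<mu>: "1 \<le> \<mu>" "\<mu> \<le> a" "X \<mu> = (fst x)\<^sup>2"
    using X_range[OF _ le(1)] by auto
  have "R \<mu> \<le> (norm (snd x))\<^sup>2"
    using nx mem_inner_set_iff_X[of \<mu> x] \<mu> by auto
  \<comment> \<open>If the radial part exceeded R \<mu>, a slightly smaller parameter t would, by
    strict monotonicity of X, yield an open neighbourhood of x disjoint from the set.\<close>
  moreover have False if lt: "R \<mu> < (norm (snd x))\<^sup>2"
  proof -
    have "\<mu> \<noteq> 1" using lt le(2) by auto
    then have "1 < \<mu>" using \<mu> by simp
    have "\<forall>\<^sub>F t in at_left \<mu>. R t < (norm (snd x))\<^sup>2"
      using isCont_R[of \<mu>] \<mu>(1) lt
      by (intro order_tendstoD(2)[OF _ lt]) (auto simp: isCont_def filterlim_at_split)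
    moreover have "\<forall>\<^sub>F t in at_left \<mu>. t \<in> {1<..<\<mu>}"
      using \<open>1 < \<mu>\<close> by (rule eventually_at_left_real)
    ultimately have "\<forall>\<^sub>F t in at_left \<mu>. R t < (norm (snd x))\<^sup>2 \<and> 1 < t \<and> t < \<mu>"
      by eventually_elim auto
    then obtain t where t: "R t < (norm (snd x))\<^sup>2" "1 < t" "t < \<mu>"
      using eventually_happens by fastforce
    let ?U = "{y :: real \<times> (real ^ 'm). X t < (fst y)\<^sup>2 \<and> R t < (norm (snd y))\<^sup>2}"
    have "open ?U"
      by (intro open_Collect_conj open_Collect_less continuous_intros)
    moreover have "?U \<inter> inner_set = {}"
      using not_mem_inner_set[of t] t \<mu> by force
    moreover have "X t < X \<mu>"
      using t \<mu> a_bounds by (intro X_mono) auto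
    ultimately show False
      using cl t \<mu>(3) open_Int_closure_eq_empty[of ?U inner_set] by auto
  qed
  ultimately show "x \<in> {x. \<exists>\<mu>. 1 \<le> \<mu> \<and> \<mu> \<le> a \<and> (fst x)\<^sup>2 = X \<mu> \<and> (norm (snd x))\<^sup>2 = R \<mu>}"
    using \<mu> by fastforce
next
  fix x :: "real \<times> (real ^ 'm)"
  assume "x \<in> {x. \<exists>\<mu>. 1 \<le> \<mu> \<and> \<mu> \<le> a \<and> (fst x)\<^sup>2 = X \<mu> \<and> (norm (snd x))\<^sup>2 = R \<mu>}"
  then obtain \<mu> where \<mu>: "1 \<le> \<mu>" "\<mu> \<le> a" "(fst x)\<^sup>2 = X \<mu>" "(norm (snd x))\<^sup>2 = R \<mu>" by auto
  then have nx: "x \<notin> inner_set"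
    using mem_inner_set_iff_X[of \<mu> x] by simp
  have pos: "0 < X \<mu> \<or> 0 < R \<mu>"
    using X_mono[of 1 \<mu>] X_R_special \<mu>(1,2) a_bounds by (cases "\<mu> = 1") auto
  \<comment> \<open>Shrinking x towards 0 makes one of the two inequalities strict, as X \<mu> and R
    \<mu> are not both 0; so x is a limit of points of the set.\<close>
  have "t *\<^sub>R x \<in> inner_set" if t: "0 < t" "t < 1" for t
  proof (rule mem_inner_set[OF \<mu>(1,2)])
    have "t\<^sup>2 < 1" using t by (simp add: power_less_one_iff)
    then have le: "t\<^sup>2 * X \<mu> \<le> X \<mu>" "t\<^sup>2 * R \<mu> \<le> R \<mu>"
      using \<mu>(3,4) by (metis mult_left_le_one_le zero_le_power2 less_imp_le)+
    have lt: "t\<^sup>2 * X \<mu> < X \<mu> \<or> t\<^sup>2 * R \<mu> < R \<mu>"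
      using pos \<open>t\<^sup>2 < 1\<close> by auto
    show "(fst (t *\<^sub>R x))\<^sup>2 \<le> X \<mu>" "(norm (snd (t *\<^sub>R x)))\<^sup>2 \<le> R \<mu>"
      "(fst (t *\<^sub>R x))\<^sup>2 < X \<mu> \<or> (norm (snd (t *\<^sub>R x)))\<^sup>2 < R \<mu>"
      using le lt \<mu>(3,4) by (auto simp: power_mult_distrib)
  qed
  moreover have "((\<lambda>t. t *\<^sub>R x) \<longlongrightarrow> 1 *\<^sub>R x) (at_left (1::real))"
    by (intro tendsto_intros)
  moreover have "\<forall>\<^sub>F t in at_left (1::real). 0 < t \<and> t < 1"
    using eventually_at_left_real[of 0 1] by simp
  ultimately have "x \<in> closure inner_set"
    by (intro Lim_in_closed_set[of _ "\<lambda>t. t *\<^sub>R x" "at_left 1"])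
       (auto elim!: eventually_mono simp: trivial_limit_at_left_real intro: subsetD[OF closure_subset])
  then show "x \<in> frontier inner_set"
    using nx by (simp add: frontier_def interior_open[OF open_inner_set])
qed

abbreviation (input) "I \<equiv> {1/2<..<5/4 :: real}"

lemma C_k_on_X: "C_k_on k I X" and C_k_on_R: "C_k_on k I R"
  and C_k_on_X': "C_k_on k I X'" and C_k_on_R': "C_k_on k I R'"
proof -
  have o: "open I" by simp
  have i: "C_k_on k I inverse"
    by (rule C_k_on_subset[OF C_k_on_inverse]) auto
  show "C_k_on k I X" "C_k_on k I R" "C_k_on k I X'" "C_k_on k I R'"
    unfolding X_def[abs_def] R_def[abs_def] X'_def[abs_def] R'_def[abs_def]
    by (intro C_k_on_divide_const[OF o] C_k_on_mult[OF o] C_k_on_power[OF o] C_k_on_diff[OF o]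
        C_k_on_const i C_k_on_ident[OF o])+
qed

lemma inj_on_X: "inj_on X I"
  by (rule linorder_inj_onI') (use X_mono in fastforce)

lemma inj_on_R: "inj_on R I"
  by (rule linorder_inj_onI') (use R_mono in fastforce)

text \<open>The interval reaches beyond [1, a] at both ends, so the inverse is smooth also at X 1 =
  0 and at X a. Since it is later composed with the square of the first coordinate, the resulting
  chart is smooth across the equator.\<close>

lemma X_inverse: "open (X ` I)" "C_k_on k (X ` I) (the_inv_into I X)"
proof -
  have *: "(X has_field_derivative X' \<mu>) (at \<mu>)" "X' \<mu> \<noteq> 0" if "\<mu> \<in> I" for \<mu>
    using that X_deriv[of \<mu>] X'_pos[of \<mu>] by auto
  have o: "open I" by simp
  show "open (X ` I)" "C_k_on k (X ` I) (the_inv_into I X)"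
    by (rule C_k_on_inverse_function[OF o inj_on_X * C_k_on_X']; assumption)+
qed

lemma R_inverse: "open (R ` I)" "C_k_on k (R ` I) (the_inv_into I R)"
proof -
  have *: "(R has_field_derivative R' \<mu>) (at \<mu>)" "R' \<mu> \<noteq> 0" if "\<mu> \<in> I" for \<mu>
    using that R_deriv[of \<mu>] R'_neg[of \<mu>] by auto
  have o: "open I" by simp
  show "open (R ` I)" "C_k_on k (R ` I) (the_inv_into I R)"
    by (rule C_k_on_inverse_function[OF o inj_on_R * C_k_on_R']; assumption)+
qed

text \<open>The value of X may come from a parameter above a, that is, from a point past the poles;
  there R is negative and both sides are false. Parameters below 1 do not occur, because X is
  negative there.\<close>

lemma mem_inner_set_near_side:
  assumes "(fst x)\<^sup>2 \<in> X ` I"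
  shows "x \<in> inner_set \<longleftrightarrow> (norm (snd x))\<^sup>2 < R (the_inv_into I X ((fst x)\<^sup>2))"
proof -
  obtain \<mu> where \<mu>: "\<mu> \<in> I" "(fst x)\<^sup>2 = X \<mu>" using assms by auto
  have inv: "the_inv_into I X ((fst x)\<^sup>2) = \<mu>"
    using \<mu> by (simp add: the_inv_into_f_f[OF inj_on_X])
  have "0 \<le> X \<mu>" using \<mu>(2) by (metis zero_le_power2)
  then have "1 \<le> \<mu>"
    using X_mono[of \<mu> 1] \<mu>(1) X_R_special by (cases "\<mu> < 1") auto
  show ?thesis
  proof (cases "\<mu> \<le> a")
    case True
    then show ?thesis using mem_inner_set_iff_X \<open>1 \<le> \<mu>\<close> \<mu>(2) inv by simp
  next
    case False
    then have "R \<mu> < 0" "X a < X \<mu>"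
      using R_mono[of a \<mu>] X_mono[of a \<mu>] \<mu>(1) X_R_special a_bounds by auto
    then show ?thesis
      using inner_set_bounds(1)[of x] \<mu>(2) inv by (smt (verit) zero_le_power2)
  qed
qed

lemma mem_inner_set_near_pole:
  assumes "(norm (snd x))\<^sup>2 \<in> R ` I"
  shows "x \<in> inner_set \<longleftrightarrow> (fst x)\<^sup>2 < X (the_inv_into I R ((norm (snd x))\<^sup>2))"
proof -
  obtain \<mu> where \<mu>: "\<mu> \<in> I" "(norm (snd x))\<^sup>2 = R \<mu>" using assms by auto
  have inv: "the_inv_into I R ((norm (snd x))\<^sup>2) = \<mu>"
    using \<mu> by (simp add: the_inv_into_f_f[OF inj_on_R])
  have "0 \<le> R \<mu>" using \<mu>(2) by (metis zero_le_power2)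
  then have "\<mu> \<le> a"
    using R_mono[of a \<mu>] \<mu>(1) X_R_special a_bounds by (cases "a < \<mu>") auto
  show ?thesis
  proof (cases "1 \<le> \<mu>")
    case True
    then show ?thesis using mem_inner_set_iff_R \<open>\<mu> \<le> a\<close> \<mu>(2) inv by simp
  next
    case False
    then have "X \<mu> < 0" "R 1 < R \<mu>"
      using R_mono[of \<mu> 1] X_mono[of \<mu> 1] \<mu>(1) X_R_special by auto
    then show ?thesis
      using inner_set_bounds(2)[of x] \<mu>(2) inv by (smt (verit) zero_le_power2)
  qed
qed

lemma less_sqrt_iff: "0 < x \<Longrightarrow> x < sqrt y \<longleftrightarrow> x\<^sup>2 < y" for x y :: real
  using real_sqrt_less_iff[of "x\<^sup>2" y] by simp

text \<open>Off the axis the height is measured along \<open>snd p\<close>, and the squared norm of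
  \<open>snd x\<close> splits by Pythagoras into height and horizontal part. At a pole the height is
  the first coordinate with its sign. Positivity of the height near p turns the inequality between
  squares into a comparison with a square root.\<close>

lemma smooth_boundary_inner_set: "smooth_boundary (inner_set :: (real \<times> (real ^ 'm::finite)) set)"
proof (rule smooth_boundaryI)
  fix p :: "real \<times> (real ^ 'm)" assume "p \<in> frontier inner_set"
  then obtain \<mu> where \<mu>: "1 \<le> \<mu>" "\<mu> \<le> a" "(fst p)\<^sup>2 = X \<mu>" "(norm (snd p))\<^sup>2 = R \<mu>"
    by (auto simp: frontier_inner_set)
  have \<mu>I: "\<mu> \<in> I" using \<mu> a_bounds by auto
  have q: "C_k_on k U (\<lambda>y. (norm (snd y))\<^sup>2)" "C_k_on k U (\<lambda>y. (fst y)\<^sup>2)"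
    if "open U" for k and U :: "(real \<times> (real ^ 'm)) set"
    using C_k_on_norm_sq[OF that bounded_linear_snd] C_k_on_power[OF that C_k_on_bounded_linear[OF that bounded_linear_fst]]
    by auto
  show "\<exists>\<nu> g U V. norm \<nu> = 1 \<and> open U \<and> open V \<and> p \<in> V \<and>
      p - (p \<bullet> \<nu>) *\<^sub>R \<nu> \<in> U \<and> (\<forall>k. C_k_on k U g) \<and>
      (\<forall>x\<in>V. x \<in> inner_set \<longleftrightarrow> x \<bullet> \<nu> < g (x - (x \<bullet> \<nu>) *\<^sub>R \<nu>))"
  proof (cases "snd p = 0")
    case False
    define e where "e = snd p /\<^sub>R norm (snd p)"
    define \<nu> :: "real \<times> (real ^ 'm)" where "\<nu> = (0, e)"
    have e: "norm e = 1" "e \<bullet> e = 1"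
      using False by (auto simp: e_def simp flip: power2_norm_eq_inner)
    define h where "h = (\<lambda>y :: real \<times> (real ^ 'm). R (the_inv_into I X ((fst y)\<^sup>2)) - (norm (snd y))\<^sup>2)"
    define U0 where "U0 = {y :: real \<times> (real ^ 'm). (fst y)\<^sup>2 \<in> X ` I}"
    define U where "U = U0 \<inter> h -` {0<..}"
    define V where "V = U0 \<inter> {x. 0 < snd x \<bullet> e}"
    have U0: "open U0"
      using continuous_open_vimage[OF X_inverse(1), of "\<lambda>y :: real \<times> (real ^ 'm). (fst y)\<^sup>2"]
      by (auto simp: U0_def vimage_def intro!: continuous_intros)
    have hk: "C_k_on k U0 h" for k
      unfolding h_def
    proof (intro C_k_on_diff U0 q)
      have "C_k_on k U0 (\<lambda>y. the_inv_into I X ((fst y)\<^sup>2))"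
        by (rule C_k_on_compose[OF U0 q(2)[OF U0] X_inverse]) (auto simp: U0_def)
      then show "C_k_on k U0 (\<lambda>y. R (the_inv_into I X ((fst y)\<^sup>2)))"
        by (rule C_k_on_compose[OF U0 _ _ C_k_on_R])
          (auto simp: U0_def the_inv_into_f_f[OF inj_on_X])
    qed
    have U: "open U"
      unfolding U_def using hk[of 0] U0 by (intro continuous_open_preimage) auto
    have V: "open V"
      unfolding V_def using U0 by (intro open_Int open_Collect_less continuous_intros)
    have gk: "C_k_on k U (\<lambda>y. sqrt (h y))" for k
      by (rule C_k_on_compose[OF U C_k_on_subset[OF hk] _ C_k_on_sqrt]) (auto simp: U_def)
    have hor: "x - (x \<bullet> \<nu>) *\<^sub>R \<nu> = (fst x, snd x - (snd x \<bullet> e) *\<^sub>R e)" for x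
      by (cases x) (simp add: \<nu>_def)
    have nrm: "(norm (snd x - (snd x \<bullet> e) *\<^sub>R e))\<^sup>2 = (norm (snd x))\<^sup>2 - (snd x \<bullet> e)\<^sup>2"
      for x :: "real \<times> (real ^ 'm)"
      unfolding power2_norm_eq_inner
      by (simp add: inner_diff_left inner_diff_right e inner_commute power2_eq_square)
    have pe: "snd p \<bullet> e = norm (snd p)"
      using False by (simp add: e_def power2_norm_eq_inner[symmetric] power2_eq_square)
    show ?thesis
    proof (intro exI conjI allI ballI)
      show "norm \<nu> = 1" by (simp add: \<nu>_def e)
      show "open U" "open V" by fact+
      show "p \<in> V" using \<mu>I \<mu>(3) False pe by (auto simp: V_def U0_def)
      show "C_k_on k U (\<lambda>y. sqrt (h y))" for k by (rule gk)
      have "h (p - (p \<bullet> \<nu>) *\<^sub>R \<nu>) = R \<mu>"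
        unfolding hor h_def fst_conv snd_conv nrm by (simp add: pe \<mu>(3) the_inv_into_f_f[OF inj_on_X \<mu>I])
      moreover have "R \<mu> > 0" using False \<mu>(4) by (metis norm_eq_zero zero_less_power2)
      ultimately show "p - (p \<bullet> \<nu>) *\<^sub>R \<nu> \<in> U"
        using \<mu>I \<mu>(3) by (auto simp: U_def U0_def hor)
      fix x assume x: "x \<in> V"
      have "x \<in> inner_set \<longleftrightarrow> (snd x \<bullet> e)\<^sup>2 < h (x - (x \<bullet> \<nu>) *\<^sub>R \<nu>)"
        using x mem_inner_set_near_side[of x] by (auto simp: V_def U0_def hor h_def nrm)
      then show "x \<in> inner_set \<longleftrightarrow> x \<bullet> \<nu> < sqrt (h (x - (x \<bullet> \<nu>) *\<^sub>R \<nu>))"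
        using x less_sqrt_iff[of "snd x \<bullet> e"] by (cases x) (simp add: V_def \<nu>_def)
    qed
  next
    case True
    then have "R \<mu> = 0" using \<mu>(4) by simp
    then have "\<mu> = a"
      using R_mono[of \<mu> a] \<mu> a_bounds X_R_special by (cases "\<mu> = a") auto
    then have Xpos: "X \<mu> > 0"
      using X_R_special a_bounds by simp
    define c where "c = sgn (fst p)"
    define \<nu> :: "real \<times> (real ^ 'm)" where "\<nu> = (c, 0)"
    have c: "\<bar>c\<bar> = 1" "c * c = 1" "fst p * c > 0"
      using Xpos \<mu>(3) by (auto simp: c_def sgn_if zero_less_mult_iff)
    define h where "h = (\<lambda>y :: real \<times> (real ^ 'm). X (the_inv_into I R ((norm (snd y))\<^sup>2)))"
    define U0 where "U0 = {y :: real \<times> (real ^ 'm). (norm (snd y))\<^sup>2 \<in> R ` I}"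
    define U where "U = U0 \<inter> h -` {0<..}"
    define V where "V = U0 \<inter> {x. 0 < fst x * c}"
    have U0: "open U0"
      using continuous_open_vimage[OF R_inverse(1), of "\<lambda>y :: real \<times> (real ^ 'm). (norm (snd y))\<^sup>2"]
      by (auto simp: U0_def vimage_def intro!: continuous_intros)
    have hk: "C_k_on k U0 h" for k
    proof -
      have "C_k_on k U0 (\<lambda>y. the_inv_into I R ((norm (snd y))\<^sup>2))"
        by (rule C_k_on_compose[OF U0 q(1)[OF U0] R_inverse]) (auto simp: U0_def)
      then show ?thesis
        unfolding h_def by (rule C_k_on_compose[OF U0 _ _ C_k_on_X])
          (auto simp: U0_def the_inv_into_f_f[OF inj_on_R])
    qed
    have U: "open U"
      unfolding U_def using hk[of 0] U0 by (intro continuous_open_preimage) auto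
    have V: "open V"
      unfolding V_def using U0 by (intro open_Int open_Collect_less continuous_intros)
    have gk: "C_k_on k U (\<lambda>y. sqrt (h y))" for k
      by (rule C_k_on_compose[OF U C_k_on_subset[OF hk] _ C_k_on_sqrt]) (auto simp: U_def)
    have hor: "x - (x \<bullet> \<nu>) *\<^sub>R \<nu> = (0, snd x)" for x
      using c(2) by (cases x) (simp add: \<nu>_def mult.assoc)
    show ?thesis
    proof (intro exI conjI allI ballI)
      show "norm \<nu> = 1" using c by (simp add: \<nu>_def)
      show "open U" "open V" by fact+
      show "p \<in> V" using \<mu>I \<mu>(4) c by (auto simp: V_def U0_def)
      show "C_k_on k U (\<lambda>y. sqrt (h y))" for k by (rule gk)
      have "h (p - (p \<bullet> \<nu>) *\<^sub>R \<nu>) = X \<mu>"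
        by (simp only: hor h_def snd_conv \<mu>(4) the_inv_into_f_f[OF inj_on_R \<mu>I])
      then show "p - (p \<bullet> \<nu>) *\<^sub>R \<nu> \<in> U"
        using \<mu>I \<mu>(4) Xpos by (auto simp: U_def U0_def hor)
      fix x assume x: "x \<in> V"
      have "x \<in> inner_set \<longleftrightarrow> (fst x)\<^sup>2 < h (x - (x \<bullet> \<nu>) *\<^sub>R \<nu>)"
        using x mem_inner_set_near_pole[of x] by (auto simp: V_def U0_def hor h_def)
      also have "(fst x)\<^sup>2 = (fst x * c)\<^sup>2"
        using c(2) by (simp add: power_mult_distrib power2_eq_square)
      finally show "x \<in> inner_set \<longleftrightarrow> x \<bullet> \<nu> < sqrt (h (x - (x \<bullet> \<nu>) *\<^sub>R \<nu>))"
        using x less_sqrt_iff[of "fst x * c"] by (cases x) (simp add: V_def \<nu>_def)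
    qed
  qed
qed

text \<open>The boundary of the ellipsoid, and the set at depth \<open>1/2\<close>, parametrized by the outer unit normal.\<close>

definition stretch :: "real \<times> 'b::real_normed_vector \<Rightarrow> real" where
  "stretch \<nu> = sqrt (1 + (a\<^sup>2 - 1) * (fst \<nu>)\<^sup>2)"

definition boundary_point :: "real \<times> 'b::real_normed_vector \<Rightarrow> real \<times> 'b" where
  "boundary_point \<nu> = (a\<^sup>2 / stretch \<nu> * fst \<nu>, (1 / stretch \<nu>) *\<^sub>R snd \<nu>)"

definition inner_point :: "real \<times> 'b::real_normed_vector \<Rightarrow> real \<times> 'b" where
  "inner_point \<nu> = boundary_point \<nu> - (1/2) *\<^sub>R \<nu>"

lemma unit_norm:
  fixes \<nu> :: "real \<times> 'b::real_normed_vector"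
  assumes "norm \<nu> = 1"
  shows "(norm (snd \<nu>))\<^sup>2 = 1 - (fst \<nu>)\<^sup>2" "(fst \<nu>)\<^sup>2 \<le> 1"
proof -
  show "(norm (snd \<nu>))\<^sup>2 = 1 - (fst \<nu>)\<^sup>2"
    using norm_prod_sq[of \<nu>] assms by simp
  then show "(fst \<nu>)\<^sup>2 \<le> 1" by (metis diff_ge_0_iff_ge zero_le_power2)
qed

text \<open>On unit vectors \<open>stretch\<close> is the support function of the ellipsoid, the
  norm of (a * fst \<nu>, snd \<nu>), hence it lies between the semi-axes 1 and a. It is the
  parameter \<mu> of the boundary point with normal \<nu>.\<close>

lemma stretch_bounds:
  assumes "norm \<nu> = 1"
  shows "1 \<le> stretch \<nu>" "stretch \<nu> \<le> a" "(stretch \<nu>)\<^sup>2 = 1 + (a\<^sup>2 - 1) * (fst \<nu>)\<^sup>2"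
proof -
  have a: "0 \<le> a\<^sup>2 - 1" using a_bounds(3) by simp
  then have m: "0 \<le> (a\<^sup>2 - 1) * (fst \<nu>)\<^sup>2" "(a\<^sup>2 - 1) * (fst \<nu>)\<^sup>2 \<le> a\<^sup>2 - 1"
    using unit_norm[OF assms] mult_left_mono[OF unit_norm(2)[OF assms] a] by auto
  then show "1 \<le> stretch \<nu>" "(stretch \<nu>)\<^sup>2 = 1 + (a\<^sup>2 - 1) * (fst \<nu>)\<^sup>2"
    by (auto simp: stretch_def)
  have "stretch \<nu> \<le> sqrt (a\<^sup>2)"
    unfolding stretch_def using m by (intro real_sqrt_le_mono) simp
  then show "stretch \<nu> \<le> a" using a_bounds by simp
qed

lemma inner_point_X_R:
  assumes "norm \<nu> = 1"
  shows "(fst (inner_point \<nu>))\<^sup>2 = X (stretch \<nu>)" "(norm (snd (inner_point \<nu>)))\<^sup>2 = R (stretch \<nu>)"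
proof -
  define \<mu> where "\<mu> = stretch \<nu>"
  have \<mu>: "1 \<le> \<mu>" "\<mu>\<^sup>2 = 1 + (a\<^sup>2 - 1) * (fst \<nu>)\<^sup>2"
    using stretch_bounds[OF assms] by (auto simp: \<mu>_def)
  have nz: "a\<^sup>2 - 1 \<noteq> 0" "\<mu> \<noteq> 0" using a_bounds(6) \<mu>(1) by auto
  have f: "(fst \<nu>)\<^sup>2 = (\<mu>\<^sup>2 - 1) / (a\<^sup>2 - 1)"
    using \<mu>(2) nz by simp
  have s: "(norm (snd \<nu>))\<^sup>2 = (a\<^sup>2 - \<mu>\<^sup>2) / (a\<^sup>2 - 1)"
    using unit_norm(1)[OF assms] f nz by (simp add: field_simps)
  have "fst (inner_point \<nu>) = (a\<^sup>2 - \<mu>/2) * inverse \<mu> * fst \<nu>"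
    using nz by (simp add: inner_point_def boundary_point_def \<mu>_def[symmetric] field_simps)
  then have "(fst (inner_point \<nu>))\<^sup>2 = (a\<^sup>2 - \<mu>/2)\<^sup>2 * ((inverse \<mu>)\<^sup>2 * (\<mu>\<^sup>2 - 1)) / (a\<^sup>2 - 1)"
    by (simp only: power_mult_distrib f) simp
  also have "(inverse \<mu>)\<^sup>2 * (\<mu>\<^sup>2 - 1) = 1 - (inverse \<mu>)\<^sup>2"
    using nz by (simp add: field_simps)
  finally show "(fst (inner_point \<nu>))\<^sup>2 = X (stretch \<nu>)"
    by (simp add: X_def \<mu>_def)
  have "snd (inner_point \<nu>) = ((1 - \<mu>/2) * inverse \<mu>) *\<^sub>R snd \<nu>"
    using nz by (simp add: inner_point_def boundary_point_def \<mu>_def[symmetric] field_simps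
        flip: scaleR_diff_left)
  then have "(norm (snd (inner_point \<nu>)))\<^sup>2 = (1 - \<mu>/2)\<^sup>2 * ((inverse \<mu>)\<^sup>2 * (a\<^sup>2 - \<mu>\<^sup>2)) / (a\<^sup>2 - 1)"
    by (simp only: norm_scaleR power_mult_distrib power2_abs s) simp
  also have "(inverse \<mu>)\<^sup>2 * (a\<^sup>2 - \<mu>\<^sup>2) = a\<^sup>2 * (inverse \<mu>)\<^sup>2 - 1"
    using nz by (simp add: field_simps)
  finally show "(norm (snd (inner_point \<nu>)))\<^sup>2 = R (stretch \<nu>)"
    by (simp add: R_def \<mu>_def)
qed

lemma frontier_inner_set_eq_image:
  "frontier (inner_set :: (real \<times> (real ^ 'm::finite)) set) = inner_point ` sphere 0 1"
proof (intro set_eqI iffI)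
  fix x :: "real \<times> (real ^ 'm)" assume "x \<in> inner_point ` sphere 0 1"
  then obtain \<nu> where "norm \<nu> = 1" "x = inner_point \<nu>" by auto
  then show "x \<in> frontier inner_set"
    unfolding frontier_inner_set using inner_point_X_R[of \<nu>] stretch_bounds[of \<nu>]
    by (intro CollectI exI[of _ "stretch \<nu>"]) simp
next
  fix x :: "real \<times> (real ^ 'm)" assume "x \<in> frontier inner_set"
  then obtain \<mu> where \<mu>: "1 \<le> \<mu>" "\<mu> \<le> a" "(fst x)\<^sup>2 = X \<mu>" "(norm (snd x))\<^sup>2 = R \<mu>"
    by (auto simp: frontier_inner_set)
  \<comment> \<open>\<open>inner_point \<nu>\<close> multiplies the two components of \<nu> by these
    factors, so dividing x by them recovers the normal.\<close>
  define c1 where "c1 = (a\<^sup>2 - \<mu>/2) * inverse \<mu>"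
  define c2 where "c2 = (1 - \<mu>/2) * inverse \<mu>"
  have nz: "a\<^sup>2 - 1 \<noteq> 0" "\<mu> \<noteq> 0" "0 < a\<^sup>2 - \<mu>/2" "0 < 1 - \<mu>/2"
    using a_bounds \<mu>(1,2) by auto
  then have c: "c1 \<noteq> 0" "c2 \<noteq> 0" by (auto simp: c1_def c2_def)
  define \<nu> where "\<nu> = (fst x / c1, snd x /\<^sub>R c2)"
  have cancel: "A\<^sup>2 * B / D / (A * inverse \<mu>)\<^sup>2 = \<mu>\<^sup>2 * B / D" if "A \<noteq> 0" for A B D
    using that nz(2) by (simp add: power_mult_distrib power_inverse divide_inverse)
  have "(fst \<nu>)\<^sup>2 = \<mu>\<^sup>2 * (1 - (inverse \<mu>)\<^sup>2) / (a\<^sup>2 - 1)"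
    using nz cancel[of "a\<^sup>2 - \<mu>/2" "1 - (inverse \<mu>)\<^sup>2" "a\<^sup>2 - 1"]
    by (simp only: \<nu>_def fst_conv power_divide \<mu>(3) X_def c1_def)
  also have "\<mu>\<^sup>2 * (1 - (inverse \<mu>)\<^sup>2) = \<mu>\<^sup>2 - 1"
    using nz by (simp add: field_simps)
  finally have f: "(fst \<nu>)\<^sup>2 = (\<mu>\<^sup>2 - 1) / (a\<^sup>2 - 1)" .
  have n2: "(norm (snd \<nu>))\<^sup>2 = (norm (snd x))\<^sup>2 / c2\<^sup>2"
  proof -
    have "norm (snd \<nu>) = norm (snd x) / \<bar>c2\<bar>"
      by (simp add: \<nu>_def divide_inverse mult.commute)
    then show ?thesis by (simp add: power_divide)
  qed
  have "(norm (snd \<nu>))\<^sup>2 = \<mu>\<^sup>2 * (a\<^sup>2 * (inverse \<mu>)\<^sup>2 - 1) / (a\<^sup>2 - 1)"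
    using nz cancel[of "1 - \<mu>/2" "a\<^sup>2 * (inverse \<mu>)\<^sup>2 - 1" "a\<^sup>2 - 1"]
    by (simp only: n2 \<mu>(4) R_def c2_def)
  also have "\<mu>\<^sup>2 * (a\<^sup>2 * (inverse \<mu>)\<^sup>2 - 1) = a\<^sup>2 - \<mu>\<^sup>2"
    using nz by (simp add: field_simps)
  finally have s: "(norm (snd \<nu>))\<^sup>2 = (a\<^sup>2 - \<mu>\<^sup>2) / (a\<^sup>2 - 1)" .
  have "(norm \<nu>)\<^sup>2 = 1"
    unfolding norm_prod_sq f s add_divide_distrib[symmetric] using nz by simp
  then have "norm \<nu> = 1" using norm_ge_zero[of \<nu>] by (auto simp: power2_eq_1_iff simp del: norm_ge_zero)
  have "1 + (a\<^sup>2 - 1) * (fst \<nu>)\<^sup>2 = \<mu>\<^sup>2"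
    using nz by (simp add: f)
  then have st: "stretch \<nu> = \<mu>"
    using \<mu>(1) by (simp add: stretch_def)
  have "fst (inner_point \<nu>) = c1 * fst \<nu>"
    using nz by (simp add: inner_point_def boundary_point_def st c1_def field_simps)
  moreover have "snd (inner_point \<nu>) = c2 *\<^sub>R snd \<nu>"
    using nz by (simp add: inner_point_def boundary_point_def st c2_def field_simps
        flip: scaleR_diff_left)
  ultimately have "inner_point \<nu> = x"
    using c by (simp add: \<nu>_def prod_eq_iff)
  then show "x \<in> inner_point ` sphere 0 1"
    using \<open>norm \<nu> = 1\<close> by (auto simp: image_iff)
qed

text \<open>N is half the gradient of the quadratic form at p. Its normalization is the outer
  normal, and \<open>stretch \<nu>\<close> is 1 / |N|, so the formula for the boundary point undoes
  the normalization.\<close>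

lemma boundary_point_exists:
  fixes p :: "real \<times> 'b::real_normed_vector"
  assumes "(fst p)\<^sup>2 / a\<^sup>2 + (norm (snd p))\<^sup>2 = 1"
  obtains \<nu> where "norm \<nu> = 1" "boundary_point \<nu> = p"
proof -
  define N where "N = (fst p / a\<^sup>2, snd p)"
  have "N \<noteq> 0" using assms by (auto simp: N_def zero_prod_def)
  then have N0: "norm N > 0" by simp
  define \<nu> where "\<nu> = N /\<^sub>R norm N"
  have a0: "a > 0" by (rule a_bounds)
  have N1: "a\<^sup>2 * (fst N)\<^sup>2 + (norm (snd N))\<^sup>2 = 1"
    using assms a0 by (simp add: N_def power_divide power2_eq_square)
  have "(norm N)\<^sup>2 * (1 + (a\<^sup>2 - 1) * (fst \<nu>)\<^sup>2) = (norm N)\<^sup>2 + (a\<^sup>2 - 1) * (fst N)\<^sup>2"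
    using N0 by (simp add: \<nu>_def power_mult_distrib power_inverse distrib_left)
  also have "\<dots> = 1"
    using N1 by (simp add: norm_prod_sq algebra_simps)
  finally have "1 + (a\<^sup>2 - 1) * (fst \<nu>)\<^sup>2 = (1 / norm N)\<^sup>2"
    using N0 by (simp add: field_simps)
  then have st: "stretch \<nu> = 1 / norm N"
    using N0 by (simp add: stretch_def)
  show thesis
  proof (rule that[of \<nu>])
    show "norm \<nu> = 1" using N0 by (simp add: \<nu>_def)
    show "boundary_point \<nu> = p"
    proof -
      have "boundary_point \<nu> = (a\<^sup>2 * fst N, snd N)"
        unfolding boundary_point_def st using N0 by (simp add: \<nu>_def)
      then show ?thesis using a0 by (simp add: N_def)
    qed
  qed
qed

section \<open>The Minkowski sum with the ball\<close>

lemma inner_set_subset: "inner_set \<subseteq> (ellipsoid \<epsilon> :: (real \<times> (real ^ 'm::finite)) set)"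
proof
  fix x :: "real \<times> (real ^ 'm)" assume "x \<in> inner_set"
  moreover have "x \<in> cball x (1/2)" by simp
  ultimately show "x \<in> ellipsoid \<epsilon>" unfolding inner_set_def by blast
qed

lemma inner_set_plus_ball:
  "inner_set + ball 0 (1/2) = (ellipsoid \<epsilon> :: (real \<times> (real ^ 'm::finite)) set)"
proof (intro equalityI subsetI)
  fix y :: "real \<times> (real ^ 'm)" assume "y \<in> inner_set + ball 0 (1/2)"
  then obtain x b where "x \<in> inner_set" "norm b < 1/2" "y = x + b"
    by (auto elim!: set_plus_elim)
  moreover have "x + b \<in> cball x (1/2)"
    using \<open>norm b < 1/2\<close> by (simp add: dist_norm)
  ultimately show "y \<in> ellipsoid \<epsilon>" unfolding inner_set_def by blast
next
  fix y :: "real \<times> (real ^ 'm)" assume y: "y \<in> ellipsoid \<epsilon>"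
  define l where "l = sqrt ((fst y)\<^sup>2 / a\<^sup>2 + (norm (snd y))\<^sup>2)"
  have l: "0 \<le> l" "l\<^sup>2 = (fst y)\<^sup>2 / a\<^sup>2 + (norm (snd y))\<^sup>2"
    by (auto simp: l_def)
  then have l2: "l\<^sup>2 < 1" using y by (simp add: mem_ellipsoid)
  then have l1: "l < 1" using l(1) by (simp add: power_less_one_iff abs_square_less_1)
  have "\<exists>x. x \<in> inner_set \<and> dist x y < 1/2"
  proof (cases "l = 0")
    case True
    then have "(norm (snd y))\<^sup>2 \<le> 0" "(fst y)\<^sup>2 / a\<^sup>2 \<le> 0"
      using l(2) by (smt (verit) zero_le_power2 divide_nonneg_nonneg zero_power2)+
    then have "y = 0" using a_bounds(4) by (auto simp: prod_eq_iff divide_le_0_iff)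
    then have "y \<in> inner_set"
      using mem_inner_set[of 1 y] X_R_special a_bounds by simp
    then show ?thesis by (intro exI[of _ y]) simp
  next
    case False
    \<comment> \<open>Scale y out to the boundary, step in by 1/2 along the normal and scale back by
      l. The result lies in the open set because l < 1, and its distance to y is l / 2, strictly
      below 1/2.\<close>
    define p where "p = y /\<^sub>R l"
    have yp: "y = l *\<^sub>R p" using False by (simp add: p_def)
    have "l\<^sup>2 * ((fst p)\<^sup>2 / a\<^sup>2 + (norm (snd p))\<^sup>2) = l\<^sup>2 * 1"
      using l unfolding yp by (simp add: power_mult_distrib distrib_left)
    then have "(fst p)\<^sup>2 / a\<^sup>2 + (norm (snd p))\<^sup>2 = 1"
      using False by (subst (asm) mult_cancel_left) simp
    then obtain \<nu> where \<nu>: "norm \<nu> = 1" "boundary_point \<nu> = p"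
      by (rule boundary_point_exists)
    define \<mu> where "\<mu> = stretch \<nu>"
    have \<mu>: "1 \<le> \<mu>" "\<mu> \<le> a" using stretch_bounds[OF \<nu>(1)] by (auto simp: \<mu>_def)
    note XR = inner_point_X_R[OF \<nu>(1), folded \<mu>_def]
    have pos: "0 < X \<mu> \<or> 0 < R \<mu>"
      using X_mono[of 1 \<mu>] X_R_special \<mu> a_bounds by (cases "\<mu> = 1") auto
    have "l *\<^sub>R inner_point \<nu> \<in> inner_set"
    proof (rule mem_inner_set[OF \<mu>])
      have le: "l\<^sup>2 * X \<mu> \<le> X \<mu>" "l\<^sup>2 * R \<mu> \<le> R \<mu>"
        using XR l2 by (metis mult_left_le_one_le zero_le_power2 less_imp_le)+
      have lt: "l\<^sup>2 * X \<mu> < X \<mu> \<or> l\<^sup>2 * R \<mu> < R \<mu>"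
        using pos l2 by auto
      show "(fst (l *\<^sub>R inner_point \<nu>))\<^sup>2 \<le> X \<mu>" "(norm (snd (l *\<^sub>R inner_point \<nu>)))\<^sup>2 \<le> R \<mu>"
        "(fst (l *\<^sub>R inner_point \<nu>))\<^sup>2 < X \<mu> \<or> (norm (snd (l *\<^sub>R inner_point \<nu>)))\<^sup>2 < R \<mu>"
        using le lt XR by (auto simp: power_mult_distrib)
    qed
    moreover have "l *\<^sub>R inner_point \<nu> - y = (- l / 2) *\<^sub>R \<nu>"
      by (simp add: inner_point_def \<nu>(2) yp scaleR_diff_right)
    then have "dist (l *\<^sub>R inner_point \<nu>) y < 1/2"
      using l(1) l1 \<nu>(1) by (simp add: dist_norm)
    ultimately show ?thesis by blast
  qed
  then obtain x where "x \<in> inner_set" "dist x y < 1/2" by blast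
  moreover have "y = x + (y - x)" by simp
  moreover have "y - x \<in> ball 0 (1/2)"
    using \<open>dist x y < 1/2\<close> by (simp add: dist_norm norm_minus_commute)
  ultimately show "y \<in> inner_set + ball 0 (1/2)"
    by (metis set_plus_intro)
qed

end

section \<open>The one-dimensional profile\<close>

definition pos_pow :: "real \<Rightarrow> real \<Rightarrow> real" where
  "pos_pow s t = max 0 t powr s"

lemma pos_pow_nonneg: "0 \<le> pos_pow s t"
  by (simp add: pos_pow_def)

lemma pos_pow_le_1: "0 < s \<Longrightarrow> t \<le> 1 \<Longrightarrow> pos_pow s t \<le> 1"
  unfolding pos_pow_def by (rule powr_le1) auto

lemma pos_pow_mult: "0 < D \<Longrightarrow> pos_pow s (D * t) = D powr s * pos_pow s t"
  unfolding pos_pow_def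
  by (cases "0 \<le> t") (auto simp: max_def powr_mult mult_pos_neg not_le)

lemma continuous_on_pos_pow:
  assumes "0 < s" "continuous_on S f"
  shows "continuous_on S (\<lambda>x. pos_pow s (f x))"
  unfolding pos_pow_def
  by (rule continuous_on_powr') (use assms in \<open>auto intro!: continuous_intros\<close>)

text \<open>One constant serves all s and all h, inside and outside the support. For x = 1 + h > 0
  the upper bound is Young's inequality with weights s and 1 - s; the lower one writes x^s as x *
  x^(-(1 - s)) and uses x^(-(1 - s)) >= 1 - (1 - s) ln x >= 1 - (1 - s) h.\<close>

lemma pos_pow_taylor:
  assumes "0 < s" "s < 1"
  shows "\<bar>pos_pow s (1 + h) - (1 + s * h)\<bar> \<le> 2 * h\<^sup>2"
proof (cases "h \<le> -1")
  case True
  have "s * h \<le> 0" "h \<le> s * h"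
    using assms True mult_right_mono_neg[of s 1 h] by (auto simp: mult_le_0_iff)
  moreover have "- h \<le> h\<^sup>2"
    using True mult_left_mono_neg[of h "-1" h] by (simp add: power2_eq_square)
  moreover have "pos_pow s (1 + h) = 0"
    using True by (simp add: pos_pow_def)
  ultimately show ?thesis
    using True unfolding abs_le_iff by linarith
next
  case False
  define x where "x = 1 + h"
  have x: "x > 0" using False by (simp add: x_def)
  have ln: "ln x \<le> h" using ln_le_minus_one[OF x] by (simp add: x_def)
  have "1 - (1 - s) * h \<le> 1 + (- (1 - s)) * ln x"
    using ln mult_left_mono[OF ln, of "1 - s"] assms by (simp add: algebra_simps)
  also have "\<dots> \<le> x powr (- (1 - s))"
    using x exp_ge_add_one_self[of "(- (1 - s)) * ln x"] by (simp add: powr_def)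
  finally have "x * (1 - (1 - s) * h) \<le> x * x powr (- (1 - s))"
    using x by (intro mult_left_mono) auto
  also have "\<dots> = x powr s"
    using x powr_add[of x 1 "- (1 - s)"] by simp
  finally have lo: "1 + s * h - (1 - s) * h\<^sup>2 \<le> x powr s"
    by (simp add: x_def algebra_simps power2_eq_square)
  have up: "x powr s \<le> 1 + s * h"
    using Youngs_inequality_0[of s "1 - s" x 1] assms x by (simp add: x_def algebra_simps)
  have "(1 - s) * h\<^sup>2 \<le> 1 * h\<^sup>2"
    using assms by (intro mult_right_mono) auto
  then show ?thesis
    using lo up x unfolding pos_pow_def x_def[symmetric] by (simp add: abs_le_iff)
qed

text \<open>
  In terms of \<open>h = (1 - \<bar>A (x + z)\<bar>\<^sup>2) / (1 - \<bar>A x\<bar>\<^sup>2) - 1\<close> the increments of the profile are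
  increments of \<open>h \<mapsto> (1 + h)\<^sub>+\<^sup>s\<close>, whose first-order terms cancel between \<open>z\<close> and \<open>- z\<close>.
\<close>

lemma profile_increments:
  fixes A :: "'a::real_normed_vector \<Rightarrow> 'b::real_inner"
  assumes "0 < s" "s < 1" "bounded_linear A" "norm (A x) < 1"
  defines "u \<equiv> \<lambda>x. pos_pow s (1 - (norm (A x))\<^sup>2)"
  shows "\<exists>M\<ge>0. \<forall>z. \<bar>2 * u x - u (x + z) - u (x - z)\<bar> \<le> M * min 1 ((norm z)\<^sup>2)"
    and "\<exists>L\<ge>0. \<forall>z. \<bar>u (x + z) - u x\<bar> \<le> L * norm z"
proof -
  interpret A: bounded_linear A by fact
  obtain K where K: "K > 0" "\<And>z. norm (A z) \<le> norm z * K"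
    using A.pos_bounded by auto
  define D where "D = 1 - (norm (A x))\<^sup>2"
  have D: "D > 0"
    using assms(4) power_strict_mono[of "norm (A x)" 1 2] by (simp add: D_def)
  define h where "h = (\<lambda>z. (- 2 * (A x \<bullet> A z) - (norm (A z))\<^sup>2) / D)"
  define H where "H = (2 * K + K\<^sup>2) / D"
  have H0: "H \<ge> 0" using K D by (simp add: H_def)
  have u: "u (x + z) = D powr s * pos_pow s (1 + h z)" for z
  proof -
    have "1 - (norm (A (x + z)))\<^sup>2 = D * (1 + h z)"
      using D by (simp add: h_def A.add power2_norm_eq_inner inner_add_left inner_add_right
          inner_commute D_def field_simps)
    then show ?thesis using D by (simp add: u_def pos_pow_mult)
  qed
  have u0: "u x = D powr s"
    using u[of 0] by (simp add: h_def A.zero pos_pow_def)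
  have u1: "0 \<le> u y" "u y \<le> 1" for y
    using assms(1) by (auto simp: u_def pos_pow_nonneg intro!: pos_pow_le_1)
  have Az: "(norm (A z))\<^sup>2 \<le> K\<^sup>2 * (norm z)\<^sup>2" for z
    using power_mono[OF K(2), of z 2] by (simp add: power_mult_distrib mult.commute)
  have h: "\<bar>h z\<bar> \<le> H * norm z" if z: "norm z \<le> 1" for z
  proof -
    have "\<bar>A x \<bullet> A z\<bar> \<le> norm (A x) * norm (A z)" by (rule Cauchy_Schwarz_ineq2)
    also have "\<dots> \<le> 1 * (norm z * K)"
      using K assms(4) by (intro mult_mono) auto
    finally have 1: "\<bar>A x \<bullet> A z\<bar> \<le> norm z * K" by simp
    have "(norm z)\<^sup>2 \<le> norm z"
      using z by (simp add: power2_eq_square mult_left_le)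
    then have "K\<^sup>2 * (norm z)\<^sup>2 \<le> K\<^sup>2 * norm z" by (rule mult_left_mono) simp
    then have "(norm (A z))\<^sup>2 \<le> K\<^sup>2 * norm z"
      using Az[of z] by linarith
    then have "\<bar>- 2 * (A x \<bullet> A z) - (norm (A z))\<^sup>2\<bar> \<le> 2 * (norm z * K) + K\<^sup>2 * norm z"
      using 1 zero_le_power2[of "norm (A z)"] by linarith
    then have "\<bar>- 2 * (A x \<bullet> A z) - (norm (A z))\<^sup>2\<bar> \<le> (2 * K + K\<^sup>2) * norm z"
      by (simp add: algebra_simps)
    then show ?thesis
      using D by (simp add: h_def H_def abs_divide divide_le_cancel)
  qed
  have h2: "(h z)\<^sup>2 \<le> H\<^sup>2 * (norm z)\<^sup>2" if z: "norm z \<le> 1" for z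
    using power_mono[OF h[OF z], of 2] by (simp add: power_mult_distrib)
  \<comment> \<open>The summand 4 covers norm z > 1, where only 0 <= u <= 1 is used.\<close>
  define M where "M = D powr s * (2 * K\<^sup>2 / D + 4 * H\<^sup>2) + 4"
  have "\<bar>2 * u x - u (x + z) - u (x - z)\<bar> \<le> M * min 1 ((norm z)\<^sup>2)" for z
  proof (cases "norm z \<le> 1")
    case True
    have m: "min 1 ((norm z)\<^sup>2) = (norm z)\<^sup>2"
      using True by (simp add: min_absorb2 power_le_one)
    have t1: "\<bar>pos_pow s (1 + h z) - (1 + s * h z)\<bar> \<le> 2 * (h z)\<^sup>2"
      and t2: "\<bar>pos_pow s (1 + h (- z)) - (1 + s * h (- z))\<bar> \<le> 2 * (h (- z))\<^sup>2"
      using pos_pow_taylor assms by blast+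
    have "h z + h (- z) = - (2 * (norm (A z))\<^sup>2) / D"
      by (simp add: h_def linear_neg[OF A.linear_axioms] add_divide_distrib[symmetric])
    then have hs: "s * h z + s * h (- z) = - (s * (2 * (norm (A z))\<^sup>2 / D))"
      by (simp add: distrib_left[symmetric])
    have "s * (2 * (norm (A z))\<^sup>2 / D) \<le> 1 * (2 * (K\<^sup>2 * (norm z)\<^sup>2) / D)"
      using Az[of z] D assms by (intro mult_mono divide_right_mono) auto
    moreover have "0 \<le> s * (2 * (norm (A z))\<^sup>2 / D)"
      using D assms by simp
    moreover have "(h z)\<^sup>2 \<le> H\<^sup>2 * (norm z)\<^sup>2" "(h (- z))\<^sup>2 \<le> H\<^sup>2 * (norm z)\<^sup>2"
      using h2[of z] h2[of "- z"] True by auto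
    moreover have "\<bar>2 - p - q\<bar> \<le> c + 4 * e"
      if "\<bar>p - (1 + x)\<bar> \<le> 2 * f" "\<bar>q - (1 + y)\<bar> \<le> 2 * g" "x + y = - w" "w \<le> 1 * c" "0 \<le> w" "f \<le> e" "g \<le> e"
      for p q x y w c e f g :: real
      using that unfolding abs_le_iff by linarith
    ultimately have "\<bar>2 - pos_pow s (1 + h z) - pos_pow s (1 + h (- z))\<bar>
        \<le> 2 * (K\<^sup>2 * (norm z)\<^sup>2) / D + 4 * (H\<^sup>2 * (norm z)\<^sup>2)"
      using t1 t2 hs by blast
    also have "\<dots> = (2 * K\<^sup>2 / D + 4 * H\<^sup>2) * (norm z)\<^sup>2"
      by (simp add: algebra_simps)
    finally have "D powr s * \<bar>2 - pos_pow s (1 + h z) - pos_pow s (1 + h (- z))\<bar>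
        \<le> D powr s * ((2 * K\<^sup>2 / D + 4 * H\<^sup>2) * (norm z)\<^sup>2)"
      by (rule mult_left_mono) simp
    also have "\<dots> \<le> M * (norm z)\<^sup>2"
      by (simp add: M_def algebra_simps)
    also have "D powr s * \<bar>2 - pos_pow s (1 + h z) - pos_pow s (1 + h (- z))\<bar>
        = \<bar>2 * u x - u (x + z) - u (x - z)\<bar>"
    proof -
      have "D powr s * (2 - pos_pow s (1 + h z) - pos_pow s (1 + h (- z))) = 2 * u x - u (x + z) - u (x - z)"
        using u[of z] u[of "- z"] u0 by (simp add: algebra_simps)
      then show ?thesis by (metis abs_mult abs_of_nonneg powr_ge_zero)
    qed
    finally show ?thesis by (simp add: m)
  next
    case False
    then have "min 1 ((norm z)\<^sup>2) = 1"
      by (simp add: min_absorb1)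
    moreover have "M \<ge> 4" using D K by (simp add: M_def)
    ultimately show ?thesis
      using u1[of x] u1[of "x + z"] u1[of "x - z"] by simp
  qed
  moreover have "M \<ge> 0" using D by (simp add: M_def)
  ultimately show "\<exists>M\<ge>0. \<forall>z. \<bar>2 * u x - u (x + z) - u (x - z)\<bar> \<le> M * min 1 ((norm z)\<^sup>2)"
    by blast
  define L where "L = D powr s * (H + 2 * H\<^sup>2) + 1"
  have "\<bar>u (x + z) - u x\<bar> \<le> L * norm z" for z
  proof (cases "norm z \<le> 1")
    case True
    have "\<bar>s * h z\<bar> \<le> 1 * \<bar>h z\<bar>"
      unfolding abs_mult using assms by (intro mult_right_mono) auto
    moreover have "H\<^sup>2 * (norm z)\<^sup>2 \<le> H\<^sup>2 * norm z"
      using True by (intro mult_left_mono) (auto simp: power2_eq_square mult_left_le)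
    moreover have "\<bar>pos_pow s (1 + h z) - (1 + s * h z)\<bar> \<le> 2 * (h z)\<^sup>2"
      using pos_pow_taylor assms by blast
    ultimately have "\<bar>pos_pow s (1 + h z) - 1\<bar> \<le> (H + 2 * H\<^sup>2) * norm z"
      using h[OF True] h2[OF True] by (simp add: algebra_simps abs_le_iff) linarith
    then have "D powr s * \<bar>pos_pow s (1 + h z) - 1\<bar> \<le> D powr s * ((H + 2 * H\<^sup>2) * norm z)"
      by (rule mult_left_mono) simp
    also have "\<dots> \<le> L * norm z" by (simp add: L_def algebra_simps)
    also have "D powr s * \<bar>pos_pow s (1 + h z) - 1\<bar> = \<bar>u (x + z) - u x\<bar>"
    proof -
      have "D powr s * (pos_pow s (1 + h z) - 1) = u (x + z) - u x"
        using u[of z] u0 by (simp add: algebra_simps)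
      then show ?thesis by (metis abs_mult abs_of_nonneg powr_ge_zero)
    qed
    finally show ?thesis .
  next
    case False
    have "1 * 1 \<le> L * norm z"
      using False H0 by (intro mult_mono) (auto simp: L_def)
    then show ?thesis
      using u1[of x] u1[of "x + z"] by simp
  qed
  moreover have "L \<ge> 0" using H0 by (simp add: L_def)
  ultimately show "\<exists>L\<ge>0. \<forall>z. \<bar>u (x + z) - u x\<bar> \<le> L * norm z" by blast
qed

section \<open>One-dimensional kernel integrals\<close>

lemma has_bochner_integral_kernel_scale:
  fixes \<phi> :: "real \<Rightarrow> real"
  assumes "has_bochner_integral lborel (\<lambda>t. indicator {0<..} t * (\<phi> t * t powr p)) I" "0 < c"
  shows "has_bochner_integral lborel (\<lambda>t. indicator {0<..} t * (\<phi> (c * t) * t powr p))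
    (c powr (- 1 - p) * I)"
proof -
  have "has_bochner_integral lborel
      (\<lambda>t. indicator {0<..} (0 + c * t) * (\<phi> (0 + c * t) * (0 + c * t) powr p)) (I /\<^sub>R \<bar>c\<bar>)"
    using assms by (subst (asm) lborel_has_bochner_integral_real_affine_iff[of c _ _ 0]) auto
  then have "has_bochner_integral lborel (\<lambda>t. c powr (- p) *
      (indicator {0<..} (0 + c * t) * (\<phi> (0 + c * t) * (0 + c * t) powr p))) (c powr (- p) * (I /\<^sub>R \<bar>c\<bar>))"
    by (rule has_bochner_integral_mult_right)
  moreover have "(\<lambda>t. c powr (- p) * (indicator {0<..} (0 + c * t) * (\<phi> (0 + c * t) * (0 + c * t) powr p)))
      = (\<lambda>t. indicator {0<..} t * (\<phi> (c * t) * t powr p))"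
    using assms(2) by (intro ext) (auto simp: indicator_def powr_mult powr_minus zero_less_mult_iff)
  moreover have "c powr (- p) * (I /\<^sub>R \<bar>c\<bar>) = c powr (- 1 - p) * I"
    using assms(2) powr_add[of c "-1" "-p"] by (simp add: powr_minus field_simps)
  ultimately show ?thesis by (simp only:)
qed

text \<open>The square tames the kernel at 0 because s < 1, the constant 1 suffices at infinity
  because s > 0, and the two pieces give the two summands. This is the majorant of second
  differences, and also the term that later makes integrands nonnegative.\<close>

lemma has_bochner_integral_min_kernel:
  fixes s r :: real
  assumes "0 < s" "s < 1" "0 < r"
  shows "has_bochner_integral lborel
    (\<lambda>t. indicator {0<..} t * (min 1 ((r * t)\<^sup>2) * t powr (- 1 - 2 * s)))
    (r powr (2 * s) * (1 / (2 - 2 * s) + 1 / (2 * s)))"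
proof -
  let ?f = "\<lambda>t :: real. min 1 (t\<^sup>2) * t powr (- 1 - 2 * s)"
  have "(?f has_integral 1 / (2 - 2 * s)) {0..1}"
  proof (rule has_integral_eq)
    show "((\<lambda>t. t powr (1 - 2 * s)) has_integral 1 / (2 - 2 * s)) {0..1}"
      using has_integral_powr_from_0[of "1 - 2 * s" 1] assms by (simp add: algebra_simps)
    fix t :: real assume "t \<in> {0..1}"
    moreover from this have "min 1 (t\<^sup>2) = t\<^sup>2" by (simp add: power_le_one)
    ultimately show "t powr (1 - 2 * s) = ?f t"
      using powr_add[of t 2 "- 1 - 2 * s"] by (cases "t = 0") auto
  qed
  moreover have "(?f has_integral 1 / (2 * s)) {1..}"
  proof (rule has_integral_eq)
    show "((\<lambda>t. t powr (- 1 - 2 * s)) has_integral 1 / (2 * s)) {1..}"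
      using has_integral_powr_to_inf[of "- 1 - 2 * s" 1] assms by (simp add: algebra_simps)
    fix t :: real assume "t \<in> {1..}"
    then have "min 1 (t\<^sup>2) = 1" by (simp add: min_absorb1)
    then show "t powr (- 1 - 2 * s) = ?f t" by simp
  qed
  moreover have "{0..1} \<inter> {1..} = {1 :: real}" "{0..1} \<union> {1..} = {0 :: real..}" by auto
  ultimately have "(?f has_integral (1 / (2 - 2 * s) + 1 / (2 * s))) {0..}"
    using has_integral_Un[of ?f _ "{0..1}" _ "{1..}"] by simp
  then have "(\<integral>\<^sup>+t. ennreal (indicator {0..} t * ?f t) \<partial>lborel) = ennreal (1 / (2 - 2 * s) + 1 / (2 * s))"
    by (intro nn_integral_has_integral_lebesgue) auto
  moreover have "indicator {0..} t * ?f t = indicator {0<..} t * ?f t" for t :: real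
    by (cases "t = 0") (auto simp: indicator_def)
  ultimately have "has_bochner_integral lborel (\<lambda>t. indicator {0<..} t * ?f t) (1 / (2 - 2 * s) + 1 / (2 * s))"
    using assms by (intro has_bochner_integral_nn_integral) auto
  from has_bochner_integral_kernel_scale[OF this assms(3)] show ?thesis by simp
qed

text \<open>Power arithmetic, checked on logarithms, for w = 1 - h^2 and q = 1 + \<xi> h, 1 - \<xi>
  h or 1 - \<xi>^2 h^2. The first identity serves the derivative of the truncated integrals, the
  second that of the Beta-type comparison function, the last two the terms that diverge as h tends
  to 0.\<close>

lemma powr_mobius_identities:
  fixes a h q w s :: real
  assumes "0 < a" "0 < h" "0 < q" "0 < w"
  shows "(a * w / q\<^sup>2) powr s * (a * h / q) powr (- 1 - 2 * s) * (a / q\<^sup>2)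
      = a powr (- s) * w powr s * h powr (- 1 - 2 * s) / q"
    and "(w / q) powr s * (a * h\<^sup>2 / q) powr (- s - 1) * (2 * a * h / q\<^sup>2)
      = 2 * (a powr (- s) * w powr s * h powr (- 1 - 2 * s)) / q"
    and "(w / q) powr s * (a * h\<^sup>2 / q) powr (- s) = a powr (- s) * h powr (- 2 * s) * w powr s"
    and "a powr s * (a * h / q) powr (- 2 * s) = a powr (- s) * h powr (- 2 * s) * q powr (2 * s)"
proof -
  have e: "a = exp (ln a)" "h = exp (ln h)" "q = exp (ln q)" "w = exp (ln w)"
    using assms by auto
  define A B Q W where "A = ln a" "B = ln h" "Q = ln q" "W = ln w"
  note e = e[folded this]
  have *: "exp A * exp W / (exp Q)\<^sup>2 = exp (A + W - (Q + Q))" "exp A * exp B / exp Q = exp (A + B - Q)"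
    "exp A / (exp Q)\<^sup>2 = exp (A - (Q + Q))" "exp W / exp Q = exp (W - Q)"
    "exp A * (exp B)\<^sup>2 / exp Q = exp (A + (B + B) - Q)"
    "2 * exp A * exp B / (exp Q)\<^sup>2 = 2 * exp (A + B - (Q + Q))"
    unfolding power2_eq_square exp_add exp_diff by simp_all
  have "exp ((A + W - (Q + Q)) * s) * exp ((A + B - Q) * (- 1 - 2 * s)) * exp (A - (Q + Q))
      = exp (A * (- s)) * exp (W * s) * exp (B * (- 1 - 2 * s)) / exp Q"
    unfolding exp_add[symmetric] exp_diff[symmetric] by (simp add: algebra_simps)
  then show "(a * w / q\<^sup>2) powr s * (a * h / q) powr (- 1 - 2 * s) * (a / q\<^sup>2)
      = a powr (- s) * w powr s * h powr (- 1 - 2 * s) / q"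
    unfolding e * exp_powr_real .
  have "exp ((W - Q) * s) * exp ((A + (B + B) - Q) * (- s - 1)) * exp (A + B - (Q + Q))
      = exp (A * (- s)) * exp (W * s) * exp (B * (- 1 - 2 * s)) / exp Q"
    unfolding exp_add[symmetric] exp_diff[symmetric] by (simp add: algebra_simps)
  then show "(w / q) powr s * (a * h\<^sup>2 / q) powr (- s - 1) * (2 * a * h / q\<^sup>2)
      = 2 * (a powr (- s) * w powr s * h powr (- 1 - 2 * s)) / q"
    unfolding e * exp_powr_real by simp
  show "(w / q) powr s * (a * h\<^sup>2 / q) powr (- s) = a powr (- s) * h powr (- 2 * s) * w powr s"
    "a powr s * (a * h / q) powr (- 2 * s) = a powr (- s) * h powr (- 2 * s) * q powr (2 * s)"
    unfolding e * unfolding exp_powr_real exp_add[symmetric] by (simp_all add: algebra_simps)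
qed

text \<open>
  The principal value of the kernel against the one-dimensional profile is computed with the
  asymmetric truncation that the Moebius map \<open>h \<mapsto> (\<xi> + h) / (1 + \<xi> h)\<close> makes symmetric: the
  truncated integrals then have the same derivative in \<open>h\<close> as an incomplete Beta integral.
\<close>

locale interval_profile =
  fixes s \<xi> :: real
  assumes s: "0 < s" "s < 1" and \<xi>: "\<bar>\<xi>\<bar> < 1"
begin

definition v :: "real \<Rightarrow> real" where
  "v y = pos_pow s (1 - y\<^sup>2)"

definition k :: "real \<Rightarrow> real \<Rightarrow> real" where
  "k \<sigma> t = v (\<xi> + \<sigma> * t) * t powr (- 1 - 2 * s)"

definition P :: "real \<Rightarrow> real \<Rightarrow> real" where
  "P \<sigma> \<delta> = integral {\<delta>..2} (k \<sigma>)"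

text \<open>For \<sigma> = 1 or -1 this is the one-sided integral of (v \<xi> - v (\<xi> + \<sigma>
  t)) t^(-1 - 2 s) over t > \<delta>. The first term integrates the power up to infinity;
  \<open>P\<close> may stop at 2, since v vanishes outside [-1, 1].\<close>

definition E :: "real \<Rightarrow> real \<Rightarrow> real" where
  "E \<sigma> \<delta> = v \<xi> * \<delta> powr (- 2 * s) / (2 * s) - P \<sigma> \<delta>"

definition a :: real where "a = 1 - \<xi>\<^sup>2"

text \<open>The distance from \<xi> to the image of \<sigma> h under the Moebius map, for \<sigma> =
  1 or -1.\<close>

definition d :: "real \<Rightarrow> real \<Rightarrow> real" where
  "d \<sigma> h = a * h / (1 + \<sigma> * \<xi> * h)"

text \<open>Chosen so that 1 - T h = (1 - h^2) / (1 - \<xi>^2 h^2); it is the substitution that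
  turns the h-integral into one of Beta type.\<close>

definition T :: "real \<Rightarrow> real" where
  "T h = a * h\<^sup>2 / (1 - \<xi>\<^sup>2 * h\<^sup>2)"

definition b :: "real \<Rightarrow> real" where
  "b \<tau> = integral {0..\<tau>} (\<lambda>t. t powr (- s) * (1 - t) powr (s - 1))"

lemma \<xi>_sq: "\<xi>\<^sup>2 < 1"
  using \<xi> by (simp add: abs_square_less_1)

lemma a_pos: "0 < a" "a \<le> 1"
  using \<xi>_sq by (auto simp: a_def)

lemma continuous_v: "continuous_on S f \<Longrightarrow> continuous_on S (\<lambda>x. v (f x))"
  unfolding v_def by (intro continuous_on_pos_pow s continuous_intros)

lemma v_measurable [measurable]: "v \<in> borel_measurable borel"
  using continuous_v[of UNIV "\<lambda>x. x"] by (intro borel_measurable_continuous_onI) simp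

lemma continuous_k: "0 < c \<Longrightarrow> continuous_on {c..e} (k \<sigma>)"
  unfolding k_def[abs_def] by (intro continuous_intros continuous_v) auto

lemma P_deriv:
  assumes "0 < \<delta>" "\<delta> < 2"
  shows "(P \<sigma> has_field_derivative - k \<sigma> \<delta>) (at \<delta>)"
proof -
  have "((\<lambda>x. integral {x..2} (k \<sigma>)) has_field_derivative - k \<sigma> \<delta>) (at \<delta> within {\<delta>/2..2})"
    using assms by (intro integral_has_real_derivative' continuous_k) auto
  moreover have "at \<delta> within {\<delta>/2..2} = at \<delta>"
    using assms by (intro at_within_Icc_at) auto
  ultimately show ?thesis by (simp add: P_def[abs_def])
qed

lemma E_deriv:
  assumes "0 < \<delta>" "\<delta> < 2"
  shows "(E \<sigma> has_field_derivative - ((v \<xi> - v (\<xi> + \<sigma> * \<delta>)) * \<delta> powr (- 1 - 2 * s))) (at \<delta>)"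
proof -
  have "((\<lambda>\<delta>. v \<xi> * \<delta> powr (- 2 * s) / (2 * s)) has_field_derivative
      v \<xi> * ((- 2 * s) * \<delta> powr (- 2 * s - 1)) / (2 * s)) (at \<delta>)"
    using assms by (intro DERIV_cdivide DERIV_cmult has_real_derivative_powr) auto
  moreover have "v \<xi> * ((- 2 * s) * \<delta> powr (- 2 * s - 1)) / (2 * s) = - (v \<xi> * \<delta> powr (- 1 - 2 * s))"
  proof -
    have e: "\<delta> powr (- 2 * s - 1) = \<delta> powr (- 1 - 2 * s)"
      by (rule arg_cong[where f="(powr) \<delta>"]) simp
    show ?thesis unfolding e using s by simp
  qed
  ultimately have "((\<lambda>\<delta>. v \<xi> * \<delta> powr (- 2 * s) / (2 * s) - P \<sigma> \<delta>) has_field_derivative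
      - (v \<xi> * \<delta> powr (- 1 - 2 * s)) - (- k \<sigma> \<delta>)) (at \<delta>)"
    using P_deriv[OF assms] by (intro DERIV_diff) auto
  then show ?thesis
    by (simp add: E_def[abs_def] k_def algebra_simps)
qed

lemma denominator_pos:
  assumes "\<bar>\<sigma>\<bar> = 1" "0 \<le> h" "h \<le> 1"
  shows "0 < 1 + \<sigma> * \<xi> * h" "1 + \<sigma> * \<xi> * h \<le> 2"
proof -
  have "\<bar>\<sigma> * \<xi> * h\<bar> \<le> \<bar>\<xi>\<bar> * 1"
    using assms by (simp add: abs_mult mult_left_le)
  then show "0 < 1 + \<sigma> * \<xi> * h" "1 + \<sigma> * \<xi> * h \<le> 2"
    using \<xi> by linarith+
qed

text \<open>This is the conformal factor of the Moebius map: the substitution keeps the profile a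
  power of 1 - h^2 up to explicit factors.\<close>

lemma d_shift:
  assumes "\<bar>\<sigma>\<bar> = 1" "0 < h" "h \<le> 1"
  shows "1 - (\<xi> + \<sigma> * d \<sigma> h)\<^sup>2 = a * (1 - h\<^sup>2) / (1 + \<sigma> * \<xi> * h)\<^sup>2"
proof -
  define q where "q = 1 + \<sigma> * \<xi> * h"
  have q: "q > 0" using denominator_pos[of \<sigma> h] assms by (simp add: q_def)
  have \<sigma>: "\<sigma> * \<sigma> = 1" using assms(1) by (metis abs_mult_self_eq mult_1)
  have "d \<sigma> h = a * h / q" by (simp add: d_def q_def)
  then have e: "\<xi> + \<sigma> * d \<sigma> h = (\<xi> * q + \<sigma> * (a * h)) / q"
    using q by (simp add: field_simps)
  have "q\<^sup>2 - (\<xi> * q + \<sigma> * (a * h))\<^sup>2 = a * (1 - h\<^sup>2)"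
    using \<sigma> unfolding q_def a_def by algebra
  then show ?thesis
    unfolding e q_def[symmetric] using q by (simp add: power_divide field_simps)
qed

lemma d_bounds:
  assumes "\<bar>\<sigma>\<bar> = 1" "0 < h" "h \<le> 1"
  shows "0 < d \<sigma> h" "d \<sigma> h < 2" "a * h / 2 \<le> d \<sigma> h"
proof -
  note q = denominator_pos[OF assms(1) less_imp_le[OF assms(2)] assms(3)]
  show "0 < d \<sigma> h" using q a_pos assms by (simp add: d_def)
  show "a * h / 2 \<le> d \<sigma> h"
    unfolding d_def using q a_pos assms by (intro divide_left_mono) auto
  have "0 \<le> 1 - (\<xi> + \<sigma> * d \<sigma> h)\<^sup>2"
    unfolding d_shift[OF assms] using q a_pos assms
    by (intro divide_nonneg_nonneg mult_nonneg_nonneg) (auto simp: power_le_one)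
  then have "\<bar>\<xi> + \<sigma> * d \<sigma> h\<bar> \<le> 1"
    using abs_square_le_1[of "\<xi> + \<sigma> * d \<sigma> h"] by linarith
  moreover have "\<bar>\<sigma> * d \<sigma> h\<bar> = d \<sigma> h"
    using \<open>0 < d \<sigma> h\<close> assms(1) by (simp add: abs_mult)
  ultimately show "d \<sigma> h < 2" using \<xi> by linarith
qed

lemma d_deriv:
  assumes "\<bar>\<sigma>\<bar> = 1" "0 < h" "h \<le> 1"
  shows "(d \<sigma> has_field_derivative a / (1 + \<sigma> * \<xi> * h)\<^sup>2) (at h)"
proof -
  have q: "0 < 1 + \<sigma> * \<xi> * h" using denominator_pos[of \<sigma> h] assms by simp
  show ?thesis
    unfolding d_def[abs_def] using q
    by (auto intro!: derivative_eq_intros simp: power2_eq_square field_simps)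
qed

lemma P_d_deriv:
  assumes "\<bar>\<sigma>\<bar> = 1" "0 < h" "h < 1"
  shows "((\<lambda>h. P \<sigma> (d \<sigma> h)) has_field_derivative
    - (a powr (- s) * (1 - h\<^sup>2) powr s * h powr (- 1 - 2 * s) / (1 + \<sigma> * \<xi> * h))) (at h)"
proof -
  have h: "h \<le> 1" using assms by simp
  have h2: "0 < 1 - h\<^sup>2" using assms by (simp add: power_less_one_iff abs_square_less_1)
  have q: "0 < 1 + \<sigma> * \<xi> * h" using denominator_pos[of \<sigma> h] assms by simp
  have "((\<lambda>h. P \<sigma> (d \<sigma> h)) has_field_derivative - k \<sigma> (d \<sigma> h) * (a / (1 + \<sigma> * \<xi> * h)\<^sup>2)) (at h)"
    using DERIV_chain[OF P_deriv d_deriv, of \<sigma> h \<sigma>] d_bounds[OF assms(1,2) h] assms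
    by (simp add: comp_def)
  moreover have "v (\<xi> + \<sigma> * d \<sigma> h) = (a * (1 - h\<^sup>2) / (1 + \<sigma> * \<xi> * h)\<^sup>2) powr s"
    unfolding v_def d_shift[OF assms(1,2) h] pos_pow_def using a_pos h2 q by simp
  ultimately show ?thesis
    using powr_mobius_identities(1)[OF a_pos(1) assms(2) q h2, of s]
    by (simp add: k_def d_def)
qed

lemma P_d_1: "\<bar>\<sigma>\<bar> = 1 \<Longrightarrow> P \<sigma> (d \<sigma> 1) = 0"
proof -
  assume \<sigma>: "\<bar>\<sigma>\<bar> = 1"
  have \<sigma>2: "\<sigma> * \<sigma> = 1" using \<sigma> by (metis abs_mult_self_eq mult_1)
  have q: "0 < 1 + \<sigma> * \<xi>" using denominator_pos[of \<sigma> 1] \<sigma> by simp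
  have "a = (1 - \<sigma> * \<xi>) * (1 + \<sigma> * \<xi>)"
    unfolding a_def using \<sigma>2 by algebra
  then have d1: "d \<sigma> 1 = 1 - \<sigma> * \<xi>"
    using q by (simp add: d_def)
  have "k \<sigma> t = 0" if "t \<in> {d \<sigma> 1..2}" for t
  proof -
    have "1 \<le> \<sigma> * \<xi> + t" using that d1 by auto
    then have "1 \<le> (\<sigma> * \<xi> + t)\<^sup>2" by (simp add: one_le_power)
    also have "(\<sigma> * \<xi> + t)\<^sup>2 = (\<xi> + \<sigma> * t)\<^sup>2" using \<sigma>2 by algebra
    finally show ?thesis by (simp add: k_def v_def pos_pow_def)
  qed
  then have "integral {d \<sigma> 1..2} (k \<sigma>) = integral {d \<sigma> 1..2} (\<lambda>_. 0)"
    by (intro integral_cong)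
  then show ?thesis by (simp add: P_def)
qed

section \<open>Comparison with an incomplete Beta integral\<close>

lemma has_integral_b: "((\<lambda>t. t powr (- s) * (1 - t) powr (s - 1)) has_integral Beta (1 - s) s) {0..1}"
  using has_integral_Beta_real[of "1 - s" s] s by (simp add: algebra_simps)

lemma b_1: "b 1 = Beta (1 - s) s"
  unfolding b_def using has_integral_b by (rule integral_unique)

lemma continuous_on_b: "continuous_on {0..1} b"
  unfolding b_def[abs_def] by (rule indefinite_integral_continuous_1) (use has_integral_b in auto)

lemma b_deriv:
  assumes "0 < \<tau>" "\<tau> < 1"
  shows "(b has_field_derivative \<tau> powr (- s) * (1 - \<tau>) powr (s - 1)) (at \<tau>)"
proof -
  have "isCont (\<lambda>t. t powr (- s) * (1 - t) powr (s - 1)) \<tau>"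
    using assms by (intro continuous_intros) auto
  then have "((\<lambda>u. integral {0..u} (\<lambda>t. t powr (- s) * (1 - t) powr (s - 1))) has_vector_derivative
      \<tau> powr (- s) * (1 - \<tau>) powr (s - 1)) (at \<tau> within ({0..1} - {}))"
    using assms has_integral_b
    by (intro integral_has_vector_derivative_continuous_at) (auto intro: continuous_at_imp_continuous_within)
  then show ?thesis
    using assms at_within_Icc_at[of 0 \<tau> 1]
    by (simp add: b_def[abs_def] has_real_derivative_iff_has_vector_derivative)
qed

lemma T_bounds:
  assumes "0 < h" "h \<le> 1"
  shows "0 < 1 - \<xi>\<^sup>2 * h\<^sup>2" "0 < T h" "T h \<le> 1" "1 - T h = (1 - h\<^sup>2) / (1 - \<xi>\<^sup>2 * h\<^sup>2)"
proof -
  have h2: "h\<^sup>2 \<le> 1" using assms by (simp add: power_le_one)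
  have "\<xi>\<^sup>2 * h\<^sup>2 \<le> \<xi>\<^sup>2 * 1" using h2 by (intro mult_left_mono) auto
  then show q: "0 < 1 - \<xi>\<^sup>2 * h\<^sup>2" using \<xi>_sq by linarith
  show "0 < T h" using q assms a_pos by (simp add: T_def)
  show e: "1 - T h = (1 - h\<^sup>2) / (1 - \<xi>\<^sup>2 * h\<^sup>2)"
    using q by (simp add: T_def a_def field_simps)
  have "0 \<le> 1 - T h" unfolding e using q h2 by simp
  then show "T h \<le> 1" by simp
qed

lemma T_deriv:
  assumes "0 < h" "h \<le> 1"
  shows "(T has_field_derivative 2 * a * h / (1 - \<xi>\<^sup>2 * h\<^sup>2)\<^sup>2) (at h)"
proof -
  have q: "1 - \<xi>\<^sup>2 * h\<^sup>2 \<noteq> 0" using T_bounds[OF assms] by simp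
  have "(T has_field_derivative (2 * a * h * (1 - \<xi>\<^sup>2 * h\<^sup>2) - a * h\<^sup>2 * (- (\<xi>\<^sup>2 * (2 * h))))
      / ((1 - \<xi>\<^sup>2 * h\<^sup>2) * (1 - \<xi>\<^sup>2 * h\<^sup>2))) (at h)"
    unfolding T_def[abs_def] using q
    by (intro DERIV_divide) (auto intro!: derivative_eq_intros)
  also have "2 * a * h * (1 - \<xi>\<^sup>2 * h\<^sup>2) - a * h\<^sup>2 * (- (\<xi>\<^sup>2 * (2 * h))) = 2 * a * h"
    by (simp add: algebra_simps power2_eq_square)
  finally show ?thesis by (simp add: power2_eq_square)
qed

text \<open>The integral of (1 - \<tau>)^s \<tau>^(-s - 1) over [T h, 1] after one integration by
  parts: the divergence as h tends to 0 sits in the first term, and a convergent incomplete Beta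
  integral remains.\<close>

definition \<Psi> :: "real \<Rightarrow> real" where
  "\<Psi> h = (1 - T h) powr s * T h powr (- s) / s - (Beta (1 - s) s - b (T h))"

lemma \<Psi>_deriv:
  assumes "0 < h" "h < 1"
  shows "(\<Psi> has_field_derivative
    - (2 * (a powr (- s) * (1 - h\<^sup>2) powr s * h powr (- 1 - 2 * s)) / (1 - \<xi>\<^sup>2 * h\<^sup>2))) (at h)"
proof -
  note Tb = T_bounds[OF assms(1) less_imp_le[OF assms(2)]]
  have h2: "0 < 1 - h\<^sup>2" using assms by (simp add: power_less_one_iff abs_square_less_1)
  define \<tau> where "\<tau> = T h"
  have \<tau>: "0 < \<tau>" "0 < 1 - \<tau>"
    unfolding \<tau>_def using Tb h2 by auto
  let ?g = "\<lambda>\<tau>. (1 - \<tau>) powr s * \<tau> powr (- s) / s - (Beta (1 - s) s - b \<tau>)"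
  have 1: "((\<lambda>\<tau>. (1 - \<tau>) powr s) has_field_derivative - (s * (1 - \<tau>) powr (s - 1))) (at \<tau>)"
    using \<tau> by (auto intro!: derivative_eq_intros)
  have 2: "((\<lambda>\<tau>. \<tau> powr (- s)) has_field_derivative - s * \<tau> powr (- s - 1)) (at \<tau>)"
    using \<tau> by (intro has_real_derivative_powr)
  have "(?g has_field_derivative (- (s * (1 - \<tau>) powr (s - 1)) * \<tau> powr (- s)
      + (- s * \<tau> powr (- s - 1)) * (1 - \<tau>) powr s) / s
      - (0 - \<tau> powr (- s) * (1 - \<tau>) powr (s - 1))) (at \<tau>)"
    using b_deriv \<tau> by (intro DERIV_diff DERIV_cdivide DERIV_mult 1 2 DERIV_const) auto
  also have "(- (s * (1 - \<tau>) powr (s - 1)) * \<tau> powr (- s)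
      + (- s * \<tau> powr (- s - 1)) * (1 - \<tau>) powr s) / s
      - (0 - \<tau> powr (- s) * (1 - \<tau>) powr (s - 1)) = - ((1 - \<tau>) powr s * \<tau> powr (- s - 1))"
    using s by (simp add: field_simps)
  finally have "((\<lambda>h. ?g (T h)) has_field_derivative
      - ((1 - \<tau>) powr s * \<tau> powr (- s - 1)) * (2 * a * h / (1 - \<xi>\<^sup>2 * h\<^sup>2)\<^sup>2)) (at h)"
    unfolding \<tau>_def using DERIV_chain2[of ?g _ T h, OF _ T_deriv[OF assms(1) less_imp_le[OF assms(2)]]]
    by blast
  also have "- ((1 - \<tau>) powr s * \<tau> powr (- s - 1)) * (2 * a * h / (1 - \<xi>\<^sup>2 * h\<^sup>2)\<^sup>2)
      = - (2 * (a powr (- s) * (1 - h\<^sup>2) powr s * h powr (- 1 - 2 * s)) / (1 - \<xi>\<^sup>2 * h\<^sup>2))"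
    using powr_mobius_identities(2)[OF a_pos(1) assms(1) Tb(1) h2, of s]
    unfolding \<tau>_def Tb(4) by (simp add: T_def)
  finally show ?thesis by (simp add: \<Psi>_def[abs_def])
qed

text \<open>The derivatives agree because 1 / (1 + \<xi> h) + 1 / (1 - \<xi> h) = 2 / (1 - \<xi>^2
  h^2), and both sides vanish at h = 1, where the Moebius map reaches the ends of the
  interval.\<close>

lemma P_d_eq_\<Psi>:
  assumes "0 < h" "h \<le> 1"
  shows "P 1 (d 1 h) + P (-1) (d (-1) h) = \<Psi> h"
proof (cases "h = 1")
  case h1: True
  have "T 1 = 1" using \<xi>_sq by (simp add: T_def a_def)
  then show ?thesis using h1 P_d_1[of 1] P_d_1[of "-1"] s by (simp add: \<Psi>_def b_1)
next
  case False
  let ?f = "\<lambda>h. P 1 (d 1 h) + P (-1) (d (-1) h) - \<Psi> h"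
  have "?f 1 = ?f h"
  proof (rule DERIV_isconst_end[where f="?f"])
    show "h < 1" using assms False by simp
    have "continuous_on {h..1} (\<lambda>h. P \<sigma> (d \<sigma> h))" if \<sigma>: "\<bar>\<sigma>\<bar> = 1" for \<sigma>
    proof (intro continuous_at_imp_continuous_on ballI)
      fix x assume "x \<in> {h..1}"
      then have x: "0 < x" "x \<le> 1" using assms by auto
      show "isCont (\<lambda>h. P \<sigma> (d \<sigma> h)) x"
        by (rule DERIV_isCont[OF DERIV_chain2[OF P_deriv d_deriv]]) (use d_bounds[OF \<sigma> x] \<sigma> x in auto)
    qed
    moreover have cT: "continuous_on {h..1} T"
      by (rule DERIV_continuous_on[OF has_field_derivative_at_within[OF T_deriv]]) (use assms in auto)
    moreover have "continuous_on {h..1} (\<lambda>h. b (T h))"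
    proof (rule continuous_on_compose2[OF continuous_on_b cT])
      show "T ` {h..1} \<subseteq> {0..1}"
        using T_bounds(2,3) assms by (force intro: less_imp_le)
    qed
    moreover have "continuous_on {h..1} (\<lambda>h. (1 - T h) powr s)"
      using T_bounds(3) assms s by (intro continuous_on_powr' continuous_intros cT) auto
    moreover have "continuous_on {h..1} (\<lambda>h. T h powr (- s))"
    proof (intro continuous_on_powr continuous_intros cT ballI)
      fix x assume "x \<in> {h..1}"
      then show "T x \<noteq> 0" using T_bounds(2)[of x] assms by auto
    qed
    ultimately show "continuous_on {h..1} ?f"
      unfolding \<Psi>_def[abs_def] using s
      by (intro continuous_on_add continuous_on_diff continuous_on_divide continuous_on_mult
          continuous_on_const) auto
    fix x assume x: "h < x" "x < 1"
    then have x0: "0 < x" using assms by simp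
    have q: "1 + \<xi> * x \<noteq> 0" "1 - \<xi> * x \<noteq> 0"
      using denominator_pos[of 1 x] denominator_pos[of "-1" x] x x0 by auto
    have "1 / (1 + \<xi> * x) + 1 / (1 - \<xi> * x) = 2 / (1 - \<xi>\<^sup>2 * x\<^sup>2)"
    proof -
      have "1 - \<xi>\<^sup>2 * x\<^sup>2 = (1 + \<xi> * x) * (1 - \<xi> * x)" by (simp add: algebra_simps power2_eq_square)
      then show ?thesis using q by (simp add: add_divide_eq_iff divide_add_eq_iff)
    qed
    note unit = this
    let ?c = "a powr (- s) * (1 - x\<^sup>2) powr s * x powr (- 1 - 2 * s)"
    have frac: "?c / (1 + \<xi> * x) + ?c / (1 - \<xi> * x) = 2 * ?c / (1 - \<xi>\<^sup>2 * x\<^sup>2)"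
      using arg_cong[OF unit, of "(*) ?c"]
      by (simp only: distrib_left times_divide_eq_right mult_1_right mult.commute[of 2])
    have "(?f has_field_derivative - (?c / (1 + 1 * \<xi> * x)) + - (?c / (1 + (-1) * \<xi> * x))
        - - (2 * ?c / (1 - \<xi>\<^sup>2 * x\<^sup>2))) (at x)"
      by (intro DERIV_diff DERIV_add P_d_deriv \<Psi>_deriv x0 x(2)) auto
    moreover have "- (?c / (1 + 1 * \<xi> * x)) + - (?c / (1 + (-1) * \<xi> * x))
        - - (2 * ?c / (1 - \<xi>\<^sup>2 * x\<^sup>2)) = 0"
      using frac by simp
    ultimately show "(?f has_field_derivative 0) (at x)" by (simp only:)
  qed
  moreover have "T 1 = 1" using \<xi>_sq by (simp add: T_def a_def)
  then have "?f 1 = 0" using P_d_1[of 1] P_d_1[of "-1"] s by (simp add: \<Psi>_def b_1)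
  ultimately show ?thesis by simp
qed

end

section \<open>From the asymmetric truncation to the principal value\<close>

context interval_profile
begin

lemma v_xi: "v \<xi> = a powr s"
  using a_pos by (simp add: v_def pos_pow_def a_def)

definition f :: "real \<Rightarrow> real" where
  "f t = (2 * v \<xi> - v (\<xi> + t) - v (\<xi> - t)) * t powr (- 1 - 2 * s)"

lemma f_measurable [measurable]: "f \<in> borel_measurable borel"
  unfolding f_def[abs_def] by measurable

lemma increments:
  obtains M L where "M \<ge> 0" "\<And>t. \<bar>2 * v \<xi> - v (\<xi> + t) - v (\<xi> - t)\<bar> \<le> M * min 1 (t\<^sup>2)"
    "L \<ge> 0" "\<And>t. \<bar>v (\<xi> + t) - v \<xi>\<bar> \<le> L * \<bar>t\<bar>"
proof -
  have \<xi>': "norm \<xi> < 1" using \<xi> by simp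
  note inc = profile_increments[OF s bounded_linear_ident \<xi>',
      unfolded real_norm_def power2_abs, folded v_def]
  from inc(1) obtain M where "M \<ge> 0" "\<forall>t. \<bar>2 * v \<xi> - v (\<xi> + t) - v (\<xi> - t)\<bar> \<le> M * min 1 (t\<^sup>2)"
    by (elim exE conjE)
  moreover from inc(2) obtain L where "L \<ge> 0" "\<forall>t. \<bar>v (\<xi> + t) - v \<xi>\<bar> \<le> L * \<bar>t\<bar>"
    by (elim exE conjE)
  ultimately show thesis by (intro that[of M L]) auto
qed

lemma set_integrable_f: "set_integrable lborel {0<..} f"
proof -
  obtain M where M: "M \<ge> 0" "\<And>t. \<bar>2 * v \<xi> - v (\<xi> + t) - v (\<xi> - t)\<bar> \<le> M * min 1 (t\<^sup>2)"
    by (rule increments) (rule that)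
  have "integrable lborel (\<lambda>t. M * (indicator {0<..} t * (min 1 ((1 * t)\<^sup>2) * t powr (- 1 - 2 * s))))"
    using has_bochner_integral_min_kernel[OF s, of 1] by (auto simp: has_bochner_integral_iff)
  then show ?thesis
    unfolding set_integrable_def
  proof (rule Bochner_Integration.integrable_bound)
    show "AE t in lborel. norm (indicator {0<..} t *\<^sub>R f t)
        \<le> norm (M * (indicator {0<..} t * (min 1 ((1 * t)\<^sup>2) * t powr (- 1 - 2 * s))))"
    proof (rule AE_I2)
      fix t :: real
      have "\<bar>f t\<bar> \<le> M * min 1 (t\<^sup>2) * t powr (- 1 - 2 * s)"
        unfolding f_def abs_mult using M(2)[of t] by (simp add: mult_right_mono)
      then show "norm (indicator {0<..} t *\<^sub>R f t)
        \<le> norm (M * (indicator {0<..} t * (min 1 ((1 * t)\<^sup>2) * t powr (- 1 - 2 * s))))"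
        using M(1) by (auto simp: indicator_def abs_mult)
    qed
  qed measurable
qed

lemma integral_f_truncated:
  assumes "0 < \<delta>" "\<delta> < 2"
  shows "(LINT t:{\<delta>..2}|lborel. f t) = E 1 \<delta> + E (-1) \<delta> - v \<xi> * 2 powr (- 2 * s) / s"
proof -
  have "set_integrable lborel {\<delta>..2} f"
    by (rule set_integrable_subset[OF set_integrable_f]) (use assms in auto)
  then have "(LINT t:{\<delta>..2}|lborel. f t) = integral {\<delta>..2} f"
    by (rule set_borel_integral_eq_integral)
  also have "integral {\<delta>..2} f = integral {\<delta>..2} (\<lambda>t. 2 * v \<xi> * t powr (- 1 - 2 * s) - k 1 t - k (-1) t)"
    by (rule arg_cong[where f="integral {\<delta>..2}"]) (auto simp: f_def k_def algebra_simps)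
  finally have "(LINT t:{\<delta>..2}|lborel. f t)
      = integral {\<delta>..2} (\<lambda>t. 2 * v \<xi> * t powr (- 1 - 2 * s) - k 1 t - k (-1) t)" .
  also have "((\<lambda>t. 2 * v \<xi> * t powr (- 1 - 2 * s) - k 1 t - k (-1) t) has_integral
      2 * v \<xi> * (- (2 powr (- 2 * s) / (2 * s)) - - (\<delta> powr (- 2 * s) / (2 * s))) - P 1 \<delta> - P (-1) \<delta>) {\<delta>..2}"
  proof (intro has_integral_diff has_integral_mult_right)
    show "((\<lambda>t. t powr (- 1 - 2 * s)) has_integral
        - (2 powr (- 2 * s) / (2 * s)) - - (\<delta> powr (- 2 * s) / (2 * s))) {\<delta>..2}"
    proof (rule fundamental_theorem_of_calculus)
      fix t assume t: "t \<in> {\<delta>..2}"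
      have "((\<lambda>t. - (t powr (- 2 * s) / (2 * s))) has_field_derivative
          - ((- 2 * s) * t powr (- 2 * s - 1) / (2 * s))) (at t)"
        using t assms by (intro DERIV_minus DERIV_cdivide has_real_derivative_powr) auto
      moreover have e: "t powr (- 2 * s - 1) = t powr (- 1 - 2 * s)"
        by (rule arg_cong[where f="(powr) t"]) simp
      have "- ((- 2 * s) * t powr (- 2 * s - 1) / (2 * s)) = t powr (- 1 - 2 * s)"
        unfolding e using s by simp
      ultimately show "((\<lambda>t. - (t powr (- 2 * s) / (2 * s))) has_vector_derivative t powr (- 1 - 2 * s))
          (at t within {\<delta>..2})"
        by (simp add: has_real_derivative_iff_has_vector_derivative has_vector_derivative_at_within)
    qed (use assms in auto)
    have "(k \<sigma> has_integral P \<sigma> \<delta>) {\<delta>..2}" for \<sigma>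
      unfolding P_def
      by (rule integrable_integral[OF integrable_continuous_interval[OF continuous_k[OF assms(1)]]])
    then show "(k 1 has_integral P 1 \<delta>) {\<delta>..2}" "(k (-1) has_integral P (-1) \<delta>) {\<delta>..2}" by auto
  qed
  then have "integral {\<delta>..2} (\<lambda>t. 2 * v \<xi> * t powr (- 1 - 2 * s) - k 1 t - k (-1) t)
      = 2 * v \<xi> * (- (2 powr (- 2 * s) / (2 * s)) - - (\<delta> powr (- 2 * s) / (2 * s))) - P 1 \<delta> - P (-1) \<delta>"
    by (rule integral_unique)
  also have "\<dots> = E 1 \<delta> + E (-1) \<delta> - v \<xi> * 2 powr (- 2 * s) / s"
    using s by (simp add: E_def field_simps)
  finally show ?thesis .
qed

lemma integral_f_tail: "(LINT t:{2<..}|lborel. f t) = v \<xi> * 2 powr (- 2 * s) / s"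
proof -
  have "set_integrable lborel {2<..} f"
    by (rule set_integrable_subset[OF set_integrable_f]) auto
  then have "(LINT t:{2<..}|lborel. f t) = integral {2<..} f"
    by (rule set_borel_integral_eq_integral)
  also have "\<dots> = integral {2..} f"
    by (rule integral_spike_set) (auto intro: negligible_subset[of "{2}"])
  also have "(f has_integral 2 * v \<xi> * (- (2 powr (- 1 - 2 * s + 1)) / (- 1 - 2 * s + 1))) {2..}"
  proof (rule has_integral_eq)
    show "((\<lambda>t. 2 * v \<xi> * t powr (- 1 - 2 * s)) has_integral
        2 * v \<xi> * (- (2 powr (- 1 - 2 * s + 1)) / (- 1 - 2 * s + 1))) {2..}"
      using s by (intro has_integral_mult_right has_integral_powr_to_inf) auto
    fix t :: real assume t: "t \<in> {2..}"
    have "v y = 0" if "1 \<le> \<bar>y\<bar>" for y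
      using that one_le_power[of "\<bar>y\<bar>" 2] by (simp add: v_def pos_pow_def)
    moreover have "1 \<le> \<bar>\<xi> + t\<bar>" "1 \<le> \<bar>\<xi> - t\<bar>" using t \<xi> by auto
    ultimately have "v (\<xi> + t) = 0" "v (\<xi> - t) = 0" by blast+
    then show "2 * v \<xi> * t powr (- 1 - 2 * s) = f t" by (simp add: f_def)
  qed
  then have "integral {2..} f = 2 * v \<xi> * (- (2 powr (- 1 - 2 * s + 1)) / (- 1 - 2 * s + 1))"
    by (rule integral_unique)
  also have "\<dots> = v \<xi> * 2 powr (- 2 * s) / s" using s by simp
  finally show ?thesis .
qed

lemma E_tendsto: "((\<lambda>\<delta>. E 1 \<delta> + E (-1) \<delta>) \<longlongrightarrow> (LINT t:{0<..}|lborel. f t)) (at_right 0)"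
proof -
  let ?c = "v \<xi> * 2 powr (- 2 * s) / s"
  have i1: "set_integrable lborel {0<..2} f"
    by (rule set_integrable_subset[OF set_integrable_f]) auto
  have i2: "set_integrable lborel {2<..} f"
    by (rule set_integrable_subset[OF set_integrable_f]) auto
  have disj: "{0 :: real<..2} \<inter> {2<..} = {}" by auto
  have un: "{0 :: real<..} = {0<..2} \<union> {2<..}" by auto
  have eq: "(LINT t:{0<..}|lborel. f t) = (LINT t:{0<..2}|lborel. f t) + ?c"
    unfolding un set_integral_Un[OF disj i1 i2] integral_f_tail ..
  have "((\<lambda>\<delta>. (LINT t:{\<delta>..2}|lborel. f t) + ?c) \<longlongrightarrow> (LINT t:{0<..2}|lborel. f t) + ?c) (at_right 0)"
    by (intro tendsto_add tendsto_const tendsto_set_lebesgue_integral_at_right i1) auto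
  moreover have "\<forall>\<^sub>F \<delta> in at_right 0. \<delta> \<in> {0<..<2::real}"
    by (rule eventually_at_right_real) simp
  then have "\<forall>\<^sub>F \<delta> in at_right 0. (LINT t:{\<delta>..2}|lborel. f t) + ?c = E 1 \<delta> + E (-1) \<delta>"
    by (rule eventually_mono) (simp add: integral_f_truncated)
  ultimately show ?thesis
    unfolding eq by (rule Lim_transform_eventually)
qed

text \<open>All powers h^(-2 s) are collected in front of one bracket. The bracket is of second
  order in h, so this term is O(h^(2 - 2 s)) and only the Beta value survives in the limit.\<close>

lemma E_d_eq:
  assumes "0 < h" "h < 1"
  shows "E 1 (d 1 h) + E (-1) (d (-1) h) = a powr (- s) * h powr (- 2 * s) / s *
    (((1 + \<xi> * h) powr (2 * s) + (1 - \<xi> * h) powr (2 * s)) / 2 - (1 - h\<^sup>2) powr s)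
    + Beta (1 - s) s - b (T h)"
proof -
  have h2: "0 < 1 - h\<^sup>2" using assms by (simp add: power_less_one_iff abs_square_less_1)
  have q: "0 < 1 + \<xi> * h" "0 < 1 - \<xi> * h"
    using denominator_pos[of 1 h] denominator_pos[of "-1" h] assms by auto
  note Tb = T_bounds[OF assms(1) less_imp_le[OF assms(2)]]
  have "v \<xi> * d 1 h powr (- 2 * s) = a powr (- s) * h powr (- 2 * s) * (1 + \<xi> * h) powr (2 * s)"
    "v \<xi> * d (-1) h powr (- 2 * s) = a powr (- s) * h powr (- 2 * s) * (1 - \<xi> * h) powr (2 * s)"
    using powr_mobius_identities(4)[OF a_pos(1) assms(1) q(1) h2, of s]
      powr_mobius_identities(4)[OF a_pos(1) assms(1) q(2) h2, of s]
    by (simp_all add: v_xi d_def)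
  moreover have "(1 - T h) powr s * T h powr (- s) = a powr (- s) * h powr (- 2 * s) * (1 - h\<^sup>2) powr s"
    unfolding Tb(4) unfolding T_def using powr_mobius_identities(3)[OF a_pos(1) assms(1) Tb(1) h2] .
  moreover have "E 1 (d 1 h) + E (-1) (d (-1) h)
      = (v \<xi> * d 1 h powr (- 2 * s) + v \<xi> * d (-1) h powr (- 2 * s)) / (2 * s) - \<Psi> h"
    unfolding P_d_eq_\<Psi>[OF assms(1) less_imp_le[OF assms(2)], symmetric] E_def
    by (simp add: add_divide_distrib)
  moreover have "(A * x + A * y) / (2 * s) - (A * w / s - (\<beta> - c)) = A / s * ((x + y) / 2 - w) + \<beta> - c"
    for A x y w \<beta> c :: real
    using s by (simp add: field_simps)
  ultimately show ?thesis
    unfolding \<Psi>_def by (simp only:)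
qed

text \<open>The terms linear in h cancel between the two signs. As 2 s may exceed 1, each power is
  expanded as the s-th power of a square; that square differs from 1 by at most 3 h, which gives 2 *
  9 = 18. The remaining quadratic terms contribute at most 1 + 3.\<close>

lemma bracket_bound:
  assumes "0 < h" "h < 1"
  shows "\<bar>((1 + \<xi> * h) powr (2 * s) + (1 - \<xi> * h) powr (2 * s)) / 2 - (1 - h\<^sup>2) powr s\<bar> \<le> 22 * h\<^sup>2"
proof -
  have q: "0 < 1 + \<sigma> * \<xi> * h" if "\<bar>\<sigma>\<bar> = 1" for \<sigma>
    using denominator_pos[of \<sigma> h] that assms by auto
  have xh: "\<bar>\<xi> * h\<bar> \<le> h" "(\<xi> * h)\<^sup>2 \<le> h\<^sup>2"
    using \<xi> assms by (auto simp: abs_mult mult_left_le_one_le power_mult_distrib intro!: mult_left_le_one_le less_imp_le[OF \<xi>_sq])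
  have h2: "h\<^sup>2 \<le> h" "h\<^sup>2 \<le> 1" "0 < 1 - h\<^sup>2"
    using assms by (auto simp: power2_eq_square mult_left_le_one_le mult_le_one intro: mult_strict_mono[of h 1 h 1, simplified])
  have sq: "\<bar>(1 + \<sigma> * \<xi> * h) powr (2 * s) - (1 + s * (2 * \<sigma> * (\<xi> * h) + (\<xi> * h)\<^sup>2))\<bar> \<le> 18 * h\<^sup>2"
    if \<sigma>: "\<bar>\<sigma>\<bar> = 1" for \<sigma>
  proof -
    have \<sigma>2: "\<sigma>\<^sup>2 = 1" using \<sigma> by (metis power2_abs power_one)
    define y where "y = 2 * \<sigma> * (\<xi> * h) + (\<xi> * h)\<^sup>2"
    have y: "(1 + \<sigma> * \<xi> * h)\<^sup>2 = 1 + y"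
      using \<sigma>2 by (simp add: y_def power2_eq_square algebra_simps)
    have "(1 + \<sigma> * \<xi> * h) powr (2 * s) = ((1 + \<sigma> * \<xi> * h) powr 2) powr s"
      by (simp add: powr_powr)
    also have "\<dots> = pos_pow s (1 + y)"
      using q[OF \<sigma>] by (simp add: pos_pow_def flip: y)
    finally have "\<bar>(1 + \<sigma> * \<xi> * h) powr (2 * s) - (1 + s * y)\<bar> \<le> 2 * y\<^sup>2"
      using pos_pow_taylor[OF s, of y] by simp
    moreover have "\<bar>2 * \<sigma> * (\<xi> * h)\<bar> \<le> 2 * h"
      using xh(1) \<sigma> by (simp add: abs_mult)
    then have "\<bar>y\<bar> \<le> 3 * h"
      using xh(2) h2(1) zero_le_power2[of "\<xi> * h"] unfolding y_def by linarith
    then have "y\<^sup>2 \<le> 9 * h\<^sup>2"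
      using power_mono[of "\<bar>y\<bar>" "3 * h" 2] by (simp add: power_mult_distrib)
    ultimately show ?thesis by (simp add: y_def)
  qed
  have "\<bar>(1 - h\<^sup>2) powr s - (1 - s * h\<^sup>2)\<bar> \<le> 2 * (- h\<^sup>2)\<^sup>2"
    using pos_pow_taylor[OF s, of "- h\<^sup>2"] h2 by (simp add: pos_pow_def)
  moreover have "(- h\<^sup>2)\<^sup>2 \<le> h\<^sup>2"
    using mult_left_le[of "h\<^sup>2" "h\<^sup>2"] h2 by (simp add: power2_eq_square)
  moreover have "s * (\<xi> * h)\<^sup>2 \<le> 1 * h\<^sup>2" "0 \<le> s * (\<xi> * h)\<^sup>2" "s * h\<^sup>2 \<le> 1 * h\<^sup>2" "0 \<le> s * h\<^sup>2"
    using s xh(2) mult_mono[of s 1 "(\<xi> * h)\<^sup>2" "h\<^sup>2"] mult_right_mono[of s 1 "h\<^sup>2"] by auto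
  moreover have "s * (2 * 1 * (\<xi> * h) + (\<xi> * h)\<^sup>2) + s * (2 * (-1) * (\<xi> * h) + (\<xi> * h)\<^sup>2) = 2 * (s * (\<xi> * h)\<^sup>2)"
    by (simp add: algebra_simps)
  moreover have gen: "\<bar>(p + m) / 2 - c\<bar> \<le> 22 * H"
    if "\<bar>p - (1 + x)\<bar> \<le> 18 * H" "\<bar>m - (1 + y)\<bar> \<le> 18 * H" "x + y = 2 * w" "w \<le> 1 * H" "0 \<le> w"
      "\<bar>c - (1 - t)\<bar> \<le> 2 * g" "g \<le> H" "t \<le> 1 * H" "0 \<le> t" for p m c x y w g t H :: real
  proof -
    have "p + m \<le> 2 + 2 * w + 36 * H" "2 + 2 * w - 36 * H \<le> p + m"
      using that(1-3) by linarith+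
    then have "(p + m) / 2 \<le> 1 + w + 18 * H" "1 + w - 18 * H \<le> (p + m) / 2"
      by auto
    moreover have "1 - 3 * H \<le> c" "c \<le> 1 + 2 * H" "0 \<le> H"
      using that(4-9) by linarith+
    ultimately show ?thesis using that(4,5) by linarith
  qed
  moreover have "\<bar>(1 + \<xi> * h) powr (2 * s) - (1 + s * (2 * 1 * (\<xi> * h) + (\<xi> * h)\<^sup>2))\<bar> \<le> 18 * h\<^sup>2"
    "\<bar>(1 - \<xi> * h) powr (2 * s) - (1 + s * (2 * (-1) * (\<xi> * h) + (\<xi> * h)\<^sup>2))\<bar> \<le> 18 * h\<^sup>2"
    using sq[of 1] sq[of "-1"] by simp_all
  ultimately show ?thesis
    by (intro gen)
qed

lemma d_difference:
  assumes "0 < h" "h < 1"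
  shows "\<bar>d (-1) h - d 1 h\<bar> \<le> 2 * h\<^sup>2"
proof -
  have q: "0 < 1 + \<xi> * h" "0 < 1 - \<xi> * h"
    using denominator_pos[of 1 h] denominator_pos[of "-1" h] assms by auto
  have D: "(1 - \<xi> * h) * (1 + \<xi> * h) = 1 - \<xi>\<^sup>2 * h\<^sup>2"
    by (simp add: algebra_simps power2_eq_square)
  have "\<xi>\<^sup>2 * h\<^sup>2 \<le> \<xi>\<^sup>2 * 1" using assms by (intro mult_left_mono) (auto simp: power_le_one)
  then have aD: "a \<le> 1 - \<xi>\<^sup>2 * h\<^sup>2" by (simp add: a_def)
  have "d (-1) h - d 1 h = a * h / (1 - \<xi> * h) - a * h / (1 + \<xi> * h)"
    by (simp add: d_def)
  also have "\<dots> = (a * h * (1 + \<xi> * h) - a * h * (1 - \<xi> * h)) / ((1 - \<xi> * h) * (1 + \<xi> * h))"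
    using q by (intro diff_frac_eq) auto
  also have "\<dots> = a * (2 * \<xi> * h\<^sup>2) / (1 - \<xi>\<^sup>2 * h\<^sup>2)"
    unfolding D by (simp add: algebra_simps power2_eq_square)
  finally have "\<bar>d (-1) h - d 1 h\<bar> = a * \<bar>2 * \<xi> * h\<^sup>2\<bar> / (1 - \<xi>\<^sup>2 * h\<^sup>2)"
    using aD a_pos by (simp add: abs_mult)
  also have "\<dots> \<le> (1 - \<xi>\<^sup>2 * h\<^sup>2) * \<bar>2 * \<xi> * h\<^sup>2\<bar> / (1 - \<xi>\<^sup>2 * h\<^sup>2)"
    using aD a_pos by (intro divide_right_mono mult_right_mono) auto
  also have "\<dots> = \<bar>2 * \<xi> * h\<^sup>2\<bar>" using aD a_pos by simp
  also have "\<dots> \<le> 2 * h\<^sup>2"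
    using \<xi> by (simp add: abs_mult mult_left_le_one_le)
  finally show ?thesis .
qed

text \<open>The two truncation points differ by at most 2 h^2, and on the interval between them the
  Lipschitz bound for v leaves an integrand of order h^(-2 s).\<close>

lemma E_difference:
  obtains C where "\<And>h. 0 < h \<Longrightarrow> h < 1 \<Longrightarrow> \<bar>E 1 (d (-1) h) - E 1 (d 1 h)\<bar> \<le> C * h powr (2 - 2 * s)"
proof -
  obtain L where L: "L \<ge> 0" "\<And>t. \<bar>v (\<xi> + t) - v \<xi>\<bar> \<le> L * \<bar>t\<bar>"
    by (rule increments) (rule that)
  have "\<bar>E 1 (d (-1) h) - E 1 (d 1 h)\<bar> \<le> (2 * L * (a / 2) powr (- 2 * s)) * h powr (2 - 2 * s)"
    if h: "0 < h" "h < 1" for h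
  proof -
    have ah: "0 < a * h / 2" using a_pos h by simp
    let ?E' = "\<lambda>t. - ((v \<xi> - v (\<xi> + 1 * t)) * t powr (- 1 - 2 * s))"
    have "norm (E 1 (d (-1) h) - E 1 (d 1 h)) \<le> (L * (a * h / 2) powr (- 2 * s)) * norm (d (-1) h - d 1 h)"
    proof (rule field_differentiable_bound[where S="{a * h / 2..<2}" and f'="?E'"])
      show "convex {a * h / 2..<2}" by simp
      show "d (-1) h \<in> {a * h / 2..<2}" "d 1 h \<in> {a * h / 2..<2}"
        using d_bounds[of "-1" h] d_bounds[of 1 h] h by auto
      fix t assume "t \<in> {a * h / 2..<2}"
      then have t: "0 < t" "t < 2" "a * h / 2 \<le> t" using ah by auto
      show "(E 1 has_field_derivative ?E' t) (at t within {a * h / 2..<2})"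
        using E_deriv[OF t(1,2)] by (rule has_field_derivative_at_within)
      have "norm (?E' t) \<le> L * t * t powr (- 1 - 2 * s)"
        using L(2)[of t] t by (simp add: abs_mult abs_minus_commute mult_right_mono)
      also have "t * t powr (- 1 - 2 * s) = t powr (- 2 * s)"
        using t powr_add[of t 1 "- 1 - 2 * s"] by simp
      then have "L * t * t powr (- 1 - 2 * s) = L * t powr (- 2 * s)"
        by (simp add: mult.assoc)
      also have "\<dots> \<le> L * (a * h / 2) powr (- 2 * s)"
        using L(1) t ah s by (intro mult_left_mono powr_mono2') auto
      finally show "norm (?E' t) \<le> L * (a * h / 2) powr (- 2 * s)" .
    qed
    also have "\<dots> \<le> (L * (a * h / 2) powr (- 2 * s)) * (2 * h\<^sup>2)"
      using d_difference[OF h] L(1) by (intro mult_left_mono) auto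
    also have "(a * h / 2) powr (- 2 * s) = (a / 2) powr (- 2 * s) * h powr (- 2 * s)"
      using powr_mult[of "a / 2" h "- 2 * s"] a_pos h by simp
    also have "L * ((a / 2) powr (- 2 * s) * h powr (- 2 * s)) * (2 * h\<^sup>2)
        = (2 * L * (a / 2) powr (- 2 * s)) * (h powr (- 2 * s) * h powr 2)"
      using h by simp
    also have "h powr (- 2 * s) * h powr 2 = h powr (2 - 2 * s)"
      by (simp add: powr_add[symmetric])
    finally show ?thesis by simp
  qed
  then show thesis by (rule that)
qed

lemma E_d_tendsto: "((\<lambda>h. E 1 (d (-1) h) + E (-1) (d (-1) h)) \<longlongrightarrow> Beta (1 - s) s) (at_right 0)"
proof -
  obtain C where C: "\<And>h. 0 < h \<Longrightarrow> h < 1 \<Longrightarrow> \<bar>E 1 (d (-1) h) - E 1 (d 1 h)\<bar> \<le> C * h powr (2 - 2 * s)"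
    using E_difference by blast
  define C' where "C' = C + 22 * a powr (- s) / s"
  have bound: "\<bar>E 1 (d (-1) h) + E (-1) (d (-1) h) - (Beta (1 - s) s - b (T h))\<bar> \<le> C' * h powr (2 - 2 * s)"
    if h: "0 < h" "h < 1" for h
  proof -
    let ?B = "((1 + \<xi> * h) powr (2 * s) + (1 - \<xi> * h) powr (2 * s)) / 2 - (1 - h\<^sup>2) powr s"
    have "\<bar>a powr (- s) * h powr (- 2 * s) / s * ?B\<bar> = a powr (- s) * h powr (- 2 * s) / s * \<bar>?B\<bar>"
      using s by (simp add: abs_mult)
    also have "\<dots> \<le> a powr (- s) * h powr (- 2 * s) / s * (22 * h\<^sup>2)"
      using bracket_bound[OF h] s by (intro mult_left_mono) auto
    also have "\<dots> = 22 * a powr (- s) / s * (h powr (- 2 * s) * h powr 2)"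
      using h by simp
    also have "h powr (- 2 * s) * h powr 2 = h powr (2 - 2 * s)"
      by (simp add: powr_add[symmetric])
    finally have "\<bar>a powr (- s) * h powr (- 2 * s) / s * ?B\<bar> \<le> 22 * a powr (- s) / s * h powr (2 - 2 * s)" .
    note X = this
    have gen: "\<bar>e1 + e3 - (\<beta> - c)\<bar> \<le> y + x"
      if "\<bar>X\<bar> \<le> x" "\<bar>e1 - e2\<bar> \<le> y" "e2 + e3 = X + \<beta> - c" for e1 e2 e3 X x y \<beta> c :: real
      using that by linarith
    show ?thesis
      unfolding C'_def distrib_right by (rule gen[OF X C[OF h] E_d_eq[OF h]])
  qed
  have T0: "(T \<longlongrightarrow> 0) (at_right 0)"
    unfolding T_def[abs_def] by (auto intro!: tendsto_eq_intros)
  have ev: "\<forall>\<^sub>F h in at_right 0. 0 < h \<and> h < (1::real)"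
    using eventually_at_right_real[of 0 1] by (auto elim: eventually_mono)
  have "((\<lambda>h. b (T h)) \<longlongrightarrow> b 0) (at_right 0)"
  proof (rule continuous_on_tendsto_compose[OF continuous_on_b T0])
    show "\<forall>\<^sub>F h in at_right 0. T h \<in> {0..1}"
      using ev by eventually_elim (use T_bounds(2,3) in \<open>auto intro: less_imp_le\<close>)
  qed simp
  then have bT: "((\<lambda>h. Beta (1 - s) s - b (T h)) \<longlongrightarrow> Beta (1 - s) s - 0) (at_right 0)"
    by (intro tendsto_diff tendsto_const) (simp add: b_def)
  have "((\<lambda>h. h powr (2 - 2 * s)) \<longlongrightarrow> 0) (at_right 0)"
    using s ev by (intro tendsto_zero_powrI[of _ _ _ "2 - 2 * s"]) (auto intro!: tendsto_eq_intros elim!: eventually_mono)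
  then have "((\<lambda>h. C' * h powr (2 - 2 * s)) \<longlongrightarrow> 0) (at_right 0)"
    by (rule tendsto_mult_right_zero)
  then have "((\<lambda>h. E 1 (d (-1) h) + E (-1) (d (-1) h) - (Beta (1 - s) s - b (T h))) \<longlongrightarrow> 0) (at_right 0)"
    by (rule Lim_null_comparison[rotated]) (use ev in eventually_elim, use bound in auto)
  from tendsto_add[OF this bT] show ?thesis by simp
qed

text \<open>The value does not depend on \<xi>, which is what makes the fractional Laplacian of the
  profile constant. It is read off along the truncations \<open>d (-1) h\<close>, which tend to 0
  with h.\<close>

lemma integral_f: "(LINT t:{0<..}|lborel. f t) = Beta (1 - s) s"
proof -
  have "filterlim (d (-1)) (at_right 0) (at_right 0)"
    unfolding filterlim_at
  proof
    show "\<forall>\<^sub>F h in at_right 0. d (-1) h \<in> {0<..} \<and> d (-1) h \<noteq> 0"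
      using eventually_at_right_real[of 0 1] by (rule eventually_mono) (use d_bounds[of "-1"] in \<open>auto simp: less_imp_neq[symmetric]\<close>)
    show "(d (-1) \<longlongrightarrow> 0) (at_right 0)"
      unfolding d_def[abs_def] by (auto intro!: tendsto_eq_intros)
  qed
  from filterlim_compose[OF E_tendsto this] E_d_tendsto show ?thesis
    by (intro tendsto_unique[of "at_right (0::real)"]) auto
qed

lemma has_bochner_integral_f:
  "has_bochner_integral lborel (\<lambda>t. indicator {0<..} t * f t) (Beta (1 - s) s)"
  using set_integrable_f integral_f
  by (simp add: has_bochner_integral_iff set_integrable_def set_lebesgue_integral_def)

end

section \<open>The fractional Laplacian of the profile\<close>

lemma nn_integral_lborel_scale:
  fixes g :: "'a::euclidean_space \<Rightarrow> ennreal"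
  assumes [measurable]: "g \<in> borel_measurable borel" and "c \<noteq> 0"
  shows "(\<integral>\<^sup>+z. g z \<partial>lborel) = ennreal (\<bar>c\<bar> ^ DIM('a)) * (\<integral>\<^sup>+z. g (t + c *\<^sub>R z) \<partial>lborel)"
  by (subst lborel_affine[OF assms(2), of t])
    (simp add: nn_integral_density nn_integral_distr nn_integral_cmult)

lemma has_bochner_integral_lborel_affine:
  fixes g :: "'a::euclidean_space \<Rightarrow> real"
  assumes g: "has_bochner_integral lborel g I" and "\<bar>c\<bar> = 1"
  shows "has_bochner_integral lborel (\<lambda>z. g (t + c *\<^sub>R z)) I"
proof -
  have [measurable]: "g \<in> borel_measurable borel"
    using g by (auto simp: has_bochner_integral_iff)
  have "c \<noteq> 0" using assms(2) by auto
  then have "has_bochner_integral (density (distr lborel borel (\<lambda>z. t + c *\<^sub>R z)) (\<lambda>_. ennreal (\<bar>c\<bar> ^ DIM('a)))) g I"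
    using g by (subst lborel_affine[symmetric]) auto
  then have "has_bochner_integral (distr lborel borel (\<lambda>z. t + c *\<^sub>R z)) g I"
    using assms(2) by (simp add: density_1)
  then show ?thesis
    by (simp add: has_bochner_integral_iff integrable_distr_eq integral_distr)
qed

text \<open>
  Integration in polar coordinates without the surface measure: average the radial scaling over
  the ball, using \<open>1 = n \<bar>z\<bar>\<^sup>n \<integral> t\<^bsup>- n - 1\<^esup> dt\<close> over \<open>t > \<bar>z\<bar>\<close>, and exchange the integrals.
\<close>

lemma nn_integral_radial:
  fixes G H :: "'a::euclidean_space \<Rightarrow> real"
  assumes [measurable]: "G \<in> borel_measurable borel" and nonneg: "\<And>z. 0 \<le> G z"
    and H: "\<And>w. w \<noteq> 0 \<Longrightarrow>
      (\<integral>\<^sup>+t. ennreal (indicator {0<..} t * (G (t *\<^sub>R w) * t powr (- 1 - p))) \<partial>lborel) = ennreal (H w)"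
  shows "(\<integral>\<^sup>+z. ennreal (G z * norm z powr (- real DIM('a) - p)) \<partial>lborel)
    = (\<integral>\<^sup>+w. indicator (ball 0 1) w * ennreal (real DIM('a) * norm w powr (- p) * H w) \<partial>lborel)"
proof -
  define n where "n = real DIM('a)"
  have n: "0 < n" by (simp add: n_def)
  have n1: "t ^ DIM('a) = t powr n" if "0 < t" for t :: real
    using that by (simp add: n_def powr_realpow)
  have nz: "AE z in lborel. (z::'a) \<noteq> 0"
    by (rule AE_lborel_singleton)
  define K where "K = (\<lambda>(w::'a) t. (if 0 < t \<and> norm w < 1 then n * norm w powr (- p) * (G (t *\<^sub>R w) * t powr (- 1 - p)) else 0))"
  define K' where "K' = (\<lambda>(z::'a) t. (if norm z < t then n * norm z powr (- p) * G z * t powr (- 1 - n) else 0))"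
  have [measurable]: "(\<lambda>(w, t). K w t) \<in> borel_measurable (lborel \<Otimes>\<^sub>M lborel)"
    unfolding K_def by measurable
  have [measurable]: "(\<lambda>(w, t). K' w t) \<in> borel_measurable (lborel \<Otimes>\<^sub>M lborel)"
    unfolding K'_def by measurable
  have Kw[measurable]: "(\<lambda>z. K' z t) \<in> borel_measurable borel" for t
    unfolding K'_def by measurable
  have "(\<integral>\<^sup>+w. indicator (ball 0 1) w * ennreal (n * norm w powr (- p) * H w) \<partial>lborel)
      = (\<integral>\<^sup>+w. (\<integral>\<^sup>+t. ennreal (K w t) \<partial>lborel) \<partial>lborel)"
  proof (rule nn_integral_cong_AE, use nz in eventually_elim)
    fix w :: 'a assume w: "w \<noteq> 0"
    have "ennreal (K w t) = indicator (ball 0 1) w * ennreal (n * norm w powr (- p)) *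
        ennreal (indicator {0<..} t * (G (t *\<^sub>R w) * t powr (- 1 - p)))" for t
      using n nonneg by (auto simp: K_def indicator_def simp flip: ennreal_mult)
    then have "(\<integral>\<^sup>+t. ennreal (K w t) \<partial>lborel) = indicator (ball 0 1) w * ennreal (n * norm w powr (- p)) * ennreal (H w)"
      using H[OF w] by (simp add: nn_integral_cmult)
    then show "indicator (ball 0 1) w * ennreal (n * norm w powr (- p) * H w) = (\<integral>\<^sup>+t. ennreal (K w t) \<partial>lborel)"
      using n by (simp add: ennreal_mult' mult.assoc)
  qed
  also have "\<dots> = (\<integral>\<^sup>+t. (\<integral>\<^sup>+w. ennreal (K w t) \<partial>lborel) \<partial>lborel)"
    by (rule lborel_pair.Fubini'[symmetric]) measurable
  also have "\<dots> = (\<integral>\<^sup>+t. (\<integral>\<^sup>+z. ennreal (K' z t) \<partial>lborel) \<partial>lborel)"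
  proof (rule nn_integral_cong)
    fix t :: real
    show "(\<integral>\<^sup>+w. ennreal (K w t) \<partial>lborel) = (\<integral>\<^sup>+z. ennreal (K' z t) \<partial>lborel)"
    proof (cases "0 < t")
      case False
      then have "\<not> norm z < t" for z :: 'a using norm_ge_zero[of z] by linarith
      then show ?thesis using False by (simp add: K_def K'_def)
    next
      case True
      have "(\<integral>\<^sup>+z. ennreal (K' z t) \<partial>lborel) = ennreal (t ^ DIM('a)) * (\<integral>\<^sup>+z. ennreal (K' (0 + t *\<^sub>R z) t) \<partial>lborel)"
        using nn_integral_lborel_scale[of "\<lambda>z. ennreal (K' z t)" t 0] True by simp
      also have "\<dots> = (\<integral>\<^sup>+z. ennreal (t ^ DIM('a)) * ennreal (K' (0 + t *\<^sub>R z) t) \<partial>lborel)"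
        by (rule nn_integral_cmult[symmetric]) measurable
      also have "\<dots> = (\<integral>\<^sup>+z. ennreal (K z t) \<partial>lborel)"
      proof (rule nn_integral_cong)
        fix z :: 'a
        have "t powr n * (t powr (- p) * t powr (- 1 - n)) = t powr (- 1 - p)"
          by (simp add: powr_add[symmetric])
        then have "t powr n * (n * (t * norm z) powr (- p) * G (t *\<^sub>R z) * t powr (- 1 - n))
            = n * norm z powr (- p) * (G (t *\<^sub>R z) * t powr (- 1 - p))"
          using True by (simp add: powr_mult mult_ac)
        then show "ennreal (t ^ DIM('a)) * ennreal (K' (0 + t *\<^sub>R z) t) = ennreal (K z t)"
          using True n nonneg by (simp add: n1 K_def K'_def flip: ennreal_mult)
      qed
      finally show ?thesis by simp
    qed
  qed
  also have "\<dots> = (\<integral>\<^sup>+z. (\<integral>\<^sup>+t. ennreal (K' z t) \<partial>lborel) \<partial>lborel)"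
    by (rule lborel_pair.Fubini') measurable
  also have "\<dots> = (\<integral>\<^sup>+z. ennreal (G z * norm z powr (- n - p)) \<partial>lborel)"
  proof (rule nn_integral_cong_AE, use nz in eventually_elim)
    fix z :: 'a assume z: "z \<noteq> 0"
    have "((\<lambda>t. t powr (- 1 - n)) has_integral - (norm z powr (- 1 - n + 1)) / (- 1 - n + 1)) {norm z..}"
      using n z by (intro has_integral_powr_to_inf) auto
    then have "(\<integral>\<^sup>+t. ennreal (t powr (- 1 - n)) * indicator {norm z..} t \<partial>lborel)
        = ennreal (- (norm z powr (- 1 - n + 1)) / (- 1 - n + 1))"
      by (intro nn_integral_has_integral_lebesgue') auto
    also have "- (norm z powr (- 1 - n + 1)) / (- 1 - n + 1) = norm z powr (- n) / n"
      by simp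
    finally have *: "(\<integral>\<^sup>+t. ennreal (t powr (- 1 - n)) * indicator {norm z..} t \<partial>lborel) = ennreal (norm z powr (- n) / n)" .
    have "(\<integral>\<^sup>+t. ennreal (K' z t) \<partial>lborel)
        = (\<integral>\<^sup>+t. ennreal (n * norm z powr (- p) * G z) * (ennreal (t powr (- 1 - n)) * indicator {norm z..} t) \<partial>lborel)"
    proof (rule nn_integral_cong_AE)
      have "AE t in lborel. t \<noteq> norm z" by (rule AE_lborel_singleton)
      then show "AE t in lborel. ennreal (K' z t) =
          ennreal (n * norm z powr (- p) * G z) * (ennreal (t powr (- 1 - n)) * indicator {norm z..} t)"
        by eventually_elim (use n nonneg in \<open>auto simp: K'_def indicator_def simp flip: ennreal_mult\<close>)
    qed
    also have "\<dots> = ennreal (n * norm z powr (- p) * G z) * ennreal (norm z powr (- n) / n)"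
      unfolding *[symmetric] by (rule nn_integral_cmult) measurable
    also have "\<dots> = ennreal (n * norm z powr (- p) * G z * (norm z powr (- n) / n))"
      using n nonneg by (intro ennreal_mult[symmetric]) auto
    also have "n * norm z powr (- p) * G z * (norm z powr (- n) / n) = G z * (norm z powr (- n) * norm z powr (- p))"
      using n by simp
    also have "norm z powr (- n) * norm z powr (- p) = norm z powr (- n - p)"
      by (simp add: powr_add[symmetric])
    finally show "(\<integral>\<^sup>+t. ennreal (K' z t) \<partial>lborel) = ennreal (G z * norm z powr (- n - p))" .
  qed
  finally show ?thesis by (simp add: n_def)
qed

text \<open>The factor |w|^p of the line integrals cancels the weight |w|^(-p) of the radial
  formula. What remains is the integral of \<Theta> over the unit ball, finite because \<Theta> is
  bounded.\<close>

lemma has_bochner_integral_radial: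
  fixes G \<Theta> :: "'a::euclidean_space \<Rightarrow> real"
  assumes G [measurable]: "G \<in> borel_measurable borel" "\<And>z. 0 \<le> G z"
    and \<Theta> [measurable]: "\<Theta> \<in> borel_measurable borel" "\<And>w. 0 \<le> \<Theta> w" "\<And>w. \<Theta> w \<le> B"
    and *: "\<And>w. w \<noteq> 0 \<Longrightarrow> has_bochner_integral lborel
      (\<lambda>t. indicator {0<..} t * (G (t *\<^sub>R w) * t powr (- 1 - p))) (norm w powr p * \<Theta> w)"
  shows "has_bochner_integral lborel (\<lambda>z. G z * norm z powr (- real DIM('a) - p))
      (real DIM('a) * (LINT w:ball 0 1|lborel. \<Theta> w))"
proof -
  have int: "set_integrable lborel (ball 0 1) \<Theta>"
    unfolding set_integrable_def
    by (rule integrableI_bounded_set_indicator[where B=B])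
      (use \<Theta> emeasure_bounded_finite[OF bounded_ball[of "0::'a" 1]] in auto)
  have nn: "(\<integral>\<^sup>+t. ennreal (indicator {0<..} t * (G (t *\<^sub>R w) * t powr (- 1 - p))) \<partial>lborel)
      = ennreal (norm w powr p * \<Theta> w)" if "w \<noteq> 0" for w
    using *[OF that] G(2) by (subst nn_integral_eq_integral) (auto simp: has_bochner_integral_iff)
  have "(\<integral>\<^sup>+z. ennreal (G z * norm z powr (- real DIM('a) - p)) \<partial>lborel)
      = (\<integral>\<^sup>+w. indicator (ball 0 1) w * ennreal (real DIM('a) * norm w powr (- p) * (norm w powr p * \<Theta> w)) \<partial>lborel)"
    by (rule nn_integral_radial[OF G nn])
  also have "\<dots> = (\<integral>\<^sup>+w. ennreal (real DIM('a) * (indicator (ball 0 1) w *\<^sub>R \<Theta> w)) \<partial>lborel)"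
  proof (rule nn_integral_cong_AE)
    have "AE w in lborel. (w::'a) \<noteq> 0" by (rule AE_lborel_singleton)
    then show "AE w in lborel. indicator (ball 0 1) w * ennreal (real DIM('a) * norm w powr (- p) * (norm w powr p * \<Theta> w))
        = ennreal (real DIM('a) * (indicator (ball (0::'a) 1) w *\<^sub>R \<Theta> w))"
    proof eventually_elim
      fix w :: 'a assume "w \<noteq> 0"
      then have e: "norm w powr (- p) * (norm w powr p * \<Theta> w) = \<Theta> w"
        by (simp add: powr_minus)
      then show "indicator (ball 0 1) w * ennreal (real DIM('a) * norm w powr (- p) * (norm w powr p * \<Theta> w))
        = ennreal (real DIM('a) * (indicator (ball 0 1) w *\<^sub>R \<Theta> w))"
        unfolding mult.assoc e by (auto simp: indicator_def)
    qed
  qed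
  also have "\<dots> = ennreal (real DIM('a) * (LINT w:ball 0 1|lborel. \<Theta> w))"
    using int \<Theta>(2) unfolding set_integrable_def set_lebesgue_integral_def
    by (subst nn_integral_eq_integral) (auto intro!: integrable_mult_right)
  finally show "has_bochner_integral lborel (\<lambda>z. G z * norm z powr (- real DIM('a) - p))
      (real DIM('a) * (LINT w:ball 0 1|lborel. \<Theta> w))"
    using G(2) \<Theta>(2) by (intro has_bochner_integral_nn_integral)
      (auto simp: set_lebesgue_integral_def intro!: mult_nonneg_nonneg integral_nonneg_AE)
qed

section \<open>The profile along lines, integrated over directions\<close>

definition profile :: "real \<Rightarrow> ('a::real_normed_vector \<Rightarrow> 'b::real_normed_vector) \<Rightarrow> 'a \<Rightarrow> real" where
  "profile s A x = pos_pow s (1 - (norm (A x))\<^sup>2)"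

text \<open>For linear A the integrand is constant along rays, so \<open>DIM('a)\<close> times this
  number is the integral over the unit sphere; the ball stands in for the surface measure.\<close>

definition anisotropy :: "real \<Rightarrow> ('a::euclidean_space \<Rightarrow> 'b::real_normed_vector) \<Rightarrow> real" where
  "anisotropy s A = (LINT w:ball 0 1|lborel. (norm (A w) / norm w) powr (2 * s))"

text \<open>
  Along a line, the profile is a rescaled one-dimensional profile; by homogeneity of the kernel
  the resulting integral depends on the direction only.
\<close>

lemma has_bochner_integral_profile_line:
  fixes A :: "'a::euclidean_space \<Rightarrow> 'b::euclidean_space"
  assumes s: "0 < s" "s < 1" and A: "bounded_linear A" and x: "norm (A x) < 1" and w: "A w \<noteq> 0"
  shows "has_bochner_integral lborel
    (\<lambda>t. indicator {0<..} t * ((2 * profile s A x - profile s A (x + t *\<^sub>R w) - profile s A (x - t *\<^sub>R w))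
      * t powr (- 1 - 2 * s))) (norm (A w) powr (2 * s) * Beta (1 - s) s)"
proof -
  interpret A: bounded_linear A by fact
  define p q where "p = A x" and "q = A w"
  have q: "norm q > 0" using w by (simp add: q_def)
  have p1: "(norm p)\<^sup>2 < 1"
    using x power_strict_mono[of "norm p" 1 2] by (simp add: p_def)
  \<comment> \<open>Completing the square along the line: r is the component of A x in the direction
    of A w, and 1 - |A (x + t w)|^2 = D (1 - (\<xi> + c t)^2). From |A x| < 1 follows r^2 < D, so
    |\<xi>| < 1.\<close>
  define r where "r = (p \<bullet> q) / norm q"
  define D where "D = 1 - (norm p)\<^sup>2 + r\<^sup>2"
  have D: "D > 0" using p1 zero_le_power2[of r] unfolding D_def by linarith
  define \<xi> where "\<xi> = r / sqrt D"
  define c where "c = norm q / sqrt D"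
  have c: "c > 0" using q D by (simp add: c_def)
  have "\<xi>\<^sup>2 < 1"
    using p1 D by (simp add: \<xi>_def power_divide D_def)
  then have \<xi>: "\<bar>\<xi>\<bar> < 1" by (simp add: abs_square_less_1)
  interpret interval_profile s \<xi> using s \<xi> by unfold_locales
  have line: "profile s A (x + t *\<^sub>R w) = D powr s * v (\<xi> + c * t)" for t
  proof -
    have "sqrt D * (\<xi> + c * t) = r + norm q * t"
      using D by (simp add: \<xi>_def c_def field_simps)
    then have "D * (\<xi> + c * t)\<^sup>2 = (r + norm q * t)\<^sup>2"
      using D by (metis power_mult_distrib real_sqrt_pow2 less_imp_le)
    also have "\<dots> = r\<^sup>2 + 2 * t * (p \<bullet> q) + t\<^sup>2 * (norm q)\<^sup>2"
      using q by (simp add: r_def power2_eq_square field_simps)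
    finally have "D * (1 - (\<xi> + c * t)\<^sup>2) = 1 - ((norm p)\<^sup>2 + 2 * t * (p \<bullet> q) + t\<^sup>2 * (norm q)\<^sup>2)"
      by (simp add: D_def algebra_simps)
    also have "(norm p)\<^sup>2 + 2 * t * (p \<bullet> q) + t\<^sup>2 * (norm q)\<^sup>2 = (norm (A (x + t *\<^sub>R w)))\<^sup>2"
      unfolding A.add A.scaleR p_def[symmetric] q_def[symmetric] power2_norm_eq_inner
      by (simp add: inner_add_left inner_add_right inner_commute power2_eq_square)
    finally show ?thesis
      unfolding profile_def v_def using pos_pow_mult[OF D] by metis
  qed
  have "has_bochner_integral lborel (\<lambda>t. indicator {0<..} t *
      ((2 * v \<xi> - v (\<xi> + c * t) - v (\<xi> - c * t)) * t powr (- 1 - 2 * s)))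
      (c powr (- 1 - (- 1 - 2 * s)) * Beta (1 - s) s)"
    using has_bochner_integral_f c unfolding f_def by (rule has_bochner_integral_kernel_scale)
  from has_bochner_integral_mult_right[OF this, of "D powr s"]
  have "has_bochner_integral lborel (\<lambda>t. D powr s * (indicator {0<..} t *
      ((2 * v \<xi> - v (\<xi> + c * t) - v (\<xi> - c * t)) * t powr (- 1 - 2 * s))))
      (D powr s * (c powr (2 * s) * Beta (1 - s) s))" by simp
  moreover have "(\<lambda>t. D powr s * (indicator {0<..} t * ((2 * v \<xi> - v (\<xi> + c * t) - v (\<xi> - c * t)) * t powr (- 1 - 2 * s))))
      = (\<lambda>t. indicator {0<..} t * ((2 * profile s A x - profile s A (x + t *\<^sub>R w) - profile s A (x - t *\<^sub>R w)) * t powr (- 1 - 2 * s)))"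
  proof (rule ext)
    fix t
    show "D powr s * (indicator {0<..} t * ((2 * v \<xi> - v (\<xi> + c * t) - v (\<xi> - c * t)) * t powr (- 1 - 2 * s)))
      = indicator {0<..} t * ((2 * profile s A x - profile s A (x + t *\<^sub>R w) - profile s A (x - t *\<^sub>R w)) * t powr (- 1 - 2 * s))"
      using line[of 0] line[of t] line[of "- t"] by (simp add: algebra_simps)
  qed
  moreover have "D powr s * c powr (2 * s) = norm q powr (2 * s)"
  proof -
    have "c powr (2 * s) = norm q powr (2 * s) / (sqrt D powr (2 * s))"
      unfolding c_def by (rule powr_divide)
    also have "sqrt D powr (2 * s) = D powr s"
      using D by (simp add: powr_half_sqrt[symmetric] powr_powr)
    finally show ?thesis using D by simp
  qed
  ultimately show ?thesis by (simp only: q_def mult.assoc[symmetric])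
qed

lemma profile_bounds: "0 < s \<Longrightarrow> 0 \<le> profile s A x" "0 < s \<Longrightarrow> profile s A x \<le> 1"
  by (auto simp: profile_def pos_pow_nonneg intro!: pos_pow_le_1)

lemma profile_measurable:
  fixes A :: "'a::euclidean_space \<Rightarrow> 'b::real_normed_vector"
  assumes "0 < s" "bounded_linear A"
  shows "profile s A \<in> borel_measurable borel"
  unfolding profile_def[abs_def] using assms
  by (intro borel_measurable_continuous_onI continuous_on_pos_pow continuous_intros
      linear_continuous_on) auto

lemma integrable_min_kernel_space:
  assumes "0 < s" "s < 1"
  shows "has_bochner_integral lborel
    (\<lambda>z::'a::euclidean_space. min 1 ((norm z)\<^sup>2) * norm z powr (- real DIM('a) - 2 * s))
    (real DIM('a) * (LINT w:ball (0::'a) 1|lborel. 1 / (2 - 2 * s) + 1 / (2 * s)))"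
proof (rule has_bochner_integral_radial[OF _ _ _ _ order_refl])
  fix w :: 'a assume "w \<noteq> 0"
  then show "has_bochner_integral lborel (\<lambda>t. indicator {0<..} t *
      (min 1 ((norm (t *\<^sub>R w))\<^sup>2) * t powr (- 1 - 2 * s)))
      (norm w powr (2 * s) * (1 / (2 - 2 * s) + 1 / (2 * s)))"
    using has_bochner_integral_min_kernel[OF assms, of "norm w"]
    by (simp add: power_mult_distrib mult.commute)
qed (use assms in auto)

lemma has_bochner_integral_profile:
  fixes A :: "'a::euclidean_space \<Rightarrow> 'b::euclidean_space"
  assumes s: "0 < s" "s < 1" and A: "bounded_linear A" "\<And>w. w \<noteq> 0 \<Longrightarrow> A w \<noteq> 0" and x: "norm (A x) < 1"
  shows "has_bochner_integral lborel
    (\<lambda>z. (2 * profile s A x - profile s A (x + z) - profile s A (x - z)) * norm z powr (- real DIM('a) - 2 * s))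
    (real DIM('a) * (Beta (1 - s) s * anisotropy s A))"
proof -
  define n where "n = real DIM('a)"
  obtain K where K: "K > 0" "\<And>z. norm (A z) \<le> norm z * K"
    using bounded_linear.pos_bounded[OF A(1)] by auto
  obtain M where M: "M \<ge> 0" "\<forall>z. \<bar>2 * profile s A x - profile s A (x + z) - profile s A (x - z)\<bar> \<le> M * min 1 ((norm z)\<^sup>2)"
    using profile_increments(1)[OF s A(1) x, folded profile_def] by (elim exE conjE)
  define \<kappa> where "\<kappa> = 1 / (2 - 2 * s) + 1 / (2 * s)"
  have \<kappa>: "\<kappa> \<ge> 0" using s by (simp add: \<kappa>_def)
  define F where "F = (\<lambda>z. 2 * profile s A x - profile s A (x + z) - profile s A (x - z))"
  define \<Theta> where "\<Theta> = (\<lambda>w. Beta (1 - s) s * (norm (A w) / norm w) powr (2 * s))"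
  have B: "Beta (1 - s) s \<ge> 0"
    using s by (simp add: Beta_def)
  note [measurable] = profile_measurable[OF s(1) A(1)]
    borel_measurable_continuous_onI[OF linear_continuous_on[OF A(1)]]
  have \<Theta>m[measurable]: "\<Theta> \<in> borel_measurable borel" unfolding \<Theta>_def by measurable
  have \<Theta>0: "0 \<le> \<Theta> w" and \<Theta>B: "\<Theta> w \<le> Beta (1 - s) s * K powr (2 * s)" for w
  proof -
    have "norm (A w) / norm w \<le> K"
      using K by (cases "w = 0") (auto simp: divide_le_eq mult.commute)
    then show "0 \<le> \<Theta> w" "\<Theta> w \<le> Beta (1 - s) s * K powr (2 * s)"
      unfolding \<Theta>_def using B s by (auto intro!: mult_left_mono powr_mono2)
  qed
  \<comment> \<open>The second difference F may change sign, while the radial formula needs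
    nonnegative integrands. The integrable majorant is added for this reason, and its integral is
    subtracted afterwards.\<close>
  have sum: "has_bochner_integral lborel (\<lambda>z. (F z + M * min 1 ((norm z)\<^sup>2)) * norm z powr (- n - 2 * s))
      (n * (LINT w:ball 0 1|lborel. \<Theta> w + M * \<kappa>))"
    unfolding n_def
  proof (rule has_bochner_integral_radial[where B="Beta (1 - s) s * K powr (2 * s) + M * \<kappa>"])
    fix w :: 'a assume w: "w \<noteq> 0"
    have "has_bochner_integral lborel (\<lambda>t. indicator {0<..} t * (F (t *\<^sub>R w) * t powr (- 1 - 2 * s))
        + M * (indicator {0<..} t * (min 1 ((norm w * t)\<^sup>2) * t powr (- 1 - 2 * s))))
        (norm (A w) powr (2 * s) * Beta (1 - s) s + M * (norm w powr (2 * s) * \<kappa>))"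
      unfolding F_def \<kappa>_def using s A x w
      by (intro has_bochner_integral_add has_bochner_integral_mult_right
          has_bochner_integral_profile_line has_bochner_integral_min_kernel) auto
    moreover have "norm (A w) powr (2 * s) = norm w powr (2 * s) * (norm (A w) / norm w) powr (2 * s)"
      using w by (subst powr_mult[symmetric]) auto
    ultimately show "has_bochner_integral lborel (\<lambda>t. indicator {0<..} t *
        ((F (t *\<^sub>R w) + M * min 1 ((norm (t *\<^sub>R w))\<^sup>2)) * t powr (- 1 - 2 * s)))
        (norm w powr (2 * s) * (\<Theta> w + M * \<kappa>))"
      by (simp add: \<Theta>_def algebra_simps power_mult_distrib)
  next
    fix z
    show "0 \<le> F z + M * min 1 ((norm z)\<^sup>2)"
      using M(2)[rule_format, of z] unfolding F_def abs_le_iff by linarith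
    show "0 \<le> \<Theta> z + M * \<kappa>" using \<Theta>0 M(1) \<kappa> by simp
    show "\<Theta> z + M * \<kappa> \<le> Beta (1 - s) s * K powr (2 * s) + M * \<kappa>" using \<Theta>B by simp
  next
    show "(\<lambda>z. F z + M * min 1 ((norm z)\<^sup>2)) \<in> borel_measurable borel"
      unfolding F_def by measurable
    show "(\<lambda>w. \<Theta> w + M * \<kappa>) \<in> borel_measurable borel" by measurable
  qed
  have const: "set_integrable lborel (ball (0::'a) 1) (\<lambda>w. \<kappa>)"
    unfolding set_integrable_def
    by (rule integrableI_bounded_set_indicator[where B="\<bar>\<kappa>\<bar>"])
      (use emeasure_bounded_finite[OF bounded_ball[of "0::'a" 1]] in auto)
  have \<Theta>i: "set_integrable lborel (ball 0 1) \<Theta>"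
    unfolding set_integrable_def
    by (rule integrableI_bounded_set_indicator[where B="Beta (1 - s) s * K powr (2 * s)"])
      (use \<Theta>0 \<Theta>B emeasure_bounded_finite[OF bounded_ball[of "0::'a" 1]] in auto)
  have "has_bochner_integral lborel (\<lambda>z. (F z + M * min 1 ((norm z)\<^sup>2)) * norm z powr (- n - 2 * s)
      - M * (min 1 ((norm z)\<^sup>2) * norm z powr (- n - 2 * s)))
      (n * (LINT w:ball 0 1|lborel. \<Theta> w + M * \<kappa>) - M * (n * (LINT w:ball (0::'a) 1|lborel. \<kappa>)))"
    unfolding n_def \<kappa>_def
    by (intro has_bochner_integral_diff has_bochner_integral_mult_right integrable_min_kernel_space s
        sum[unfolded n_def \<kappa>_def])
  moreover have "(LINT w:ball 0 1|lborel. \<Theta> w + M * \<kappa>) = (LINT w:ball 0 1|lborel. \<Theta> w) + M * (LINT w:ball (0::'a) 1|lborel. \<kappa>)"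
  proof -
    have M\<kappa>: "set_integrable lborel (ball (0::'a) 1) (\<lambda>w. M * \<kappa>)"
      using const by (intro set_integrable_mult_right)
    show ?thesis
      using set_integral_add(2)[OF \<Theta>i M\<kappa>] unfolding set_integral_mult_right .
  qed
  moreover have "(LINT w:ball 0 1|lborel. \<Theta> w) = Beta (1 - s) s * anisotropy s A"
    unfolding anisotropy_def \<Theta>_def by simp
  ultimately show ?thesis
    by (simp add: F_def n_def algebra_simps)
qed

section \<open>Truncated integrals and the principal value in space\<close>

lemma tendsto_integral_outside_ball:
  fixes g :: "'a::euclidean_space \<Rightarrow> real"
  assumes g: "integrable lborel g"
  shows "((\<lambda>\<delta>. LINT z:- ball 0 \<delta>|lborel. g z) \<longlongrightarrow> (\<integral>z. g z \<partial>lborel)) (at_right 0)"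
  unfolding tendsto_at_iff_sequentially
proof (intro allI impI)
  fix X :: "nat \<Rightarrow> real"
  assume X: "\<forall>i. X i \<in> {0<..} - {0}" "X \<longlonglongrightarrow> 0"
  have [measurable]: "g \<in> borel_measurable borel" using g by auto
  have "(\<lambda>i. \<integral>z. indicator (- ball 0 (X i)) z *\<^sub>R g z \<partial>lborel) \<longlonglongrightarrow> (\<integral>z. g z \<partial>lborel)"
  proof (rule integral_dominated_convergence[where w="\<lambda>z. norm (g z)"])
    have "AE z in lborel. (z::'a) \<noteq> 0" by (rule AE_lborel_singleton)
    then show "AE z in lborel. (\<lambda>i. indicator (- ball 0 (X i)) z *\<^sub>R g z) \<longlonglongrightarrow> g z"
    proof eventually_elim
      fix z :: 'a assume "z \<noteq> 0"
      then have "\<forall>\<^sub>F i in sequentially. X i < norm z"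
        using X(2) by (intro order_tendstoD(2)) auto
      then have "\<forall>\<^sub>F i in sequentially. indicator (- ball 0 (X i)) z *\<^sub>R g z = g z"
        by eventually_elim (auto simp: indicator_def)
      then show "(\<lambda>i. indicator (- ball 0 (X i)) z *\<^sub>R g z) \<longlonglongrightarrow> g z"
        by (rule tendsto_eventually)
    qed
    show "AE z in lborel. norm (indicator (- ball 0 (X i)) z *\<^sub>R g z) \<le> norm (g z)" for i
      by (auto simp: indicator_def)
    show "integrable lborel (\<lambda>z. norm (g z))" using g by (rule integrable_norm)
  qed auto
  then show "((\<lambda>\<delta>. LINT z:- ball 0 \<delta>|lborel. g z) \<circ> X) \<longlonglongrightarrow> (\<integral>z. g z \<partial>lborel)"
    by (simp add: comp_def set_lebesgue_integral_def)
qed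

lemma set_integrable_kernel_bounded:
  fixes h :: "'a::euclidean_space \<Rightarrow> real"
  assumes s: "0 < s" "s < 1" and [measurable]: "h \<in> borel_measurable borel"
    and h: "\<And>z. \<bar>h z\<bar> \<le> B" and "0 < \<delta>"
  shows "set_integrable lborel (- ball 0 \<delta>) (\<lambda>z. h z * norm z powr (- real DIM('a) - 2 * s))"
proof -
  \<comment> \<open>Outside the ball of radius \<delta> the function min 1 (|z|^2) is at least m, so
    after division by m the integrable kernel dominates any bounded multiple.\<close>
  define m where "m = min 1 (\<delta>\<^sup>2)"
  have m: "m > 0" using assms by (simp add: m_def)
  have "integrable lborel (\<lambda>z::'a. B / m * (min 1 ((norm z)\<^sup>2) * norm z powr (- real DIM('a) - 2 * s)))"
    using integrable_min_kernel_space[OF s] by (auto simp: has_bochner_integral_iff)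
  then show ?thesis
    unfolding set_integrable_def
  proof (rule Bochner_Integration.integrable_bound)
    show "AE z in lborel. norm (indicator (- ball 0 \<delta>) z *\<^sub>R (h z * norm z powr (- real DIM('a) - 2 * s)))
        \<le> norm (B / m * (min 1 ((norm z)\<^sup>2) * norm z powr (- real DIM('a) - 2 * s)))"
    proof (rule AE_I2)
      fix z :: 'a
      have B: "B \<ge> 0" using h[of z] by linarith
      show "norm (indicator (- ball 0 \<delta>) z *\<^sub>R (h z * norm z powr (- real DIM('a) - 2 * s)))
          \<le> norm (B / m * (min 1 ((norm z)\<^sup>2) * norm z powr (- real DIM('a) - 2 * s)))"
      proof (cases "z \<in> ball 0 \<delta>")
        case False
        then have "\<delta>\<^sup>2 \<le> (norm z)\<^sup>2" using assms by (intro power_mono) auto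
        then have "m \<le> min 1 ((norm z)\<^sup>2)" by (auto simp: m_def)
        then have "B * 1 \<le> B * (min 1 ((norm z)\<^sup>2) / m)"
          using m B by (intro mult_left_mono) (auto simp: le_divide_eq)
        then have "\<bar>h z\<bar> \<le> B / m * min 1 ((norm z)\<^sup>2)"
          using h[of z] by (simp add: mult.commute)
        then have "\<bar>h z\<bar> * norm z powr (- real DIM('a) - 2 * s)
            \<le> B / m * min 1 ((norm z)\<^sup>2) * norm z powr (- real DIM('a) - 2 * s)"
          by (rule mult_right_mono) simp
        then show ?thesis
          using False B m by (simp add: abs_mult mult.assoc abs_of_nonneg)
      qed simp
    qed
  qed measurable
qed

lemma has_frac_laplacian_profile:
  fixes A :: "'a::euclidean_space \<Rightarrow> 'b::euclidean_space"
  assumes s: "0 < s" "s < 1" and A: "bounded_linear A" "\<And>w. w \<noteq> 0 \<Longrightarrow> A w \<noteq> 0" and x: "norm (A x) < 1"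
  shows "has_frac_laplacian s (profile s A) x
    (frac_laplacian_const DIM('a) s * (real DIM('a) * (Beta (1 - s) s * anisotropy s A) / 2))"
proof -
  define n where "n = real DIM('a)"
  let ?u = "profile s A"
  have [measurable]: "?u \<in> borel_measurable borel" by (rule profile_measurable[OF s(1) A(1)])
  define g where "g = (\<lambda>\<sigma> z. (?u x - ?u (x + \<sigma> *\<^sub>R z)) * norm z powr (- n - 2 * s))"
  define F where "F = (\<lambda>z. (2 * ?u x - ?u (x + z) - ?u (x - z)) * norm z powr (- n - 2 * s))"
  define f where "f = (\<lambda>y. (?u x - ?u y) / dist x y powr (n + 2 * s))"
  note F = has_bochner_integral_profile[OF s A x, folded n_def, folded F_def]
  have gi: "set_integrable lborel (- ball 0 \<delta>) (g \<sigma>)" if "0 < \<delta>" for \<delta> \<sigma>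
    unfolding g_def n_def
  proof (rule set_integrable_kernel_bounded[OF s _ _ that])
    show "\<bar>?u x - ?u (x + \<sigma> *\<^sub>R z)\<bar> \<le> 1" for z
      using profile_bounds[OF s(1), of A x] profile_bounds[OF s(1), of A "x + \<sigma> *\<^sub>R z"] by linarith
  qed measurable
  \<comment> \<open>The substitutions y = x + z and y = x - z give the same truncated integral;
    averaging them replaces the first difference by half of the second difference F.\<close>
  have f: "set_integrable lborel (- ball x \<delta>) f \<and>
      (LINT y:- ball x \<delta>|lborel. f y) = (LINT z:- ball 0 \<delta>|lborel. g \<sigma> z)"
    if \<delta>: "0 < \<delta>" and \<sigma>: "\<bar>\<sigma>\<bar> = 1" for \<delta> \<sigma>
  proof -
    have "has_bochner_integral lborel (\<lambda>z. indicator (- ball 0 \<delta>) z *\<^sub>R g \<sigma> z) (LINT z:- ball 0 \<delta>|lborel. g \<sigma> z)"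
      using gi[OF \<delta>] by (simp add: has_bochner_integral_iff set_integrable_def set_lebesgue_integral_def)
    from has_bochner_integral_lborel_affine[OF this \<sigma>, of "- \<sigma> *\<^sub>R x"]
    have "has_bochner_integral lborel (\<lambda>y. indicator (- ball 0 \<delta>) (- \<sigma> *\<^sub>R x + \<sigma> *\<^sub>R y) *\<^sub>R
        g \<sigma> (- \<sigma> *\<^sub>R x + \<sigma> *\<^sub>R y)) (LINT z:- ball 0 \<delta>|lborel. g \<sigma> z)" .
    moreover have "indicator (- ball 0 \<delta>) (- \<sigma> *\<^sub>R x + \<sigma> *\<^sub>R y) *\<^sub>R g \<sigma> (- \<sigma> *\<^sub>R x + \<sigma> *\<^sub>R y)
        = indicator (- ball x \<delta>) y *\<^sub>R f y" for y
    proof -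
      have \<sigma>2: "\<sigma> * \<sigma> = 1" using \<sigma> by (metis abs_mult_self_eq mult_1)
      have e: "- \<sigma> *\<^sub>R x + \<sigma> *\<^sub>R y = \<sigma> *\<^sub>R (y - x)" by (simp add: scaleR_diff_right)
      have "norm (\<sigma> *\<^sub>R (y - x)) = dist x y" using \<sigma> by (simp add: dist_norm norm_minus_commute)
      moreover have "x + \<sigma> *\<^sub>R (\<sigma> *\<^sub>R (y - x)) = y" by (simp add: \<sigma>2)
      moreover have "dist x y powr (- n - 2 * s) = inverse (dist x y powr (n + 2 * s))"
        by (simp add: powr_minus[symmetric])
      ultimately show ?thesis
        unfolding e g_def f_def by (simp add: indicator_def divide_inverse)
    qed
    ultimately have "has_bochner_integral lborel (\<lambda>y. indicator (- ball x \<delta>) y *\<^sub>R f y) (LINT z:- ball 0 \<delta>|lborel. g \<sigma> z)"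
      by simp
    then show ?thesis
      by (simp add: has_bochner_integral_iff set_integrable_def set_lebesgue_integral_def)
  qed
  have half: "(LINT y:- ball x \<delta>|lborel. f y) = (LINT z:- ball 0 \<delta>|lborel. F z) / 2" if \<delta>: "0 < \<delta>" for \<delta>
  proof -
    have "(LINT z:- ball 0 \<delta>|lborel. F z) = (LINT z:- ball 0 \<delta>|lborel. g 1 z + g (-1) z)"
      by (rule arg_cong[where f="\<lambda>F. set_lebesgue_integral lborel _ F"])
        (auto simp: F_def g_def algebra_simps)
    also have "\<dots> = (LINT z:- ball 0 \<delta>|lborel. g 1 z) + (LINT z:- ball 0 \<delta>|lborel. g (-1) z)"
      by (rule set_integral_add) (intro gi \<delta>)+
    finally show ?thesis using f[OF \<delta>, of 1] f[OF \<delta>, of "-1"] by simp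
  qed
  have "((\<lambda>\<delta>. LINT z:- ball 0 \<delta>|lborel. F z) \<longlongrightarrow> real DIM('a) * (Beta (1 - s) s * anisotropy s A)) (at_right 0)"
    using tendsto_integral_outside_ball[of F] F by (simp add: has_bochner_integral_iff n_def)
  then have "((\<lambda>\<delta>. frac_laplacian_const DIM('a) s * ((LINT z:- ball 0 \<delta>|lborel. F z) / 2)) \<longlongrightarrow>
      frac_laplacian_const DIM('a) s * (real DIM('a) * (Beta (1 - s) s * anisotropy s A) / 2)) (at_right 0)"
    by (intro tendsto_intros) auto
  moreover have "\<forall>\<^sub>F \<delta> in at_right 0. frac_laplacian_const DIM('a) s * ((LINT z:- ball 0 \<delta>|lborel. F z) / 2)
      = frac_laplacian_const DIM('a) s * (LINT y:- ball x \<delta>|lborel. f y)"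
    using eventually_at_right_less[of "0::real"] by eventually_elim (simp add: half)
  ultimately have "((\<lambda>\<delta>. frac_laplacian_const DIM('a) s * (LINT y:- ball x \<delta>|lborel. f y)) \<longlongrightarrow>
      frac_laplacian_const DIM('a) s * (real DIM('a) * (Beta (1 - s) s * anisotropy s A) / 2)) (at_right 0)"
    by (rule Lim_transform_eventually)
  then show ?thesis
    using f[of _ 1] unfolding has_frac_laplacian_def Let_def f_def n_def by auto
qed

section \<open>The torsion function of the ellipsoid\<close>

lemma holder_space_continuous:
  fixes u :: "'a::metric_space \<Rightarrow> real"
  assumes "u \<in> holder_space s" "0 < s"
  shows "continuous_on UNIV u"
proof (intro continuous_at_imp_continuous_on ballI)
  fix x :: 'a
  obtain C where C: "\<And>x y. \<bar>u x - u y\<bar> \<le> C * dist x y powr s"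
    using assms(1) by (auto simp: holder_space_def)
  have "((\<lambda>y. dist y x) \<longlongrightarrow> 0) (at x)"
    using tendsto_dist[OF tendsto_ident_at[of x UNIV] tendsto_const[of x]] by simp
  then have "((\<lambda>y. C * dist y x powr s) \<longlongrightarrow> 0) (at x)"
    using assms(2) by (intro tendsto_mult_right_zero tendsto_zero_powrI[of _ _ "\<lambda>_. s" s]) auto
  then have "((\<lambda>y. u y - u x) \<longlongrightarrow> 0) (at x)"
    by (rule Lim_null_comparison[rotated]) (use C in auto)
  then show "isCont u x"
    by (simp add: isCont_def LIM_zero_iff)
qed

lemma frac_laplacian_const_pos: "0 < s \<Longrightarrow> s < 1 \<Longrightarrow> 0 < frac_laplacian_const n s"
  unfolding frac_laplacian_const_def
  by (intro divide_pos_pos mult_pos_pos Gamma_real_pos) (auto intro: add_nonneg_pos)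

lemma has_frac_laplacian_diff:
  assumes "has_frac_laplacian s u x L" "has_frac_laplacian s v x M"
  shows "has_frac_laplacian s (\<lambda>y. u y - v y) x (L - M)"
proof -
  let ?n = "DIM('a)"
  let ?k = "\<lambda>u y. (u x - u y) / dist x y powr (real ?n + 2 * s)"
  have e: "?k (\<lambda>y. u y - v y) = (\<lambda>y. ?k u y - ?k v y)"
    by (auto simp: diff_divide_distrib)
  have i: "set_integrable lborel (- ball x \<delta>) (?k u)" "set_integrable lborel (- ball x \<delta>) (?k v)" if "\<delta> > 0" for \<delta>
    using assms that by (auto simp: has_frac_laplacian_def Let_def)
  have "((\<lambda>\<delta>. frac_laplacian_const ?n s * (LINT y:- ball x \<delta>|lborel. ?k u y)
      - frac_laplacian_const ?n s * (LINT y:- ball x \<delta>|lborel. ?k v y)) \<longlongrightarrow> L - M) (at_right 0)"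
    using assms by (intro tendsto_diff) (auto simp: has_frac_laplacian_def Let_def)
  moreover have "\<forall>\<^sub>F \<delta> in at_right 0. frac_laplacian_const ?n s * (LINT y:- ball x \<delta>|lborel. ?k u y)
      - frac_laplacian_const ?n s * (LINT y:- ball x \<delta>|lborel. ?k v y)
      = frac_laplacian_const ?n s * (LINT y:- ball x \<delta>|lborel. ?k (\<lambda>y. u y - v y) y)"
    using eventually_at_right_less[of "0::real"]
    by eventually_elim (simp add: e set_integral_diff(2)[OF i] right_diff_distrib del: set_integral_diff)
  ultimately have "((\<lambda>\<delta>. frac_laplacian_const ?n s * (LINT y:- ball x \<delta>|lborel. ?k (\<lambda>y. u y - v y) y)) \<longlongrightarrow> L - M) (at_right 0)"
    by (rule Lim_transform_eventually)
  moreover have "set_integrable lborel (- ball x \<delta>) (?k (\<lambda>y. u y - v y))" if "\<delta> > 0" for \<delta>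
    unfolding e using i[OF that] by (rule set_integral_diff(1))
  ultimately show ?thesis
    by (simp add: has_frac_laplacian_def Let_def)
qed

lemma has_frac_laplacian_cmult:
  assumes "has_frac_laplacian s u x L"
  shows "has_frac_laplacian s (\<lambda>y. c * u y) x (c * L)"
proof -
  let ?n = "DIM('a)"
  let ?k = "\<lambda>u y. (u x - u y) / dist x y powr (real ?n + 2 * s)"
  have e: "?k (\<lambda>y. c * u y) = (\<lambda>y. c * ?k u y)"
    by (simp add: right_diff_distrib[symmetric])
  have i: "set_integrable lborel (- ball x \<delta>) (?k u)" if "\<delta> > 0" for \<delta>
    using assms that by (auto simp: has_frac_laplacian_def Let_def)
  have "((\<lambda>\<delta>. c * (frac_laplacian_const ?n s * (LINT y:- ball x \<delta>|lborel. ?k u y))) \<longlongrightarrow> c * L) (at_right 0)"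
    using assms by (intro tendsto_mult_left) (auto simp: has_frac_laplacian_def Let_def)
  then have "((\<lambda>\<delta>. frac_laplacian_const ?n s * (LINT y:- ball x \<delta>|lborel. ?k (\<lambda>y. c * u y) y)) \<longlongrightarrow> c * L) (at_right 0)"
    unfolding e set_integral_mult_right by (simp only: mult.left_commute)
  moreover have "set_integrable lborel (- ball x \<delta>) (?k (\<lambda>y. c * u y))" if "\<delta> > 0" for \<delta>
    unfolding e using i[OF that] by (intro set_integrable_mult_right)
  ultimately show ?thesis
    by (simp add: has_frac_laplacian_def Let_def)
qed

text \<open>
  At a positive interior maximum the integrand is nonnegative, and bounded below by a positive
  constant on a ball outside \<open>\<Omega>\<close>, so the fractional Laplacian is positive there.
\<close>

lemma frac_harmonic_nonpos:
  fixes w :: "'a::euclidean_space \<Rightarrow> real"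
  assumes s: "0 < s" "s < 1" and "bounded \<Omega>" and cont: "continuous_on UNIV w"
    and zero: "\<And>x. x \<notin> \<Omega> \<Longrightarrow> w x = 0" and harm: "\<And>x. x \<in> \<Omega> \<Longrightarrow> has_frac_laplacian s w x 0"
  shows "w y \<le> 0"
proof (rule ccontr)
  assume "\<not> w y \<le> 0"
  then have wy: "w y > 0" by simp
  then have "y \<in> closure \<Omega>" using zero closure_subset by fastforce
  have "compact (closure \<Omega>)" using assms(3) by simp
  moreover have "closure \<Omega> \<noteq> {}" using \<open>y \<in> closure \<Omega>\<close> by auto
  moreover have "continuous_on (closure \<Omega>) w" using cont by (rule continuous_on_subset) simp
  ultimately obtain x0 where x0: "x0 \<in> closure \<Omega>" "\<And>z. z \<in> closure \<Omega> \<Longrightarrow> w z \<le> w x0"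
    using continuous_attains_sup[of "closure \<Omega>" w] by auto
  have w0: "w x0 > 0" using x0(2)[OF \<open>y \<in> closure \<Omega>\<close>] wy by simp
  then have x\<Omega>: "x0 \<in> \<Omega>" using zero by fastforce
  have max: "w z \<le> w x0" for z
    using x0(2)[of z] zero[of z] w0 closure_subset[of \<Omega>] by (cases "z \<in> \<Omega>") auto
  define n where "n = real DIM('a)"
  define f where "f = (\<lambda>z. (w x0 - w z) / dist x0 z powr (n + 2 * s))"
  have f0: "0 \<le> f z" for z using max[of z] by (simp add: f_def)
  obtain r where r: "r > 0" "\<And>z. z \<in> \<Omega> \<Longrightarrow> norm z \<le> r"
    using assms(3) by (auto simp: bounded_pos)
  obtain e :: 'a where e: "norm e = 1" using vector_choose_size[of 1] by auto
  \<comment> \<open>The unit ball around p lies outside \<Omega> and at distance at least 1 from the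
    maximum point, so every truncation with \<delta> < 1 retains it.\<close>
  define p where "p = (r + norm x0 + 2) *\<^sub>R e"
  have np: "norm p = r + norm x0 + 2" using r e by (simp add: p_def)
  define d where "d = r + 2 * norm x0 + 3"
  have S: "z \<notin> \<Omega>" "1 \<le> dist x0 z" "dist x0 z \<le> d" if "z \<in> ball p 1" for z
  proof -
    have "norm p \<le> norm z + 1" "norm z \<le> norm p + 1"
      using that norm_triangle_sub[of p z] norm_triangle_sub[of z p]
      by (auto simp: dist_norm norm_minus_commute)
    then have nz: "r + norm x0 + 1 \<le> norm z" "norm z \<le> r + norm x0 + 3" using np by auto
    show "z \<notin> \<Omega>" using r(2)[of z] nz norm_ge_zero[of x0] by linarith
    show "1 \<le> dist x0 z"
      using norm_triangle_sub[of z x0] nz r(1) by (simp add: dist_norm norm_minus_commute)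
    show "dist x0 z \<le> d"
      using norm_triangle_ineq4[of x0 z] nz by (simp add: dist_norm d_def)
  qed
  define k where "k = w x0 / d powr (n + 2 * s)"
  have d: "d > 0" using r norm_ge_zero[of x0] unfolding d_def by linarith
  then have k: "k > 0" using w0 by (simp add: k_def)
  have fk: "k \<le> f z" if "z \<in> ball p 1" for z
  proof -
    have "w z = 0" using S[OF that] zero by blast
    then show ?thesis
      unfolding f_def k_def using S[OF that] w0 s d
      by (auto intro!: divide_left_mono powr_mono2 mult_pos_pos simp: n_def)
  qed
  define I where "I = k * measure lborel (ball p 1)"
  have I: "I > 0" using k content_ball_pos[of 1 p] by (simp add: I_def)
  have ge: "I \<le> (LINT z:- ball x0 \<delta>|lborel. f z)" if \<delta>: "0 < \<delta>" "\<delta> < 1" for \<delta>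
  proof -
    have fi: "set_integrable lborel (- ball x0 \<delta>) f"
      using harm[OF x\<Omega>] \<delta> by (auto simp: has_frac_laplacian_def Let_def f_def n_def)
    have "I = (\<integral>z. k * indicator (ball p 1) z \<partial>lborel)"
      by (simp add: I_def)
    also have "\<dots> \<le> (\<integral>z. indicator (- ball x0 \<delta>) z *\<^sub>R f z \<partial>lborel)"
    proof (rule integral_mono)
      show "integrable lborel (\<lambda>z. k * indicator (ball p 1) z)"
        using emeasure_bounded_finite[OF bounded_ball[of p 1]]
        by (intro integrable_mult_right integrable_real_indicator) auto
      show "integrable lborel (\<lambda>z. indicator (- ball x0 \<delta>) z *\<^sub>R f z)"
        using fi by (simp add: set_integrable_def)
      fix z
      show "k * indicator (ball p 1) z \<le> indicator (- ball x0 \<delta>) z *\<^sub>R f z"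
      proof (cases "z \<in> ball p 1")
        case True
        then have "z \<notin> ball x0 \<delta>" using S(2)[OF True] \<delta> by simp
        then show ?thesis using True fk[OF True] by simp
      next
        case False
        then show ?thesis using f0[of z] by simp
      qed
    qed
    finally show ?thesis by (simp add: set_lebesgue_integral_def)
  qed
  let ?c = "frac_laplacian_const DIM('a) s"
  have c: "?c > 0" using s by (rule frac_laplacian_const_pos)
  have "((\<lambda>\<delta>. ?c * (LINT z:- ball x0 \<delta>|lborel. f z)) \<longlongrightarrow> 0) (at_right 0)"
    using harm[OF x\<Omega>] by (simp add: has_frac_laplacian_def Let_def f_def n_def)
  moreover have "\<forall>\<^sub>F \<delta> in at_right 0. \<delta> \<in> {0<..<1::real}"
    by (rule eventually_at_right_real) simp
  then have "\<forall>\<^sub>F \<delta> in at_right 0. ?c * I \<le> ?c * (LINT z:- ball x0 \<delta>|lborel. f z)"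
    by (rule eventually_mono) (use ge c in \<open>auto intro!: mult_left_mono\<close>)
  ultimately have "?c * I \<le> 0"
    by (rule tendsto_lowerbound) simp
  then show False using c I by (simp add: mult_le_0_iff)
qed

lemma torsion_solution_unique:
  fixes u v :: "'a::euclidean_space \<Rightarrow> real"
  assumes s: "0 < s" "s < 1" and "bounded \<Omega>" and u: "torsion_solution s \<Omega> u" and v: "torsion_solution s \<Omega> v"
  shows "u = v"
proof -
  have le: "u y - v y \<le> 0" if u: "torsion_solution s \<Omega> u" and v: "torsion_solution s \<Omega> v"
    for u v :: "'a \<Rightarrow> real" and y
  proof (rule frac_harmonic_nonpos[OF s assms(3)])
    show "continuous_on UNIV (\<lambda>y. u y - v y)"
      using u v holder_space_continuous[OF _ s(1)]
      by (intro continuous_on_diff) (auto simp: torsion_solution_def)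
    show "has_frac_laplacian s (\<lambda>y. u y - v y) x 0" if "x \<in> \<Omega>" for x
      using has_frac_laplacian_diff[of s u x 1 v 1] u v that by (auto simp: torsion_solution_def)
  qed (use u v in \<open>auto simp: torsion_solution_def\<close>)
  show ?thesis
    using le[OF u v] le[OF v u] by (intro ext) (metis diff_le_0_iff_le order_antisym)
qed

section \<open>Hoelder continuity and the normalization constant\<close>

lemma powr_subadditive:
  fixes x y s :: real
  assumes "0 \<le> x" "0 \<le> y" "0 < s" "s < 1"
  shows "(x + y) powr s \<le> x powr s + y powr s"
proof (cases "x + y = 0")
  case True
  then show ?thesis using assms by (simp add: add_nonneg_eq_0_iff)
next
  case False
  then have t: "x + y > 0" using assms by auto
  \<comment> \<open>A number in [0, 1] is at most its s-th power; this is applied to x / (x + y) and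
    y / (x + y), which add up to 1.\<close>
  have le: "(x + y) powr s * (z / (x + y)) \<le> z powr s" if z: "0 \<le> z" "z \<le> x + y" for z
  proof -
    have "z / (x + y) \<le> (z / (x + y)) powr s"
      using z t assms powr_mono'[of s 1 "z / (x + y)"] by (cases "z = 0") auto
    then have "(x + y) powr s * (z / (x + y)) \<le> (x + y) powr s * (z / (x + y)) powr s"
      by (intro mult_left_mono) auto
    also have "\<dots> = z powr s"
      using z t by (subst powr_mult[symmetric]) auto
    finally show ?thesis .
  qed
  have "(x + y) powr s = (x + y) powr s * (x / (x + y)) + (x + y) powr s * (y / (x + y))"
    using t by (simp add: distrib_left[symmetric] add_divide_distrib[symmetric])
  also have "\<dots> \<le> x powr s + y powr s"
    using assms by (intro add_mono le) auto
  finally show ?thesis .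
qed

lemma pos_pow_holder:
  assumes "0 < s" "s < 1"
  shows "\<bar>pos_pow s x - pos_pow s y\<bar> \<le> \<bar>max 0 x - max 0 y\<bar> powr s"
proof -
  have le: "p powr s - q powr s \<le> \<bar>p - q\<bar> powr s" if "0 \<le> p" "0 \<le> q" for p q :: real
  proof (cases "p \<le> q")
    case True
    then have "p powr s \<le> q powr s" using that assms by (intro powr_mono2) auto
    then show ?thesis by (smt (verit) powr_ge_zero)
  next
    case False
    then show ?thesis using powr_subadditive[of q "p - q" s] that assms by simp
  qed
  show ?thesis
    using le[of "max 0 x" "max 0 y"] le[of "max 0 y" "max 0 x"]
    unfolding pos_pow_def by (simp add: abs_le_iff abs_minus_commute)
qed

lemma lipschitz_one_minus_square_pos:
  fixes p q :: real
  assumes "0 \<le> p" "0 \<le> q"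
  shows "\<bar>max 0 (1 - p\<^sup>2) - max 0 (1 - q\<^sup>2)\<bar> \<le> 2 * \<bar>p - q\<bar>"
proof -
  have "max 0 (1 - p\<^sup>2) - max 0 (1 - q\<^sup>2) \<le> 2 * (q - p)" if "0 \<le> p" "p \<le> q" for p q :: real
  proof (cases "p \<le> 1")
    case True
    define q' where "q' = min q 1"
    have "max 0 (1 - q\<^sup>2) = 1 - q'\<^sup>2"
      using that by (auto simp: q'_def min_def max_def power_le_one power2_eq_1_iff not_le
          one_le_power abs_square_le_1 intro: antisym)
    moreover have "1 - p\<^sup>2 \<ge> 0" using True that by (simp add: power_le_one)
    moreover have "q'\<^sup>2 - p\<^sup>2 = (q' - p) * (q' + p)" by (simp add: power2_eq_square algebra_simps)
    moreover have "(q' - p) * (q' + p) \<le> (q' - p) * 2"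
      using True that by (intro mult_left_mono) (auto simp: q'_def)
    moreover have "q' \<le> q" by (simp add: q'_def)
    ultimately show ?thesis by (simp add: max_def)
  next
    case False
    then have "1 \<le> p\<^sup>2" "1 \<le> q\<^sup>2" using that by (auto intro: one_le_power)
    then show ?thesis using that by simp
  qed
  moreover have "max 0 (1 - q\<^sup>2) \<le> max 0 (1 - p\<^sup>2)" if "0 \<le> p" "p \<le> q" for p q :: real
    using power_mono[OF that(2,1), of 2] by auto
  ultimately show ?thesis
    using assms by (cases "p \<le> q") (smt (verit))+
qed

text \<open>The isotropic case: for the identity map the anisotropy is the volume of the unit ball,
  so \<open>torsion_const\<close> is the multiple of the profile with fractional Laplacian 1 there.
  The Gamma factors cancel through the recursion at s and at n / 2.\<close>

lemma frac_laplacian_const_mult_torsion_const: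
  assumes "0 < s" "s < 1" "n \<ge> 1"
  shows "frac_laplacian_const n s * (real n * (Beta (1 - s) s * unit_ball_vol (real n)) / 2) * torsion_const n s = 1"
proof -
  have g: "Gamma (1 - s) > 0" "Gamma s > 0" "Gamma (real n / 2) > 0" "Gamma ((real n + 2 * s) / 2) > 0" "Gamma (1 + s) > 0"
    using assms by (auto intro!: Gamma_real_pos add_pos_pos)
  have r1: "Gamma (1 + s) = s * Gamma s"
    using Gamma_plus1[of s] assms nonpos_Ints_nonpos[of s] by (auto simp: add.commute)
  have r2: "Gamma (real n / 2 + 1) = real n / 2 * Gamma (real n / 2)"
    using Gamma_plus1[of "real n / 2"] assms nonpos_Ints_nonpos[of "real n / 2"] by auto
  have two: "2 powr (2 * s) * 2 powr (- 2 * s) = (1::real)"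
    by (simp add: powr_add[symmetric])
  have beta: "Beta (1 - s) s = Gamma (1 - s) * Gamma s"
    by (simp add: Beta_def)
  have cancel: "A * s * G4 / (q * G0) * (m * (G0 * G1 * (q / (m / 2 * G3))) / 2) * (B * G3 / (G4 * (s * G1))) = 1"
    if "A * B = 1" "0 < G0" "0 < G1" "0 < G3" "0 < G4" "0 < q" "0 < m" "0 < s" for A B G0 G1 G3 G4 q m s :: real
    using that by (simp add: field_simps)
  show ?thesis
    unfolding frac_laplacian_const_def torsion_const_def unit_ball_vol_def beta r1 r2
    by (rule cancel[OF two g(1,2,3,4)]) (use assms in auto)
qed

section \<open>The explicit solution on the ellipsoid, and its eccentricity
  \<open>rho\<close>\<close>

context thin_ellipsoid
begin

definition squeeze :: "real \<times> 'b::real_normed_vector \<Rightarrow> real \<times> 'b" where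
  "squeeze x = (fst x / a, snd x)"

lemma bounded_linear_squeeze: "bounded_linear squeeze"
  unfolding squeeze_def[abs_def]
  by (intro bounded_linear_Pair bounded_linear_snd bounded_linear_compose[OF bounded_linear_divide bounded_linear_fst])

lemma squeeze_sq: "(norm (squeeze x))\<^sup>2 = (fst x)\<^sup>2 / a\<^sup>2 + (norm (snd x))\<^sup>2"
  by (simp add: norm_prod_sq squeeze_def power_divide)

lemma mem_ellipsoid_squeeze: "x \<in> ellipsoid \<epsilon> \<longleftrightarrow> norm (squeeze x) < 1"
  unfolding mem_ellipsoid squeeze_sq[symmetric] by (simp add: power_less_one_iff abs_square_less_1)

lemma norm_squeeze_le: "norm (squeeze x) \<le> norm x"
proof (rule power2_le_imp_le)
  have "(fst x)\<^sup>2 / a\<^sup>2 \<le> (fst x)\<^sup>2 / 1"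
    using a_bounds(3) by (intro divide_left_mono) auto
  then show "(norm (squeeze x))\<^sup>2 \<le> (norm x)\<^sup>2"
    unfolding squeeze_sq norm_prod_sq[of x] by simp
qed simp

lemma norm_le_squeeze: "norm x \<le> a * norm (squeeze x)"
proof (rule power2_le_imp_le)
  have "1 * (norm (snd x))\<^sup>2 \<le> a\<^sup>2 * (norm (snd x))\<^sup>2"
    using a_bounds(3) by (intro mult_right_mono) auto
  then show "(norm x)\<^sup>2 \<le> (a * norm (squeeze x))\<^sup>2"
    using a_bounds(4) unfolding power_mult_distrib squeeze_sq norm_prod_sq[of x] distrib_left by simp
qed (use a_bounds in simp)

lemma squeeze_nonzero: "w \<noteq> 0 \<Longrightarrow> squeeze w \<noteq> 0"
  using norm_le_squeeze[of w] by auto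

lemma bounded_ellipsoid: "bounded (ellipsoid \<epsilon> :: (real \<times> (real ^ 'm::finite)) set)"
proof -
  have "norm x \<le> a" if "x \<in> ellipsoid \<epsilon>" for x :: "real \<times> (real ^ 'm)"
    using norm_le_squeeze[of x] that a_bounds(4) unfolding mem_ellipsoid_squeeze
    by (smt (verit) mult_left_le)
  then show ?thesis unfolding bounded_iff by blast
qed

text \<open>From |w| / a <= |squeeze w| <= |w|. Both bounds tend to V as a tends to 1, so the limit
  is available without evaluating the integral.\<close>

lemma anisotropy_bounds:
  assumes "0 < s"
  defines "V \<equiv> unit_ball_vol (real DIM(real \<times> (real ^ 'm::finite)))"
  shows "anisotropy s (squeeze :: real \<times> (real ^ 'm) \<Rightarrow> _) \<le> V"
    and "a powr (- 2 * s) * V \<le> anisotropy s (squeeze :: real \<times> (real ^ 'm) \<Rightarrow> _)"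
proof -
  let ?B = "ball (0 :: real \<times> (real ^ 'm)) 1"
  let ?h = "\<lambda>w :: real \<times> (real ^ 'm). (norm (squeeze w) / norm w) powr (2 * s)"
  have fin: "emeasure lborel ?B < \<infinity>" by (rule emeasure_bounded_finite) simp
  have [measurable]: "(squeeze :: real \<times> (real ^ 'm) \<Rightarrow> _) \<in> borel_measurable borel"
    by (rule borel_measurable_continuous_onI[OF linear_continuous_on[OF bounded_linear_squeeze]])
  have le1: "?h w \<le> 1" for w
  proof -
    have "norm (squeeze w) / norm w \<le> 1"
      using norm_squeeze_le[of w] by (cases "w = 0") auto
    then show ?thesis using assms(1) by (intro powr_le1) auto
  qed
  have ge: "a powr (- 2 * s) \<le> ?h w" if "w \<noteq> 0" for w
  proof -
    have "1 / a \<le> norm (squeeze w) / norm w"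
      using norm_le_squeeze[of w] that a_bounds(4) by (simp add: field_simps)
    then have "(1 / a) powr (2 * s) \<le> ?h w"
      using assms(1) a_bounds(4) by (intro powr_mono2) auto
    also have "(1 / a) powr (2 * s) = a powr (- 2 * s)"
      using a_bounds(4) by (simp add: powr_divide powr_minus_divide)
    finally show ?thesis .
  qed
  have ci: "set_integrable lborel ?B (\<lambda>_. c)" for c :: real
    unfolding set_integrable_def using fin
    by (intro integrableI_bounded_set_indicator[where B="\<bar>c\<bar>"]) auto
  have hi: "set_integrable lborel ?B ?h"
    unfolding set_integrable_def using fin le1
    by (intro integrableI_bounded_set_indicator[where B=1]) auto
  have V: "(LINT w:?B|lborel. c) = c * V" for c :: real
    unfolding set_lebesgue_integral_def V_def using content_ball[of 1 "0 :: real \<times> (real ^ 'm)"] by simp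
  have "(LINT w:?B|lborel. ?h w) \<le> (LINT w:?B|lborel. 1)"
    by (rule set_integral_mono[OF hi ci le1])
  then show "anisotropy s (squeeze :: real \<times> (real ^ 'm) \<Rightarrow> _) \<le> V"
    by (simp add: anisotropy_def V)
  have "(LINT w:?B|lborel. a powr (- 2 * s)) \<le> (LINT w:?B|lborel. ?h w)"
  proof (rule set_integral_mono_AE[OF ci hi])
    have "AE w in lborel. (w :: real \<times> (real ^ 'm)) \<noteq> 0" by (rule AE_lborel_singleton)
    then show "AE w\<in>?B in lborel. a powr (- 2 * s) \<le> ?h w"
      by eventually_elim (use ge in auto)
  qed
  then show "a powr (- 2 * s) * V \<le> anisotropy s (squeeze :: real \<times> (real ^ 'm) \<Rightarrow> _)"
    by (simp add: anisotropy_def V)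
qed

lemma profile_squeeze_holder:
  assumes "0 < s" "s < 1"
  shows "(\<lambda>x :: real \<times> 'b::real_normed_vector. K * profile s squeeze x) \<in> holder_space s"
  unfolding holder_space_def
proof (intro CollectI conjI exI allI)
  show "bounded (range (\<lambda>x :: real \<times> 'b. K * profile s squeeze x))"
    unfolding bounded_iff
  proof (intro exI[of _ "\<bar>K\<bar>"] ballI)
    fix y assume "y \<in> range (\<lambda>x :: real \<times> 'b. K * profile s squeeze x)"
    then obtain x :: "real \<times> 'b" where y: "y = K * profile s squeeze x" by (rule rangeE)
    have "\<bar>profile s squeeze x\<bar> \<le> 1"
      using profile_bounds[OF assms(1), of squeeze x] by (simp add: abs_le_iff)
    then show "norm y \<le> \<bar>K\<bar>" by (simp add: y abs_mult mult_left_le)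
  qed
  fix x y :: "real \<times> 'b"
  let ?A = "squeeze :: real \<times> 'b \<Rightarrow> _"
  have "\<bar>profile s ?A x - profile s ?A y\<bar>
      \<le> \<bar>max 0 (1 - (norm (?A x))\<^sup>2) - max 0 (1 - (norm (?A y))\<^sup>2)\<bar> powr s"
    unfolding profile_def by (rule pos_pow_holder[OF assms])
  also have "\<dots> \<le> (2 * \<bar>norm (?A x) - norm (?A y)\<bar>) powr s"
    using assms by (intro powr_mono2 lipschitz_one_minus_square_pos) auto
  also have "\<dots> \<le> (2 * dist x y) powr s"
  proof -
    have "\<bar>norm (?A x) - norm (?A y)\<bar> \<le> norm (?A x - ?A y)" by (rule norm_triangle_ineq3)
    also have "?A x - ?A y = ?A (x - y)" by (simp add: squeeze_def diff_divide_distrib)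
    also have "norm \<dots> \<le> dist x y" using norm_squeeze_le by (simp add: dist_norm)
    finally show ?thesis using assms by (intro powr_mono2) auto
  qed
  also have "\<dots> = 2 powr s * dist x y powr s" by (simp add: powr_mult)
  finally have "\<bar>K\<bar> * \<bar>profile s ?A x - profile s ?A y\<bar> \<le> \<bar>K\<bar> * (2 powr s * dist x y powr s)"
    by (rule mult_left_mono) simp
  then show "\<bar>K * profile s ?A x - K * profile s ?A y\<bar> \<le> (\<bar>K\<bar> * 2 powr s) * dist x y powr s"
    by (simp add: right_diff_distrib[symmetric] abs_mult mult.assoc)
qed

lemma torsion_solution_ellipsoid:
  assumes s: "0 < s" "s < 1"
  defines "n \<equiv> DIM(real \<times> (real ^ 'm::finite))"
  obtains K where "torsion_const n s \<le> K" "K \<le> a powr (2 * s) * torsion_const n s"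
    "torsion_solution s (ellipsoid \<epsilon> :: (real \<times> (real ^ 'm)) set) (\<lambda>x. K * profile s squeeze x)"
proof -
  let ?A = "squeeze :: real \<times> (real ^ 'm) \<Rightarrow> _"
  define V where "V = unit_ball_vol (real n)"
  have n1: "n \<ge> 1" by (simp add: n_def)
  have V: "V > 0" by (simp add: V_def)
  define c where "c = frac_laplacian_const n s * (real n * Beta (1 - s) s) / 2"
  define \<gamma> where "\<gamma> = torsion_const n s"
  have \<gamma>: "\<gamma> > 0"
    unfolding \<gamma>_def torsion_const_def using s n1
    by (intro divide_pos_pos mult_pos_pos Gamma_real_pos) (auto intro: add_pos_pos)
  have cV: "c * V * \<gamma> = 1"
    using frac_laplacian_const_mult_torsion_const[OF s n1] by (simp add: c_def V_def \<gamma>_def mult_ac)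
  have c: "c > 0"
    using cV V \<gamma> by (metis mult.commute mult_neg_pos mult_pos_pos not_less_iff_gr_or_eq mult_zero_left zero_neq_one zero_less_one)
  \<comment> \<open>The profile has the constant fractional Laplacian c times its anisotropy, and c
    V \<gamma> = 1 for the ball; hence K is \<gamma> V divided by the anisotropy.\<close>
  define K where "K = 1 / (c * anisotropy s ?A)"
  note an = anisotropy_bounds[OF s(1), where 'm='m, folded n_def, folded V_def]
  have apos: "0 < a powr (- 2 * s) * V" using V a_bounds(4) by simp
  then have an0: "anisotropy s ?A > 0" using an(2) by linarith
  have \<gamma>e: "\<gamma> = 1 / (c * V)" using cV c V by (simp add: field_simps)
  show thesis
  proof (rule that[of K])
    show "torsion_const n s \<le> K"
      unfolding \<gamma>_def[symmetric] \<gamma>e K_def using an(1) an0 c V by (intro divide_left_mono mult_left_mono mult_pos_pos) auto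
    have "K \<le> 1 / (c * (a powr (- 2 * s) * V))"
      unfolding K_def using an(2) an0 c apos V by (intro divide_left_mono mult_left_mono mult_pos_pos) auto
    also have "\<dots> = a powr (2 * s) * \<gamma>"
      using a_bounds(4) by (simp add: \<gamma>e powr_minus field_simps)
    finally show "K \<le> a powr (2 * s) * torsion_const n s" by (simp add: \<gamma>_def)
    show "torsion_solution s (ellipsoid \<epsilon>) (\<lambda>x. K * profile s ?A x)"
      unfolding torsion_solution_def
    proof (intro conjI ballI allI impI)
      show "(\<lambda>x. K * profile s ?A x) \<in> holder_space s" by (rule profile_squeeze_holder[OF s])
      show "K * profile s ?A x = 0" if "x \<notin> ellipsoid \<epsilon>" for x
        using that one_le_power[of "norm (?A x)" 2]
        by (simp add: mem_ellipsoid_squeeze profile_def pos_pow_def)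
      show "has_frac_laplacian s (\<lambda>x. K * profile s ?A x) x 1" if "x \<in> ellipsoid \<epsilon>" for x
      proof -
        have "has_frac_laplacian s (profile s ?A) x (c * anisotropy s ?A)"
          using has_frac_laplacian_profile[OF s bounded_linear_squeeze squeeze_nonzero, of x] that
          by (simp add: mem_ellipsoid_squeeze c_def n_def mult_ac)
        from has_frac_laplacian_cmult[OF this, of K] show ?thesis
          using c an0 by (simp add: K_def)
      qed
      note o = open_ellipsoid[where 'm='m]
      have pos: "1 - (norm (?A x))\<^sup>2 > 0" if "x \<in> ellipsoid \<epsilon>" for x
        using that by (simp add: mem_ellipsoid_squeeze power_less_one_iff abs_square_less_1)
      have "C_k_on 2 (ellipsoid \<epsilon>) (\<lambda>x. 1 - (norm (?A x))\<^sup>2)"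
        by (intro C_k_on_diff C_k_on_const C_k_on_norm_sq o bounded_linear_squeeze)
      then have "C_k_on 2 (ellipsoid \<epsilon>) (\<lambda>x. (1 - (norm (?A x))\<^sup>2) powr s)"
        by (rule C_k_on_compose[OF o _ _ C_k_on_powr]) (use pos in auto)
      then have "C_k_on 2 (ellipsoid \<epsilon>) (\<lambda>x. K * (1 - (norm (?A x))\<^sup>2) powr s)"
        by (intro C_k_on_mult C_k_on_const o)
      then show "C_k_on 2 (ellipsoid \<epsilon>) (\<lambda>x. K * profile s ?A x)"
        by (rule C_k_on_cong[OF o, rotated]) (use pos in \<open>auto simp: profile_def pos_pow_def less_imp_le\<close>)
    qed
  qed
qed

text \<open>The centre x is arbitrary, so the radii are bounded separately. An inscribed ball of
  radius above 1 would contain x + e and x - e for a unit vector e fixed by \<open>squeeze\<close>,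
  forcing two points of the open unit ball to distance 2. A containing ball of radius R2 below a
  would contain both (R2, 0) and (-R2, 0), at distance 2 R2.\<close>

lemma rho_ellipsoid: "rho (ellipsoid \<epsilon> :: (real \<times> (real ^ 'm::finite)) set) = \<epsilon>"
  unfolding rho_def
proof (rule cInf_eq_minimum)
  let ?\<Omega> = "ellipsoid \<epsilon> :: (real \<times> (real ^ 'm)) set"
  let ?A = "squeeze :: real \<times> (real ^ 'm) \<Rightarrow> _"
  have "0 \<in> ?\<Omega>" by (simp add: mem_ellipsoid)
  moreover have "ball 0 1 \<subseteq> ?\<Omega>"
  proof
    fix x :: "real \<times> (real ^ 'm)" assume "x \<in> ball 0 1"
    then show "x \<in> ?\<Omega>" using norm_squeeze_le[of x] by (simp add: mem_ellipsoid_squeeze)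
  qed
  moreover have "?\<Omega> \<subseteq> ball 0 a"
  proof
    fix x assume "x \<in> ?\<Omega>"
    then have "a * norm (?A x) < a * 1"
      using a_bounds(4) unfolding mem_ellipsoid_squeeze by (intro mult_strict_left_mono) auto
    then show "x \<in> ball 0 a" using norm_le_squeeze[of x] by simp
  qed
  ultimately show "\<epsilon> \<in> {R2 - R1 |R1 R2. 0 < R1 \<and> (\<exists>x\<in>?\<Omega>. ball x R1 \<subseteq> ?\<Omega> \<and> ?\<Omega> \<subseteq> ball x R2)}"
    by (intro CollectI exI[of _ "1::real"] exI[of _ a]) (auto simp: a_def)
  fix t assume "t \<in> {R2 - R1 |R1 R2. 0 < R1 \<and> (\<exists>x\<in>?\<Omega>. ball x R1 \<subseteq> ?\<Omega> \<and> ?\<Omega> \<subseteq> ball x R2)}"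
  then obtain R1 R2 x where *: "t = R2 - R1" "0 < R1" "x \<in> ?\<Omega>" "ball x R1 \<subseteq> ?\<Omega>" "?\<Omega> \<subseteq> ball x R2"
    by blast
  have "R1 \<le> 1"
  proof (rule ccontr)
    assume R: "\<not> R1 \<le> 1"
    define e :: "real \<times> (real ^ 'm)" where "e = (0, axis undefined 1)"
    have e: "norm e = 1" "?A e = e" by (auto simp: e_def squeeze_def norm_axis_1)
    have "x + e \<in> ball x R1" "x - e \<in> ball x R1" using R e(1) by (auto simp: dist_norm)
    then have "norm (?A (x + e)) < 1" "norm (?A (x - e)) < 1"
      using *(4) mem_ellipsoid_squeeze by blast+
    moreover have "?A (x + e) = ?A x + e" "?A (x - e) = ?A x - e"
      using e(2) by (auto simp: squeeze_def e_def add_divide_distrib)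
    moreover have "norm (2 *\<^sub>R e) \<le> norm (?A x + e) + norm (?A x - e)"
      using norm_triangle_ineq4[of "?A x + e" "?A x - e"] by (simp add: scaleR_2)
    ultimately show False using e(1) by simp
  qed
  moreover have "a \<le> R2"
  proof (rule ccontr)
    assume R: "\<not> a \<le> R2"
    have "x \<in> ball x R2" using * by blast
    then have R0: "0 < R2" by (auto intro: le_less_trans[OF zero_le_dist])
    have "(R2, 0) \<in> ?\<Omega>" "(- R2, 0) \<in> ?\<Omega>"
      using R R0 a_bounds(4) power_strict_mono[of R2 a 2] by (auto simp: mem_ellipsoid)
    then have "dist x (R2, 0) < R2" "dist x (- R2, 0) < R2" using *(5) by auto
    moreover have "dist (R2, 0 :: real ^ 'm) (- R2, 0) = 2 * R2"
      using R0 by (simp add: dist_Pair_Pair dist_real_def real_sqrt_mult)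
    ultimately show False
      using dist_triangle3[of "(R2, 0 :: real ^ 'm)" "(- R2, 0)" x] by simp
  qed
  ultimately show "\<epsilon> \<le> t" using * by (simp add: a_def)
qed

end

section \<open>The Lipschitz seminorm on the inner boundary\<close>

text \<open>Twice the difference is the inner product of \<nu> - \<phi> with r, the sum \<nu> +
  \<phi> reflected in the second factor, and norm r <= 2.\<close>

lemma sphere_fst_squares:
  fixes \<nu> \<phi> :: "real \<times> 'b::real_inner"
  assumes "norm \<nu> = 1" "norm \<phi> = 1"
  shows "\<bar>(fst \<nu>)\<^sup>2 - (fst \<phi>)\<^sup>2\<bar> \<le> norm (\<nu> - \<phi>)"
proof -
  define r where "r = (fst (\<nu> + \<phi>), - snd (\<nu> + \<phi>))"
  have sq: "(fst \<nu>)\<^sup>2 + snd \<nu> \<bullet> snd \<nu> = 1" "(fst \<phi>)\<^sup>2 + snd \<phi> \<bullet> snd \<phi> = 1"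
    using assms norm_prod_def[of \<nu>] norm_prod_def[of \<phi>] by (auto simp: power2_norm_eq_inner)
  have "2 * ((fst \<nu>)\<^sup>2 - (fst \<phi>)\<^sup>2) = (\<nu> - \<phi>) \<bullet> r"
    using sq by (simp add: r_def inner_prod_def inner_diff_left inner_add_right inner_commute
        power2_eq_square algebra_simps)
  then have "\<bar>2 * ((fst \<nu>)\<^sup>2 - (fst \<phi>)\<^sup>2)\<bar> \<le> norm (\<nu> - \<phi>) * norm r"
    using Cauchy_Schwarz_ineq2 by metis
  also have "norm r = norm (\<nu> + \<phi>)" unfolding r_def norm_prod_def fst_conv snd_conv norm_minus_cancel ..
  also have "norm (\<nu> - \<phi>) * norm (\<nu> + \<phi>) \<le> norm (\<nu> - \<phi>) * 2"
    using norm_triangle_ineq[of \<nu> \<phi>] assms by (intro mult_left_mono) auto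
  finally show ?thesis by simp
qed

lemma sphere_fst_squares_sharp:
  fixes r :: real
  assumes "0 < r" "r < 1"
  obtains \<nu> \<phi> :: "real \<times> (real ^ 'm::finite)" where "norm \<nu> = 1" "norm \<phi> = 1" "\<nu> \<noteq> \<phi>"
    "r * norm (\<nu> - \<phi>) \<le> \<bar>(fst \<nu>)\<^sup>2 - (fst \<phi>)\<^sup>2\<bar>"
proof -
  \<comment> \<open>With r = sin (2 \<theta>) one has \<delta> = cos (2 \<theta>), c = cos \<theta>
    and d = sin \<theta>. The points (c, d e) and (d, c e) lie symmetrically about the latitude of
    45 degrees and merge there as r tends to 1.\<close>
  define \<delta> where "\<delta> = sqrt (1 - r\<^sup>2)"
  have r2: "0 < r\<^sup>2" "r\<^sup>2 < 1" using assms by (auto simp: power_less_one_iff abs_square_less_1)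
  then have \<delta>: "0 < \<delta>" "\<delta> < 1" "\<delta>\<^sup>2 = 1 - r\<^sup>2" by (auto simp: \<delta>_def)
  define c where "c = sqrt ((1 + \<delta>) / 2)"
  define d where "d = sqrt ((1 - \<delta>) / 2)"
  have cd: "c\<^sup>2 = (1 + \<delta>) / 2" "d\<^sup>2 = (1 - \<delta>) / 2" "0 < c" "0 < d"
    using \<delta> by (auto simp: c_def d_def)
  have pm: "c\<^sup>2 + d\<^sup>2 = 1" "d\<^sup>2 + c\<^sup>2 = 1" "c\<^sup>2 - d\<^sup>2 = \<delta>"
    unfolding cd(1,2) by (simp_all add: add_divide_distrib diff_divide_distrib)
  have "(2 * c * d)\<^sup>2 = (1 + \<delta>) * (1 - \<delta>)"
    by (simp only: power_mult_distrib cd) (simp add: power2_eq_square)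
  also have "\<dots> = r\<^sup>2" using \<delta>(3) by (simp add: algebra_simps power2_eq_square)
  finally have "2 * c * d = r" using cd assms by (simp add: power2_eq_iff_nonneg)
  then have rr: "r\<^sup>2 \<le> 2 * c * d" using assms by (simp add: power2_eq_square mult_left_le)
  let ?e = "axis undefined 1 :: real ^ 'm"
  have e: "norm ?e = 1" by (rule norm_axis_1)
  define \<nu> where "\<nu> = (c, d *\<^sub>R ?e)"
  define \<phi> where "\<phi> = (d, c *\<^sub>R ?e)"
  have n: "(norm (d - c))\<^sup>2 = (c - d)\<^sup>2"
    unfolding real_norm_def power2_abs by (rule power2_commute)
  have "(norm (\<nu> - \<phi>))\<^sup>2 = (c - d)\<^sup>2 + (norm ((d - c) *\<^sub>R ?e))\<^sup>2"
    by (simp add: \<nu>_def \<phi>_def norm_Pair scaleR_diff_left)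
  also have "norm ((d - c) *\<^sub>R ?e) = norm (d - c)"
    unfolding norm_scaleR e by simp
  also have "(c - d)\<^sup>2 + (norm (d - c))\<^sup>2 = 2 * (c - d)\<^sup>2"
    unfolding n by simp
  finally have nd: "(norm (\<nu> - \<phi>))\<^sup>2 = 2 * (c - d)\<^sup>2" .
  have "r\<^sup>2 * 2 \<le> (c + d)\<^sup>2"
    using rr cd r2 by (simp add: power2_sum)
  then have "(r\<^sup>2 * 2) * (c - d)\<^sup>2 \<le> (c + d)\<^sup>2 * (c - d)\<^sup>2"
    by (rule mult_right_mono) simp
  then have "(r * norm (\<nu> - \<phi>))\<^sup>2 \<le> ((c + d) * (c - d))\<^sup>2"
    unfolding power_mult_distrib nd by (simp only: mult.assoc)
  also have "(c + d) * (c - d) = \<delta>"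
    using pm(3) unfolding power2_eq_square square_diff_square_factored .
  finally have le: "r * norm (\<nu> - \<phi>) \<le> \<delta>"
    by (rule power2_le_imp_le) (use \<delta>(1) in simp)
  show thesis
  proof (rule that[of \<nu> \<phi>])
    have "norm \<nu> = sqrt (c\<^sup>2 + d\<^sup>2)" "norm \<phi> = sqrt (d\<^sup>2 + c\<^sup>2)"
      unfolding \<nu>_def \<phi>_def norm_Pair norm_scaleR e by simp_all
    then show "norm \<nu> = 1" "norm \<phi> = 1"
      unfolding pm by simp_all
    have "c \<noteq> d" using pm(3) \<delta>(1) by auto
    then show "\<nu> \<noteq> \<phi>" by (simp add: \<nu>_def \<phi>_def)
    show "r * norm (\<nu> - \<phi>) \<le> \<bar>(fst \<nu>)\<^sup>2 - (fst \<phi>)\<^sup>2\<bar>"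
    proof -
      have "(fst \<nu>)\<^sup>2 - (fst \<phi>)\<^sup>2 = \<delta>" unfolding \<nu>_def \<phi>_def fst_conv by (rule pm)
      then show ?thesis using le \<delta>(1) by simp
    qed
  qed
qed

section \<open>Distances and values on the inner boundary in terms of normals\<close>

context thin_ellipsoid
begin

text \<open>
  Two boundary points with outer normals \<open>\<nu>\<close> and \<open>\<phi>\<close> differ by a \<open>v\<close> with
  \<open>v \<bullet> (\<phi> - \<nu>) = (stretch \<nu> + stretch \<phi>) \<bar>squeeze v\<bar>\<^sup>2 / 2\<close>, which is \<open>\<bar>v\<bar>\<^sup>2\<close> up to \<open>O(\<epsilon>)\<close>. Hence moving in
  by \<open>1/2\<close> multiplies distances of normals by nearly \<open>1/2\<close>.
\<close>

lemma inner_point_dist: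
  fixes \<nu> \<phi> :: "real \<times> 'b::real_inner"
  assumes n: "norm \<nu> = 1" "norm \<phi> = 1"
  shows "(1/4 - (a - 1) * a ^ 4) * (norm (\<nu> - \<phi>))\<^sup>2 \<le> (dist (inner_point \<nu>) (inner_point \<phi>))\<^sup>2"
    and "(dist (inner_point \<nu>) (inner_point \<phi>))\<^sup>2 \<le> (1/4 + (a\<^sup>2 - 1) * a ^ 2) * (norm (\<nu> - \<phi>))\<^sup>2"
proof -
  \<comment> \<open>\<open>squeeze\<close> maps the boundary to the unit sphere, and pairing with
    \<nu> becomes pairing with \<open>stretch \<nu>\<close> times the squeezed boundary
    point.\<close>
  have on_boundary: "squeeze (boundary_point \<nu>) \<bullet> squeeze (boundary_point \<nu>) = 1"
    and normal: "\<nu> \<bullet> w = stretch \<nu> * (squeeze (boundary_point \<nu>) \<bullet> squeeze w)"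
    if "norm \<nu> = 1" for \<nu> w :: "real \<times> 'b"
  proof -
    have st: "1 \<le> stretch \<nu>" "(stretch \<nu>)\<^sup>2 = 1 + (a\<^sup>2 - 1) * (fst \<nu>)\<^sup>2"
      using stretch_bounds[OF that] by auto
    have a0: "a \<noteq> 0" using a_bounds(4) by simp
    have sq: "squeeze (boundary_point \<nu>) = (a / stretch \<nu> * fst \<nu>, (1 / stretch \<nu>) *\<^sub>R snd \<nu>)"
      using a0 by (simp add: squeeze_def boundary_point_def power2_eq_square)
    have "squeeze (boundary_point \<nu>) \<bullet> squeeze (boundary_point \<nu>)
        = (a\<^sup>2 * (fst \<nu>)\<^sup>2 + (norm (snd \<nu>))\<^sup>2) / (stretch \<nu>)\<^sup>2"
      unfolding power2_norm_eq_inner[symmetric] sq norm_prod_sq fst_conv snd_conv norm_scaleR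
      by (simp add: power_mult_distrib power_divide add_divide_distrib)
    also have "\<dots> = 1"
      using st unfolding unit_norm(1)[OF that] by (simp add: algebra_simps)
    finally show "squeeze (boundary_point \<nu>) \<bullet> squeeze (boundary_point \<nu>) = 1" .
    show "\<nu> \<bullet> w = stretch \<nu> * (squeeze (boundary_point \<nu>) \<bullet> squeeze w)"
      unfolding sq using st(1) a0 by (simp add: squeeze_def inner_prod_def distrib_left)
  qed
  define v where "v = boundary_point \<phi> - boundary_point \<nu>"
  define Q where "Q = (norm (squeeze v))\<^sup>2"
  define D where "D = norm (\<nu> - \<phi>)"
  have sv: "squeeze v = squeeze (boundary_point \<phi>) - squeeze (boundary_point \<nu>)"
    by (simp add: v_def squeeze_def diff_divide_distrib)
  let ?B = "squeeze (boundary_point \<nu>) \<bullet> squeeze (boundary_point \<phi>)"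
  have Q: "Q = 2 - 2 * ?B"
    unfolding Q_def sv power2_norm_eq_inner
    using on_boundary[OF n(1)] on_boundary[OF n(2)] by (simp add: inner_diff_left inner_diff_right inner_commute)
  have \<nu>v: "\<nu> \<bullet> v = stretch \<nu> * (?B - 1)" "\<phi> \<bullet> v = stretch \<phi> * (1 - ?B)"
    unfolding normal[OF n(1)] normal[OF n(2)] sv using on_boundary[OF n(1)] on_boundary[OF n(2)]
    by (simp_all add: inner_diff_right inner_commute)
  have vn: "v \<bullet> (\<phi> - \<nu>) = (stretch \<nu> + stretch \<phi>) * Q / 2"
  proof -
    have B: "?B = 1 - Q / 2" using Q by linarith
    have "\<nu> \<bullet> v = - (stretch \<nu> * Q / 2)" "\<phi> \<bullet> v = stretch \<phi> * Q / 2"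
      unfolding \<nu>v B by auto
    then show ?thesis by (simp add: inner_diff_right inner_commute distrib_right add_divide_distrib)
  qed
  have Q0: "0 \<le> Q" by (simp add: Q_def)
  have Qv: "Q \<le> (norm v)\<^sup>2" "(norm v)\<^sup>2 \<le> a\<^sup>2 * Q"
    using power_mono[OF norm_squeeze_le, of v 2] power_mono[OF norm_le_squeeze, of v 2]
    by (auto simp: Q_def power_mult_distrib)
  have "2 * Q \<le> (stretch \<nu> + stretch \<phi>) * Q" "(stretch \<nu> + stretch \<phi>) * Q \<le> (2 * a) * Q"
    using stretch_bounds[OF n(1)] stretch_bounds[OF n(2)] Q0 by (auto intro!: mult_right_mono)
  then have vQ: "Q \<le> v \<bullet> (\<phi> - \<nu>)" "v \<bullet> (\<phi> - \<nu>) \<le> a * Q"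
    unfolding vn by auto
  have "a * Q \<le> a * (norm v)\<^sup>2" using Qv(1) a_bounds(4) by simp
  then have up: "v \<bullet> (\<phi> - \<nu>) \<le> a * (norm v)\<^sup>2" using vQ(2) by linarith
  have "v \<bullet> (\<phi> - \<nu>) \<le> norm v * D"
    using norm_cauchy_schwarz[of v "\<phi> - \<nu>"] by (simp add: D_def norm_minus_commute)
  then have "a\<^sup>2 * Q \<le> a\<^sup>2 * (norm v * D)"
    using vQ(1) a_bounds(4) by (intro mult_left_mono) auto
  then have "norm v * norm v \<le> norm v * (a\<^sup>2 * D)"
    using Qv(2) by (simp add: power2_eq_square mult_ac)
  then have "norm v \<le> a\<^sup>2 * D"
    by (cases "norm v = 0") (auto simp: D_def)
  then have vD: "(norm v)\<^sup>2 \<le> a ^ 4 * D\<^sup>2"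
    using power_mono[of "norm v" "a\<^sup>2 * D" 2] by (simp add: power_mult_distrib)
  have "inner_point \<phi> - inner_point \<nu> = v - (1/2) *\<^sub>R (\<phi> - \<nu>)"
    by (simp add: inner_point_def v_def scaleR_diff_right)
  then have "(dist (inner_point \<nu>) (inner_point \<phi>))\<^sup>2 = (norm (v - (1/2) *\<^sub>R (\<phi> - \<nu>)))\<^sup>2"
    by (metis dist_commute dist_norm)
  \<comment> \<open>The first two terms nearly cancel: v . (\<phi> - \<nu>) lies between |v|^2 / a^2
    and a |v|^2, and |v| is at most a^2 D.\<close>
  also have "\<dots> = (norm v)\<^sup>2 - v \<bullet> (\<phi> - \<nu>) + D\<^sup>2 / 4"
  proof -
    have "(norm (v - (1/2) *\<^sub>R e))\<^sup>2 = (norm v)\<^sup>2 - v \<bullet> e + (norm e)\<^sup>2 / 4" for e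
      unfolding power2_norm_eq_inner by (simp add: inner_diff_left inner_diff_right inner_commute)
    then show ?thesis unfolding D_def norm_minus_commute[of \<nu> \<phi>] .
  qed
  finally have dist: "(dist (inner_point \<nu>) (inner_point \<phi>))\<^sup>2 = (norm v)\<^sup>2 - v \<bullet> (\<phi> - \<nu>) + D\<^sup>2 / 4" .
  have "(a - 1) * (norm v)\<^sup>2 \<le> (a - 1) * (a ^ 4 * D\<^sup>2)"
    using vD a_bounds(1) by (intro mult_left_mono) auto
  then show "(1/4 - (a - 1) * a ^ 4) * (norm (\<nu> - \<phi>))\<^sup>2 \<le> (dist (inner_point \<nu>) (inner_point \<phi>))\<^sup>2"
    using up unfolding dist D_def[symmetric] by (simp add: algebra_simps)
  have "a\<^sup>2 * ((norm v)\<^sup>2 - v \<bullet> (\<phi> - \<nu>)) \<le> a\<^sup>2 * (norm v)\<^sup>2 - (norm v)\<^sup>2"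
    using Qv(2) mult_left_mono[OF vQ(1), of "a\<^sup>2"] by (simp add: right_diff_distrib)
  also have "\<dots> = (a\<^sup>2 - 1) * (norm v)\<^sup>2" by (simp add: algebra_simps)
  also have "\<dots> \<le> (a\<^sup>2 - 1) * (a ^ 4 * D\<^sup>2)"
    using vD a_bounds(3) by (intro mult_left_mono) auto
  also have "\<dots> = a\<^sup>2 * ((a\<^sup>2 - 1) * a ^ 2 * D\<^sup>2)"
    by (simp add: power2_eq_square power4_eq_xxxx)
  finally have "(norm v)\<^sup>2 - v \<bullet> (\<phi> - \<nu>) \<le> (a\<^sup>2 - 1) * a ^ 2 * D\<^sup>2"
    using a_bounds(4) by (subst (asm) mult_le_cancel_left_pos) auto
  then show "(dist (inner_point \<nu>) (inner_point \<phi>))\<^sup>2 \<le> (1/4 + (a\<^sup>2 - 1) * a ^ 2) * (norm (\<nu> - \<phi>))\<^sup>2"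
    unfolding dist D_def[symmetric] by (simp add: algebra_simps)
qed

text \<open>The value of 1 - |squeeze x|^2 at the inner boundary point whose normal has squared
  first component m; for a = 1 the formula gives 3/4.\<close>

definition depth :: "real \<Rightarrow> real" where
  "depth m = 1 / sqrt (1 + (a\<^sup>2 - 1) * m) - 1/4 + (1 - 1 / a\<^sup>2) * m / 4"

lemma depth_inner_point:
  fixes \<nu> :: "real \<times> 'b::real_normed_vector"
  assumes "norm \<nu> = 1"
  shows "1 - (norm (squeeze (inner_point \<nu>)))\<^sup>2 = depth ((fst \<nu>)\<^sup>2)"
proof -
  define i where "i = 1 / stretch \<nu>"
  define m where "m = (fst \<nu>)\<^sup>2"
  define j where "j = 1 / a"
  have aj: "a * j = 1" using a_bounds(4) by (simp add: j_def)
  have st: "1 \<le> stretch \<nu>" "(stretch \<nu>)\<^sup>2 = 1 + (a\<^sup>2 - 1) * m"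
    using stretch_bounds[OF assms] by (auto simp: m_def)
  have i: "i\<^sup>2 * (1 + (a\<^sup>2 - 1) * m) = 1"
    unfolding st(2)[symmetric] using st(1) by (simp add: i_def power_divide)
  have f: "fst (squeeze (inner_point \<nu>)) = (a\<^sup>2 * i - 1/2) * j * fst \<nu>"
    by (simp add: squeeze_def inner_point_def boundary_point_def i_def j_def left_diff_distrib diff_divide_distrib)
  have s: "snd (squeeze (inner_point \<nu>)) = (i - 1/2) *\<^sub>R snd \<nu>"
    by (simp add: squeeze_def inner_point_def boundary_point_def i_def scaleR_diff_left)
  have "(norm (squeeze (inner_point \<nu>)))\<^sup>2 = (a\<^sup>2 * i - 1/2)\<^sup>2 * j\<^sup>2 * m + (i - 1/2)\<^sup>2 * (1 - m)"
    unfolding norm_prod_sq[of "squeeze (inner_point \<nu>)"] f s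
    by (simp add: power_mult_distrib unit_norm(1)[OF assms] m_def)
  also have "(a\<^sup>2 * i - 1/2)\<^sup>2 * j\<^sup>2 = (a * i - j / 2)\<^sup>2"
  proof -
    have "(a\<^sup>2 * i - 1/2) * j = a * i * (a * j) - j / 2"
      by (simp add: power2_eq_square algebra_simps)
    then show ?thesis by (simp add: aj flip: power_mult_distrib)
  qed
  also have "(a * i - j / 2)\<^sup>2 = a\<^sup>2 * i\<^sup>2 - i * (a * j) + j\<^sup>2 / 4"
    by (simp add: power2_eq_square algebra_simps)
  also have "(a\<^sup>2 * i\<^sup>2 - i * (a * j) + j\<^sup>2 / 4) * m + (i - 1/2)\<^sup>2 * (1 - m)
      = i\<^sup>2 * (1 + (a\<^sup>2 - 1) * m) - i + 1/4 - (1 - j\<^sup>2) * m / 4"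
    unfolding aj by (simp add: power2_eq_square field_simps)
  finally have "1 - (norm (squeeze (inner_point \<nu>)))\<^sup>2 = i - 1/4 + (1 - j\<^sup>2) * m / 4"
    unfolding i by simp
  moreover have "j\<^sup>2 = 1 / a\<^sup>2" by (simp add: j_def power_divide)
  ultimately show ?thesis
    by (simp add: depth_def i_def m_def stretch_def)
qed

lemma depth_deriv:
  assumes "0 \<le> m"
  shows "(depth has_field_derivative - (a\<^sup>2 - 1) / (2 * sqrt (1 + (a\<^sup>2 - 1) * m) ^ 3) + (1 - 1 / a\<^sup>2) / 4) (at m)"
proof -
  define r where "r = 1 + (a\<^sup>2 - 1) * m"
  have r: "r > 0" using assms a_bounds(3) by (auto simp: r_def intro: add_pos_nonneg)
  have d1: "((\<lambda>m. 1 + (a\<^sup>2 - 1) * m) has_field_derivative (a\<^sup>2 - 1)) (at m)"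
    by (auto intro!: derivative_eq_intros)
  have "((\<lambda>m. sqrt (1 + (a\<^sup>2 - 1) * m)) has_field_derivative inverse (sqrt r) / 2 * (a\<^sup>2 - 1)) (at m)"
    unfolding r_def by (rule DERIV_chain2[OF DERIV_real_sqrt d1]) (use r r_def in auto)
  then have "((\<lambda>m. inverse (sqrt (1 + (a\<^sup>2 - 1) * m))) has_field_derivative
      - (inverse (sqrt r) * (inverse (sqrt r) / 2 * (a\<^sup>2 - 1)) * inverse (sqrt r))) (at m)"
    unfolding r_def by (rule DERIV_inverse') (use r r_def in auto)
  moreover have "((\<lambda>m. (1 - 1 / a\<^sup>2) * m / 4) has_field_derivative (1 - 1 / a\<^sup>2) / 4) (at m)"
    by (auto intro!: derivative_eq_intros)
  ultimately have "((\<lambda>m. inverse (sqrt (1 + (a\<^sup>2 - 1) * m)) - 1/4 + (1 - 1 / a\<^sup>2) * m / 4) has_field_derivative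
      (- (inverse (sqrt r) * (inverse (sqrt r) / 2 * (a\<^sup>2 - 1)) * inverse (sqrt r)) - 0) + (1 - 1 / a\<^sup>2) / 4) (at m)"
    by (intro DERIV_add DERIV_diff DERIV_const)
  moreover have "- (inverse (sqrt r) * (inverse (sqrt r) / 2 * (a\<^sup>2 - 1)) * inverse (sqrt r)) - 0
      = - (a\<^sup>2 - 1) / (2 * sqrt r ^ 3)"
  proof -
    have cube: "- (inverse x * (inverse x / 2 * c) * inverse x) - 0 = - c / (2 * x ^ 3)" if "0 < x" for x c :: real
      using that by (simp add: field_simps power3_eq_cube)
    show ?thesis by (rule cube) (use r in simp)
  qed
  ultimately have "((\<lambda>m. inverse (sqrt (1 + (a\<^sup>2 - 1) * m)) - 1/4 + (1 - 1 / a\<^sup>2) * m / 4) has_field_derivative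
      - (a\<^sup>2 - 1) / (2 * sqrt r ^ 3) + (1 - 1 / a\<^sup>2) / 4) (at m)"
    by (simp only:)
  then show ?thesis
    unfolding depth_def[abs_def] by (simp add: inverse_eq_divide r_def)
qed

lemma depth_bounds:
  assumes t: "0 \<le> t" "t \<le> 1"
  shows "1 \<le> sqrt (1 + (a\<^sup>2 - 1) * t)" "sqrt (1 + (a\<^sup>2 - 1) * t) \<le> a"
    "1 / a - 1/4 \<le> depth t" "depth t \<le> 3/4 + (1 - 1 / a\<^sup>2) / 4"
proof -
  have a1: "1 - 1 / a\<^sup>2 \<ge> 0" using a_bounds(3) by (auto simp: divide_le_eq_1)
  have "(a\<^sup>2 - 1) * t \<le> (a\<^sup>2 - 1) * 1" "0 \<le> (a\<^sup>2 - 1) * t"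
    using t a_bounds(3) by (auto intro!: mult_left_mono)
  then show r: "1 \<le> sqrt (1 + (a\<^sup>2 - 1) * t)" "sqrt (1 + (a\<^sup>2 - 1) * t) \<le> a"
    using a_bounds(4) by (auto intro: real_le_lsqrt)
  have "1 / a \<le> 1 / x" "1 / x \<le> 1" if "1 \<le> x" "x \<le> a" for x
    using that by (auto intro!: divide_left_mono mult_pos_pos simp: divide_le_eq_1)
  from this[OF r] have "1 / a \<le> 1 / sqrt (1 + (a\<^sup>2 - 1) * t)" "1 / sqrt (1 + (a\<^sup>2 - 1) * t) \<le> 1" .
  moreover have "0 \<le> (1 - 1 / a\<^sup>2) * t" "(1 - 1 / a\<^sup>2) * t \<le> (1 - 1 / a\<^sup>2) * 1"
    using a1 t by (auto intro!: mult_left_mono simp del: mult_1_right)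
  moreover have "i - 1/4 \<le> x - 1/4 + y / 4 \<and> x - 1/4 + y / 4 \<le> 3/4 + z / 4"
    if "i \<le> x" "x \<le> 1" "0 \<le> y" "y \<le> z * 1" for i x y z :: real
    using that by auto
  ultimately show "1 / a - 1/4 \<le> depth t" "depth t \<le> 3/4 + (1 - 1 / a\<^sup>2) / 4"
    unfolding depth_def by blast+
qed

lemma depth_pos: "0 \<le> t \<Longrightarrow> t \<le> 1 \<Longrightarrow> 0 < depth t"
  and inverse_a_gt: "0 < 1 / a - 1/4"
proof -
  show lo: "0 < 1 / a - 1/4" using a_bounds(1,2) by (simp add: field_simps)
  show "0 < depth t" if "0 \<le> t" "t \<le> 1" using depth_bounds(3)[OF that] lo by linarith
qed

text \<open>A lower bound on [0, 1] for minus the derivative of depth^s: since s - 1 < 0, an upper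
  bound of the depth enters the power, and the largest root, a, enters the cube. Divided by
  \<epsilon>, both this and \<open>max_slope\<close> tend to s (3/4)^(s - 1) / 2.\<close>

definition min_slope :: "real \<Rightarrow> real" where
  "min_slope s = s * (3/4 + (1 - 1 / a\<^sup>2) / 4) powr (s - 1) * ((a\<^sup>2 - 1) / (2 * a ^ 3) - (1 - 1 / a\<^sup>2) / 4)"

definition max_slope :: "real \<Rightarrow> real" where
  "max_slope s = s * (1 / a - 1/4) powr (s - 1) * ((a\<^sup>2 - 1) / 2 - (1 - 1 / a\<^sup>2) / 4)"

lemma min_slope_factor: "(a\<^sup>2 - 1) / (2 * a ^ 3) - (1 - 1 / a\<^sup>2) / 4 = (a\<^sup>2 - 1) * (2 - a) / (4 * a ^ 3)"
  using a_bounds(4) by (simp add: field_simps power2_eq_square power3_eq_cube)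

lemma max_slope_factor: "(a\<^sup>2 - 1) / 2 - (1 - 1 / a\<^sup>2) / 4 = (a\<^sup>2 - 1) * (2 * a\<^sup>2 - 1) / (4 * a\<^sup>2)"
  using a_bounds(4) by (simp add: field_simps)

lemma slope_nonneg: "0 < s \<Longrightarrow> 0 \<le> min_slope s" "0 < s \<Longrightarrow> 0 \<le> max_slope s"
  unfolding min_slope_def max_slope_def min_slope_factor max_slope_factor
  using a_bounds by (auto intro!: mult_nonneg_nonneg divide_nonneg_nonneg)

lemma depth_powr_difference:
  assumes s: "0 < s" "s < 1" and m: "0 \<le> m" "m < m'" "m' \<le> 1"
  shows "min_slope s * (m' - m) \<le> depth m powr s - depth m' powr s"
    and "depth m powr s - depth m' powr s \<le> max_slope s * (m' - m)"
proof -
  let ?r = "\<lambda>m. sqrt (1 + (a\<^sup>2 - 1) * m)"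
  let ?d = "\<lambda>m. (a\<^sup>2 - 1) / (2 * ?r m ^ 3) - (1 - 1 / a\<^sup>2) / 4"
  note bounds = depth_bounds and lo = inverse_a_gt
  have d: "(a\<^sup>2 - 1) / (2 * a ^ 3) - (1 - 1 / a\<^sup>2) / 4 \<le> ?d t" "?d t \<le> (a\<^sup>2 - 1) / 2 - (1 - 1 / a\<^sup>2) / 4"
    if t: "0 \<le> t" "t \<le> 1" for t
  proof -
    note b = bounds[OF t]
    have p: "1 \<le> ?r t ^ 3" "?r t ^ 3 \<le> a ^ 3"
      using b(1,2) by (auto intro!: power_mono one_le_power)
    have l: "(a\<^sup>2 - 1) / (2 * a ^ 3) \<le> (a\<^sup>2 - 1) / (2 * x)" if "1 \<le> x" "x \<le> a ^ 3" for x
      by (rule divide_left_mono) (use that a_bounds(3,4) in auto)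
    have u: "(a\<^sup>2 - 1) / (2 * x) \<le> (a\<^sup>2 - 1) / (2 * 1)" if "1 \<le> x" for x
      by (rule divide_left_mono) (use that a_bounds(3) in auto)
    from l[OF p] u[OF p(1)] show "(a\<^sup>2 - 1) / (2 * a ^ 3) - (1 - 1 / a\<^sup>2) / 4 \<le> ?d t" "?d t \<le> (a\<^sup>2 - 1) / 2 - (1 - 1 / a\<^sup>2) / 4"
      by auto
  qed
  have "\<exists>z>m. z < m' \<and> depth m' powr s - depth m powr s = (m' - m) * (s * depth z powr (s - 1) * - ?d z)"
  proof (rule MVT2[OF m(2)])
    fix t assume t: "m \<le> t" "t \<le> m'"
    then have "0 \<le> t" "t \<le> 1" using m by auto
    then have "depth t > 0" using bounds(3)[of t] lo by linarith
    have "((\<lambda>t. depth t powr s) has_field_derivative (s * depth t powr (s - 1)) * (- (a\<^sup>2 - 1) / (2 * ?r t ^ 3) + (1 - 1 / a\<^sup>2) / 4)) (at t)"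
      by (rule DERIV_chain2[OF has_real_derivative_powr depth_deriv]) fact+
    moreover have "- (a\<^sup>2 - 1) / (2 * ?r t ^ 3) + (1 - 1 / a\<^sup>2) / 4 = - ?d t"
      unfolding minus_divide_left[symmetric] by simp
    ultimately show "((\<lambda>t. depth t powr s) has_field_derivative s * depth t powr (s - 1) * - ?d t) (at t)"
      by (simp only:)
  qed
  then obtain z where z: "m < z" "z < m'" "depth m' powr s - depth m powr s = (m' - m) * (s * depth z powr (s - 1) * - ?d z)"
    by auto
  have eq: "depth m' powr s - depth m powr s = - ((m' - m) * (s * depth z powr (s - 1) * ?d z))"
    unfolding z(3) mult_minus_right ..
  have z01: "0 \<le> z" "z \<le> 1" using z m by auto
  note b = bounds[OF z01]
  have P: "(3/4 + (1 - 1 / a\<^sup>2) / 4) powr (s - 1) \<le> depth z powr (s - 1)"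
    "depth z powr (s - 1) \<le> (1 / a - 1/4) powr (s - 1)"
    using b lo s by (auto intro!: powr_mono2')
  have ds: "0 \<le> (a\<^sup>2 - 1) / (2 * a ^ 3) - (1 - 1 / a\<^sup>2) / 4"
    unfolding min_slope_factor using a_bounds by (intro divide_nonneg_nonneg mult_nonneg_nonneg) auto
  have "min_slope s \<le> s * depth z powr (s - 1) * ?d z"
    unfolding min_slope_def
    by (rule mult_mono[OF mult_left_mono[OF P(1)] d(1)[OF z01] _ ds]) (use s in auto)
  moreover have "s * depth z powr (s - 1) * ?d z \<le> max_slope s"
    unfolding max_slope_def
    by (rule mult_mono[OF mult_left_mono[OF P(2)] d(2)[OF z01] _ order_trans[OF ds d(1)[OF z01]]]) (use s in auto)
  moreover have "depth m powr s - depth m' powr s = (s * depth z powr (s - 1) * ?d z) * (m' - m)"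
    using eq by (simp add: mult.commute)
  ultimately show "min_slope s * (m' - m) \<le> depth m powr s - depth m' powr s"
    "depth m powr s - depth m' powr s \<le> max_slope s * (m' - m)"
    using m(2) by (simp_all add: mult_right_mono)
qed

lemma profile_inner_point:
  assumes "norm \<nu> = 1"
  shows "profile s squeeze (inner_point \<nu>) = depth ((fst \<nu>)\<^sup>2) powr s"
  unfolding profile_def depth_inner_point[OF assms] pos_pow_def
  using depth_pos[of "(fst \<nu>)\<^sup>2"] unit_norm(2)[OF assms] by simp

lemma depth_powr_bounds:
  assumes s: "0 < s" "s < 1" and m: "0 \<le> m" "m \<le> 1" "0 \<le> m'" "m' \<le> 1"
  shows "\<bar>depth m powr s - depth m' powr s\<bar> \<le> max_slope s * \<bar>m - m'\<bar>" (is "?l \<le> _")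
    and "min_slope s * \<bar>m - m'\<bar> \<le> \<bar>depth m powr s - depth m' powr s\<bar>"
proof -
  have "\<bar>depth m powr s - depth m' powr s\<bar> \<le> max_slope s * \<bar>m - m'\<bar> \<and>
      min_slope s * \<bar>m - m'\<bar> \<le> \<bar>depth m powr s - depth m' powr s\<bar>"
    if m: "0 \<le> m" "m < m'" "m' \<le> 1" for m m'
  proof -
    have "0 \<le> min_slope s * (m' - m)" using slope_nonneg(1)[OF s(1)] m by simp
    moreover have e: "\<bar>m - m'\<bar> = m' - m" using m by simp
    ultimately show ?thesis
      using depth_powr_difference[OF s m] unfolding e by linarith
  qed
  from this[of m m'] this[of m' m] m
  show "?l \<le> max_slope s * \<bar>m - m'\<bar>" "min_slope s * \<bar>m - m'\<bar> \<le> ?l"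
    by (cases m m' rule: linorder_cases; simp add: abs_minus_commute)+
qed

section \<open>Two-sided bounds for the seminorm and their limit\<close>

lemma lipschitz_upper:
  fixes x y :: "real \<times> (real ^ 'm::finite)"
  assumes s: "0 < s" "s < 1" and small: "(a - 1) * a ^ 4 < 1/4" and K: "0 \<le> K"
    and "x \<in> frontier inner_set" "y \<in> frontier inner_set"
  shows "\<bar>K * profile s squeeze x - K * profile s squeeze y\<bar>
    \<le> K * max_slope s
      / sqrt (1/4 - (a - 1) * a ^ 4) * dist x y"
proof -
  obtain \<nu> \<phi> where n: "norm \<nu> = 1" "norm \<phi> = 1" and xy: "x = inner_point \<nu>" "y = inner_point \<phi>"
    using assms(5,6) unfolding frontier_inner_set_eq_image by auto
  let ?c = "max_slope s"
  define q where "q = sqrt (1/4 - (a - 1) * a ^ 4)"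
  have q: "0 < q" "q\<^sup>2 = 1/4 - (a - 1) * a ^ 4" using small by (auto simp: q_def)
  have c: "0 \<le> ?c" using slope_nonneg s by simp
  have "(q * norm (\<nu> - \<phi>))\<^sup>2 \<le> (dist x y)\<^sup>2"
    using inner_point_dist(1)[OF n] by (simp add: power_mult_distrib q xy)
  then have "q * norm (\<nu> - \<phi>) \<le> dist x y"
    by (rule power2_le_imp_le) simp
  then have D: "norm (\<nu> - \<phi>) \<le> dist x y / q"
    using q(1) by (simp add: pos_le_divide_eq mult.commute)
  have "\<bar>profile s squeeze x - profile s squeeze y\<bar> \<le> ?c * \<bar>(fst \<nu>)\<^sup>2 - (fst \<phi>)\<^sup>2\<bar>"
    unfolding xy profile_inner_point[OF n(1)] profile_inner_point[OF n(2)]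
    using unit_norm(2)[OF n(1)] unit_norm(2)[OF n(2)] by (intro depth_powr_bounds s) auto
  also have "\<dots> \<le> ?c * (dist x y / q)"
    using order_trans[OF sphere_fst_squares[OF n] D] c by (rule mult_left_mono)
  finally have "K * \<bar>profile s squeeze x - profile s squeeze y\<bar> \<le> K * (?c * (dist x y / q))"
    using K by (rule mult_left_mono)
  then show ?thesis
    using K unfolding q_def[symmetric] by (simp add: right_diff_distrib[symmetric] abs_mult)
qed

text \<open>The sharp constant on the sphere is only approached, so a factor r < 1 is given away. A
  nearly extremal pair of normals is carried over to the inner boundary, and \<open>small\<close>
  keeps the two image points distinct.\<close>

lemma lipschitz_lower:
  assumes s: "0 < s" "s < 1" and small: "(a - 1) * a ^ 4 < 1/4" and K: "0 \<le> K" and r: "0 < r" "r < 1"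
  obtains x y :: "real \<times> (real ^ 'm::finite)" where "x \<in> frontier inner_set" "y \<in> frontier inner_set" "x \<noteq> y"
    "r * (K * min_slope s
      / sqrt (1/4 + (a\<^sup>2 - 1) * a\<^sup>2)) * dist x y \<le> \<bar>K * profile s squeeze x - K * profile s squeeze y\<bar>"
proof -
  obtain \<nu> \<phi> :: "real \<times> (real ^ 'm)" where n: "norm \<nu> = 1" "norm \<phi> = 1" "\<nu> \<noteq> \<phi>"
    "r * norm (\<nu> - \<phi>) \<le> \<bar>(fst \<nu>)\<^sup>2 - (fst \<phi>)\<^sup>2\<bar>"
    by (rule sphere_fst_squares_sharp[OF r])
  let ?c = "min_slope s"
  define x y where "x = inner_point \<nu>" and "y = inner_point \<phi>"
  have pos: "0 < (a\<^sup>2 - 1) * a\<^sup>2" using a_bounds(3,4) by simp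
  define q where "q = sqrt (1/4 + (a\<^sup>2 - 1) * a\<^sup>2)"
  have q: "0 < q" "q\<^sup>2 = 1/4 + (a\<^sup>2 - 1) * a\<^sup>2"
    using pos by (auto simp: q_def)
  have c: "0 \<le> ?c" using slope_nonneg s by simp
  have "(dist x y)\<^sup>2 \<le> (q * norm (\<nu> - \<phi>))\<^sup>2"
    using inner_point_dist(2)[OF n(1,2)] by (simp add: power_mult_distrib q x_def y_def)
  then have "dist x y \<le> q * norm (\<nu> - \<phi>)"
    by (rule power2_le_imp_le) (use q in simp)
  then have "r * (dist x y / q) \<le> r * norm (\<nu> - \<phi>)"
    using q(1) r by (intro mult_left_mono) (auto simp: pos_divide_le_eq mult.commute)
  then have "?c * (r * (dist x y / q)) \<le> ?c * \<bar>(fst \<nu>)\<^sup>2 - (fst \<phi>)\<^sup>2\<bar>"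
    using n(4) c by (intro mult_left_mono) auto
  also have "\<dots> \<le> \<bar>profile s squeeze x - profile s squeeze y\<bar>"
    unfolding x_def y_def profile_inner_point[OF n(1)] profile_inner_point[OF n(2)]
    using unit_norm(2)[OF n(1)] unit_norm(2)[OF n(2)] by (intro depth_powr_bounds s) auto
  finally have "K * (?c * (r * (dist x y / q))) \<le> K * \<bar>profile s squeeze x - profile s squeeze y\<bar>"
    using K by (rule mult_left_mono)
  also have "\<dots> = \<bar>K * profile s squeeze x - K * profile s squeeze y\<bar>"
    using K by (simp add: right_diff_distrib[symmetric] abs_mult)
  also have "K * (?c * (r * (dist x y / q))) = r * (K * ?c / q) * dist x y"
    by simp
  finally have le: "r * (K * ?c / q) * dist x y \<le> \<bar>K * profile s squeeze x - K * profile s squeeze y\<bar>" .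
  have "0 < (1/4 - (a - 1) * a ^ 4) * (norm (\<nu> - \<phi>))\<^sup>2"
    using small n(3) by (intro mult_pos_pos) auto
  then have "0 < (dist x y)\<^sup>2"
    using inner_point_dist(1)[OF n(1,2)] unfolding x_def y_def by linarith
  then have "x \<noteq> y" by auto
  moreover have "x \<in> frontier inner_set" "y \<in> frontier inner_set"
    unfolding frontier_inner_set_eq_image x_def y_def using n by auto
  ultimately show thesis
    using le unfolding q_def by (intro that)
qed

lemma lip_seminorm_bounds:
  assumes s: "0 < s" "s < 1" and small: "(a - 1) * a ^ 4 < 1/4" and K: "0 \<le> K"
  defines "S \<equiv> frontier (inner_set :: (real \<times> (real ^ 'm::finite)) set)"
  shows "lip_seminorm S (\<lambda>x. K * profile s squeeze x)
      \<le> ereal (K * max_slope s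
        / sqrt (1/4 - (a - 1) * a ^ 4))"
    and "ereal (K * min_slope s
        / sqrt (1/4 + (a\<^sup>2 - 1) * a\<^sup>2)) \<le> lip_seminorm S (\<lambda>x. K * profile s squeeze x)"
proof -
  let ?u = "\<lambda>x :: real \<times> (real ^ 'm). K * profile s squeeze x"
  show "lip_seminorm S ?u \<le> ereal (K * max_slope s
        / sqrt (1/4 - (a - 1) * a ^ 4))"
    unfolding lip_seminorm_def S_def
  proof (rule SUP_least)
    fix p assume "p \<in> {(x, y). x \<in> frontier (inner_set :: (real \<times> (real ^ 'm)) set) \<and> y \<in> frontier inner_set \<and> x \<noteq> y}"
    then obtain x y where p: "p = (x, y)" and xy: "x \<in> frontier (inner_set :: (real \<times> (real ^ 'm)) set)" "y \<in> frontier inner_set" "x \<noteq> y"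
      by auto
    have "\<bar>?u x - ?u y\<bar> / dist x y \<le> K * max_slope s
          / sqrt (1/4 - (a - 1) * a ^ 4)"
      using lipschitz_upper[OF s small K xy(1,2)] xy(3) by (subst pos_divide_le_eq) auto
    then show "(case p of (x, y) \<Rightarrow> ereal (\<bar>?u x - ?u y\<bar> / dist x y))
        \<le> ereal (K * max_slope s
          / sqrt (1/4 - (a - 1) * a ^ 4))"
      by (simp add: p)
  qed
  let ?L = "K * min_slope s
        / sqrt (1/4 + (a\<^sup>2 - 1) * a\<^sup>2)"
  have r: "ereal (r * ?L) \<le> lip_seminorm S ?u" if r: "0 < r" "r < 1" for r
  proof -
    obtain x y :: "real \<times> (real ^ 'm)" where xy: "x \<in> frontier inner_set" "y \<in> frontier inner_set" "x \<noteq> y"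
      "r * ?L * dist x y \<le> \<bar>?u x - ?u y\<bar>"
      by (rule lipschitz_lower[OF s small K r])
    then have "r * ?L \<le> \<bar>?u x - ?u y\<bar> / dist x y"
      by (subst pos_le_divide_eq) auto
    then show ?thesis
      unfolding lip_seminorm_def S_def using xy
      by (intro SUP_upper2[of "(x, y)"]) auto
  qed
  have "((\<lambda>r. ereal (r * ?L)) \<longlongrightarrow> ereal (1 * ?L)) (at_left (1::real))"
    by (intro tendsto_intros)
  moreover have "\<forall>\<^sub>F r in at_left (1::real). r \<in> {0<..<1}"
    by (rule eventually_at_left_real) simp
  then have "\<forall>\<^sub>F r in at_left (1::real). ereal (r * ?L) \<le> lip_seminorm S ?u"
    by (rule eventually_mono) (use r in auto)
  ultimately show "ereal ?L \<le> lip_seminorm S ?u"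
    using tendsto_upperbound[of "\<lambda>r. ereal (r * ?L)" _ "at_left (1::real)"] by simp
qed

end

text \<open>Uniqueness replaces u by the explicit solution. Both slopes carry the factor a^2 - 1 =
  \<epsilon> (2 + \<epsilon>), whose \<epsilon> cancels against \<open>rho\<close>; the remaining
  bounds are continuous at \<epsilon> = 0.\<close>

lemma lip_quotient_bounds:
  fixes \<epsilon> s :: real and u :: "real \<times> (real ^ 'm::finite) \<Rightarrow> real"
  assumes s: "0 < s" "s < 1" and small_eps: "0 < \<epsilon>" "\<epsilon> < 1/8" and u: "torsion_solution s (ellipsoid \<epsilon>) u"
  defines "\<gamma> \<equiv> torsion_const DIM(real \<times> (real ^ 'm)) s" and "a \<equiv> 1 + \<epsilon>"
    and "Q \<equiv> lip_seminorm (frontier (thin_ellipsoid.inner_set \<epsilon>)) u / ereal (rho (ellipsoid \<epsilon> :: (real \<times> (real ^ 'm)) set))"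
  shows "ereal (\<gamma> * (s * (3/4 + (1 - 1 / a\<^sup>2) / 4) powr (s - 1) * ((2 + \<epsilon>) / (2 * a ^ 3) - (2 + \<epsilon>) / (4 * a\<^sup>2)))
        / sqrt (1/4 + (a\<^sup>2 - 1) * a\<^sup>2)) \<le> Q"
    and "Q \<le> ereal (a powr (2 * s) * \<gamma> * (s * (1 / a - 1/4) powr (s - 1) * ((2 + \<epsilon>) / 2 - (2 + \<epsilon>) / (4 * a\<^sup>2)))
        / sqrt (1/4 - \<epsilon> * a ^ 4))"
proof -
  interpret thin_ellipsoid \<epsilon> a using small_eps by unfold_locales (auto simp: a_def)
  obtain K where K: "\<gamma> \<le> K" "K \<le> a powr (2 * s) * \<gamma>"
    "torsion_solution s (ellipsoid \<epsilon> :: (real \<times> (real ^ 'm)) set) (\<lambda>x. K * profile s squeeze x)"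
    unfolding \<gamma>_def by (rule torsion_solution_ellipsoid[OF s])
  have ueq: "u = (\<lambda>x. K * profile s squeeze x)"
    by (rule torsion_solution_unique[OF s bounded_ellipsoid u K(3)])
  have \<gamma>: "\<gamma> > 0"
    unfolding \<gamma>_def torsion_const_def using s
    by (intro divide_pos_pos mult_pos_pos Gamma_real_pos) (auto intro: add_pos_pos)
  have K0: "0 \<le> K" using K(1) \<gamma> by simp
  \<comment> \<open>For \<epsilon> < 1/8 this product is at most (1/8) (9/8)^4, about 0.2, so the
    root in the upper bound is that of a positive number; near \<epsilon> = 1/4 it would not
    be.\<close>
  have "\<epsilon> * a ^ 4 \<le> 1/8 * (9/8) ^ 4"
    using small_eps by (intro mult_mono power_mono) (auto simp: a_def)
  then have small: "(a - 1) * a ^ 4 < 1/4" by (simp add: a_def power4_eq_xxxx)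
  have e1: "a - 1 = \<epsilon>" by (simp add: a_def)
  have e2: "a\<^sup>2 - 1 = \<epsilon> * (2 + \<epsilon>)" by (simp add: a_def power2_eq_square algebra_simps)
  have e3: "1 - 1 / a\<^sup>2 = \<epsilon> * ((2 + \<epsilon>) / a\<^sup>2)"
  proof -
    have "1 - 1 / a\<^sup>2 = (a\<^sup>2 - 1) / a\<^sup>2" using a_bounds(4) by (simp add: diff_divide_distrib)
    then show ?thesis unfolding e2 by simp
  qed
  have Q: "Q = lip_seminorm (frontier (inner_set :: (real \<times> (real ^ 'm)) set)) (\<lambda>x. K * profile s squeeze x) / ereal \<epsilon>"
    unfolding Q_def rho_ellipsoid ueq ..
  note lip = lip_seminorm_bounds[OF s small K0, where 'm='m, unfolded min_slope_def max_slope_def]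
  have div: "ereal (\<epsilon> * x) / ereal \<epsilon> = ereal x" for x using small_eps by simp
  let ?p = "s * (3/4 + (1 - 1 / a\<^sup>2) / 4) powr (s - 1)"
  let ?q = "s * (1 / a - 1/4) powr (s - 1)"
  have l: "(a\<^sup>2 - 1) / (2 * a ^ 3) - (1 - 1 / a\<^sup>2) / 4 = \<epsilon> * ((2 + \<epsilon>) / (2 * a ^ 3) - (2 + \<epsilon>) / (4 * a\<^sup>2))"
    and h: "(a\<^sup>2 - 1) / 2 - (1 - 1 / a\<^sup>2) / 4 = \<epsilon> * ((2 + \<epsilon>) / 2 - (2 + \<epsilon>) / (4 * a\<^sup>2))"
    unfolding e2 e3 by (simp_all add: right_diff_distrib)
  have l0: "0 \<le> (2 + \<epsilon>) / (2 * a ^ 3) - (2 + \<epsilon>) / (4 * a\<^sup>2)"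
  proof -
    have "(2 + \<epsilon>) / (2 * a ^ 3) - (2 + \<epsilon>) / (4 * a\<^sup>2) = (2 + \<epsilon>) * (2 - a) / (4 * a ^ 3)"
      using a_bounds(4) by (simp add: field_simps power2_eq_square power3_eq_cube)
    also have "\<dots> \<ge> 0" using a_bounds small_eps by (intro divide_nonneg_nonneg mult_nonneg_nonneg) auto
    finally show ?thesis .
  qed
  have h0: "0 \<le> (2 + \<epsilon>) / 2 - (2 + \<epsilon>) / (4 * a\<^sup>2)"
  proof -
    have "(2 + \<epsilon>) / (4 * a\<^sup>2) \<le> (2 + \<epsilon>) / 2"
      using a_bounds(3) small_eps by (intro divide_left_mono) auto
    then show ?thesis by simp
  qed
  show "ereal (\<gamma> * (?p * ((2 + \<epsilon>) / (2 * a ^ 3) - (2 + \<epsilon>) / (4 * a\<^sup>2))) / sqrt (1/4 + (a\<^sup>2 - 1) * a\<^sup>2)) \<le> Q"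
  proof -
    have "\<gamma> * (?p * ((2 + \<epsilon>) / (2 * a ^ 3) - (2 + \<epsilon>) / (4 * a\<^sup>2))) / sqrt (1/4 + (a\<^sup>2 - 1) * a\<^sup>2)
        \<le> K * (?p * ((2 + \<epsilon>) / (2 * a ^ 3) - (2 + \<epsilon>) / (4 * a\<^sup>2))) / sqrt (1/4 + (a\<^sup>2 - 1) * a\<^sup>2)"
      using K(1) l0 s a_bounds(3) by (intro divide_right_mono mult_right_mono mult_nonneg_nonneg) auto
    then have "ereal (\<gamma> * (?p * ((2 + \<epsilon>) / (2 * a ^ 3) - (2 + \<epsilon>) / (4 * a\<^sup>2))) / sqrt (1/4 + (a\<^sup>2 - 1) * a\<^sup>2))
        \<le> ereal (\<epsilon> * (K * (?p * ((2 + \<epsilon>) / (2 * a ^ 3) - (2 + \<epsilon>) / (4 * a\<^sup>2))) / sqrt (1/4 + (a\<^sup>2 - 1) * a\<^sup>2))) / ereal \<epsilon>"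
      unfolding div by simp
    also have "\<dots> \<le> Q"
      unfolding Q using lip(2)[unfolded l] small_eps by (intro ereal_divide_right_mono) (auto simp: mult_ac)
    finally show ?thesis .
  qed
  show "Q \<le> ereal (a powr (2 * s) * \<gamma> * (?q * ((2 + \<epsilon>) / 2 - (2 + \<epsilon>) / (4 * a\<^sup>2))) / sqrt (1/4 - \<epsilon> * a ^ 4))"
  proof -
    have "Q \<le> ereal (\<epsilon> * (K * (?q * ((2 + \<epsilon>) / 2 - (2 + \<epsilon>) / (4 * a\<^sup>2))) / sqrt (1/4 - \<epsilon> * a ^ 4))) / ereal \<epsilon>"
      unfolding Q using lip(1)[unfolded h e1] small_eps by (intro ereal_divide_right_mono) (auto simp: mult_ac)
    also have "\<dots> \<le> ereal (a powr (2 * s) * \<gamma> * (?q * ((2 + \<epsilon>) / 2 - (2 + \<epsilon>) / (4 * a\<^sup>2))) / sqrt (1/4 - \<epsilon> * a ^ 4))"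
      unfolding div ereal_less_eq
      using K(2) h0 s small by (intro divide_right_mono mult_right_mono mult_nonneg_nonneg) (auto simp: e1)
    finally show ?thesis .
  qed
qed

theorem proposition7p1:
  fixes n :: nat and s :: real
  assumes "n \<ge> 2" and "CARD('m::finite) = n - 1" and "0 < s" and "s < 1"
  shows
    "(\<forall>\<epsilon>\<in>{0<..<1/4}. \<exists>!u. torsion_solution s (ellipsoid \<epsilon> :: (real \<times> (real ^ 'm)) set) u) \<and>
     (\<exists>G :: real \<Rightarrow> (real \<times> (real ^ 'm)) set.
        (\<forall>\<epsilon>\<in>{0<..<1/4}. open (G \<epsilon>) \<and> G \<epsilon> \<subseteq> ellipsoid \<epsilon> \<and> smooth_boundary (G \<epsilon>) \<and>
           G \<epsilon> + ball 0 (1/2) = ellipsoid \<epsilon>) \<and>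
        (\<forall>u. (\<forall>\<epsilon>\<in>{0<..<1/4}. torsion_solution s (ellipsoid \<epsilon>) (u \<epsilon>)) \<longrightarrow>
           ((\<lambda>\<epsilon>. lip_seminorm (frontier (G \<epsilon>)) (u \<epsilon>)
                   / ereal (rho (ellipsoid \<epsilon> :: (real \<times> (real ^ 'm)) set)))
              \<longlongrightarrow> ereal (s * torsion_const n s * (3/4) powr (s - 1))) (at_right 0)))"
proof (intro conjI ballI exI[of _ thin_ellipsoid.inner_set] allI impI)
  note s = assms(3,4)
  have n: "DIM(real \<times> (real ^ 'm)) = n" using assms(1,2) by simp
  {
    fix \<epsilon> :: real assume "\<epsilon> \<in> {0<..<1/4}"
    then interpret thin_ellipsoid \<epsilon> "1 + \<epsilon>" by unfold_locales auto
    show "\<exists>!u. torsion_solution s (ellipsoid \<epsilon> :: (real \<times> (real ^ 'm)) set) u"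
      using torsion_solution_ellipsoid[OF s, where 'm='m] torsion_solution_unique[OF s bounded_ellipsoid] by metis
    show "open (inner_set :: (real \<times> (real ^ 'm)) set)" by (rule open_inner_set)
    show "inner_set \<subseteq> (ellipsoid \<epsilon> :: (real \<times> (real ^ 'm)) set)" by (rule inner_set_subset)
    show "smooth_boundary (inner_set :: (real \<times> (real ^ 'm)) set)" by (rule smooth_boundary_inner_set)
    show "inner_set + ball 0 (1/2) = (ellipsoid \<epsilon> :: (real \<times> (real ^ 'm)) set)" by (rule inner_set_plus_ball)
  }
  fix u :: "real \<Rightarrow> real \<times> (real ^ 'm) \<Rightarrow> real"
  assume u: "\<forall>\<epsilon>\<in>{0<..<1/4}. torsion_solution s (ellipsoid \<epsilon>) (u \<epsilon>)"
  define \<gamma> where "\<gamma> = torsion_const n s"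
  \<comment> \<open>At \<epsilon> = 0 the powers become (3/4)^(s - 1), the brackets 2/2 - 2/4 = 1/2
    and the roots sqrt (1/4) = 1/2, so both bounds take the value of the limit.\<close>
  let ?L = "\<lambda>\<epsilon>. \<gamma> * (s * (3/4 + (1 - 1 / (1 + \<epsilon>)\<^sup>2) / 4) powr (s - 1)
      * ((2 + \<epsilon>) / (2 * (1 + \<epsilon>) ^ 3) - (2 + \<epsilon>) / (4 * (1 + \<epsilon>)\<^sup>2))) / sqrt (1/4 + ((1 + \<epsilon>)\<^sup>2 - 1) * (1 + \<epsilon>)\<^sup>2)"
  let ?U = "\<lambda>\<epsilon>. (1 + \<epsilon>) powr (2 * s) * \<gamma> * (s * (1 / (1 + \<epsilon>) - 1/4) powr (s - 1)
      * ((2 + \<epsilon>) / 2 - (2 + \<epsilon>) / (4 * (1 + \<epsilon>)\<^sup>2))) / sqrt (1/4 - \<epsilon> * (1 + \<epsilon>) ^ 4)"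
  have sq: "sqrt (1/4) = (1/2 :: real)" by (simp add: real_sqrt_divide)
  have "isCont ?L 0" "isCont ?U 0"
    by (intro continuous_intros; simp)+
  then have "(?L \<longlongrightarrow> ?L 0) (at_right 0)" "(?U \<longlongrightarrow> ?U 0) (at_right 0)"
    unfolding isCont_def filterlim_at_split by auto
  then have lim: "(?L \<longlongrightarrow> s * \<gamma> * (3/4) powr (s - 1)) (at_right 0)" "(?U \<longlongrightarrow> s * \<gamma> * (3/4) powr (s - 1)) (at_right 0)"
    by (simp_all add: sq mult_ac)
  have ev: "\<forall>\<^sub>F \<epsilon> in at_right 0. \<epsilon> \<in> {0<..<1/8::real}"
    by (rule eventually_at_right_real) simp
  show "((\<lambda>\<epsilon>. lip_seminorm (frontier (thin_ellipsoid.inner_set \<epsilon>)) (u \<epsilon>)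
        / ereal (rho (ellipsoid \<epsilon> :: (real \<times> (real ^ 'm)) set)))
      \<longlongrightarrow> ereal (s * torsion_const n s * (3/4) powr (s - 1))) (at_right 0)"
  proof (rule tendsto_sandwich)
    show "((\<lambda>\<epsilon>. ereal (?L \<epsilon>)) \<longlongrightarrow> ereal (s * torsion_const n s * (3/4) powr (s - 1))) (at_right 0)"
      "((\<lambda>\<epsilon>. ereal (?U \<epsilon>)) \<longlongrightarrow> ereal (s * torsion_const n s * (3/4) powr (s - 1))) (at_right 0)"
      using lim by (auto simp: \<gamma>_def)
    show "\<forall>\<^sub>F \<epsilon> in at_right 0. ereal (?L \<epsilon>) \<le> lip_seminorm (frontier (thin_ellipsoid.inner_set \<epsilon>)) (u \<epsilon>)
        / ereal (rho (ellipsoid \<epsilon> :: (real \<times> (real ^ 'm)) set))"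
      using ev
    proof eventually_elim
      fix \<epsilon> :: real assume \<epsilon>: "\<epsilon> \<in> {0<..<1/8}"
      then show "ereal (?L \<epsilon>) \<le> lip_seminorm (frontier (thin_ellipsoid.inner_set \<epsilon>)) (u \<epsilon>)
          / ereal (rho (ellipsoid \<epsilon> :: (real \<times> (real ^ 'm)) set))"
        using lip_quotient_bounds(1)[OF s, of \<epsilon> "u \<epsilon>"] u unfolding n \<gamma>_def by auto
    qed
    show "\<forall>\<^sub>F \<epsilon> in at_right 0. lip_seminorm (frontier (thin_ellipsoid.inner_set \<epsilon>)) (u \<epsilon>)
        / ereal (rho (ellipsoid \<epsilon> :: (real \<times> (real ^ 'm)) set)) \<le> ereal (?U \<epsilon>)"
      using ev
    proof eventually_elim
      fix \<epsilon> :: real assume \<epsilon>: "\<epsilon> \<in> {0<..<1/8}"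
      then show "lip_seminorm (frontier (thin_ellipsoid.inner_set \<epsilon>)) (u \<epsilon>)
          / ereal (rho (ellipsoid \<epsilon> :: (real \<times> (real ^ 'm)) set)) \<le> ereal (?U \<epsilon>)"
        using lip_quotient_bounds(2)[OF s, of \<epsilon> "u \<epsilon>"] u unfolding n \<gamma>_def by auto
    qed
  qed
qed

end
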